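(* Let $n\ge 1$. Let $\tilde{\mathcal{L}}$ be the Lie subalgebra of all $\xi\in\mathcal{L}(sl(2n))$ such that $\psi(\lambda)\xi(\lambda)\psi(\lambda)^{-1}$ is a power series in $\lambda^{2n}$ (positive and negative powers allowed), and set $\tilde{\mathcal{L}}_\pm=\tilde{\mathcal{L}}\cap\mathcal{L}_\pm(sl(2n))$. Then $(\tilde{\mathcal{L}}_+,\tilde{\mathcal{L}}_-)$ is a splitting of $\tilde{\mathcal{L}}$.
   Context: Loop algebras: $\mathcal{L}(sl(2n))$ is the algebra of smooth loops $A(\lambda)=\sum_i A_i\lambda^i:S^1\to sl(2n,\mathbb{C})$; $\mathcal{L}_+(sl(2n))$ and $\mathcal{L}_-(sl(2n))$ are the subalgebras of those $A$ with $A_i=0$ for all $i<0$, respectively for all $i\ge0$. Notation: $e_{ij}$ are elementary matrices, $\alpha=e^{\pi i/n}$, $A=\mathrm{diag}(1,\alpha,\ldots,\alpha^{n-1})$, $\sigma_k=\frac{1-\alpha^{2k}}{1-\alpha^2}$, $\Lambda=\sum_{k=1}^{n-1}\sigma_k e_{k+1,k}\in sl(n,\mathbb{C})$, $c_k=\big(\prod_{i=1}^k\sigma_i\big)^{-1}$ ($c_0=1$), $\phi(\lambda)=\sum_{k=0}^{n-1}c_k\Lambda^k\lambda^k$, and $$\psi(\lambda)=\begin{pmatrix}\phi(\lambda)&0\\ \lambda^n\phi(\lambda)&A\phi(\lambda)A^{-1}\end{pmatrix}.$$ Splitting: for a group $L$ with Lie algebra $\mathcal{L}$ and subgroups $L_\pm$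 with Lie subalgebras $\mathcal{L}_\pm$, the pair $(\mathcal{L}_+,\mathcal{L}_-)$ is called a splitting of $\mathcal{L}$ if $\mathcal{L}=\mathcal{L}_++\mathcal{L}_-$ is a direct sum of linear subspaces and $L_+\cap L_-=\{e\}$. Here the group $\tilde L$ consists of the smooth loops $f:S^1\to SL(2n,\mathbb{C})$ such that $\psi f\psi^{-1}$ is a power series in $\lambda^{2n}$; $\tilde L_+$ is the subgroup of those $f$ extending holomorphically to $|\lambda|<1$, and $\tilde L_-$ the subgroup of those $f$ extending holomorphically to $\infty\ge|\lambda|>1$ with $f(\infty)=\mathrm{I}$. *)

theory Defs
  imports
    "HOL-Complex_Analysis.Complex_Analysis"
    "HOL-Algebra.AbelCoset"
    "Jordan_Normal_Form.VS_Connect"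
    "Jordan_Normal_Form.Gauss_Jordan_Elimination"
begin

section \<open>Matrices\<close>

definition mat_trace :: "complex mat \<Rightarrow> complex" where
  "mat_trace M = (\<Sum>i<dim_row M. M $$ (i, i))"

definition sl :: "nat \<Rightarrow> complex mat set" where
  "sl N = {M \<in> carrier_mat N N. mat_trace M = 0}"

definition SL :: "nat \<Rightarrow> complex mat set" where
  "SL N = {M \<in> carrier_mat N N. Determinant.det M = 1}"

abbreviation minv :: "complex mat \<Rightarrow> complex mat" where
  "minv M \<equiv> the (mat_inverse M)"

definition mat_exp :: "complex mat \<Rightarrow> complex mat" where
  "mat_exp X = Matrix.mat (dim_row X) (dim_row X)
     (\<lambda>(i, j). \<Sum>k. (X ^\<^sub>m k) $$ (i, j) / fact k)"


section \<open>Smooth loops of matrices\<close>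

text \<open>A loop is a function on the unit circle; it takes the value \<open>undefined\<close> elsewhere
  (\<open>\<rightarrow>\<^sub>E\<close>), so that equality of loops is equality on the circle.\<close>

type_synonym loop = "complex \<Rightarrow> complex mat"

abbreviation circle :: "complex set" where
  "circle \<equiv> sphere 0 1"

definition smooth :: "(real \<Rightarrow> complex) \<Rightarrow> bool" where
  "smooth g \<longleftrightarrow> (\<exists>D :: nat \<Rightarrow> real \<Rightarrow> complex. D 0 = g \<and>
     (\<forall>k t. (D k has_vector_derivative D (Suc k) t) (at t)))"

definition smooth_loops :: "nat \<Rightarrow> complex mat set \<Rightarrow> loop set" where
  "smooth_loops N S = {f \<in> circle \<rightarrow>\<^sub>E (S \<inter> carrier_mat N N).
     \<forall>i<N. \<forall>j<N. smooth (\<lambda>\<theta>. f (cis \<theta>) $$ (i, j))}"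

text \<open>The algebra of all smooth loops of complex \<open>N \<times> N\<close> matrices, with pointwise operations;
  \<open>loop_group N\<close> is the group of smooth loops in \<open>SL(N, \<complex>)\<close> with pointwise multiplication.\<close>

definition gl_loops :: "nat \<Rightarrow> (complex, loop) module" where
  "gl_loops N = \<lparr>
     carrier = smooth_loops N (carrier_mat N N),
     monoid.mult = (\<lambda>f g. \<lambda>z\<in>circle. f z * g z),
     one = (\<lambda>z\<in>circle. 1\<^sub>m N),
     zero = (\<lambda>z\<in>circle. 0\<^sub>m N N),
     add = (\<lambda>f g. \<lambda>z\<in>circle. f z + g z),
     module.smult = (\<lambda>a f. \<lambda>z\<in>circle. a \<cdot>\<^sub>m f z)\<rparr>"

definition loop_group :: "nat \<Rightarrow> (complex, loop) module" where
  "loop_group N = (gl_loops N)\<lparr>carrier := smooth_loops N (SL N)\<rparr>"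

definition loop_bracket :: "loop \<Rightarrow> loop \<Rightarrow> loop" where
  "loop_bracket f g = (\<lambda>z\<in>circle. f z * g z - g z * f z)"

definition lie_subalgebra :: "nat \<Rightarrow> loop set \<Rightarrow> bool" where
  "lie_subalgebra N V \<longleftrightarrow> VectorSpace.subspace class_ring V (gl_loops N) \<and>
     (\<forall>f\<in>V. \<forall>g\<in>V. loop_bracket f g \<in> V)"

text \<open>The Lie algebra of a group \<open>G\<close> of loops, as for matrix groups: those \<open>\<xi>\<close> whose
  one-parameter group \<open>exp (t\<xi>)\<close> lies in \<open>G\<close>.\<close>

definition lie_algebra_of :: "nat \<Rightarrow> loop set \<Rightarrow> loop set" where
  "lie_algebra_of N G = {\<xi> \<in> smooth_loops N (carrier_mat N N).
     \<forall>t :: real. (\<lambda>z\<in>circle. mat_exp (complex_of_real t \<cdot>\<^sub>m \<xi> z)) \<in> G}"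


section \<open>Splittings\<close>

definition splitting ::
  "nat \<Rightarrow> loop set \<Rightarrow> loop set \<Rightarrow> loop set \<Rightarrow> loop set \<Rightarrow> loop set \<Rightarrow> loop set \<Rightarrow> bool" where
  "splitting N G Gp Gm V Vp Vm \<longleftrightarrow>
     group (loop_group N) \<and> subgroup G (loop_group N) \<and>
     subgroup Gp ((loop_group N)\<lparr>carrier := G\<rparr>) \<and>
     subgroup Gm ((loop_group N)\<lparr>carrier := G\<rparr>) \<and>
     lie_subalgebra N V \<and> lie_subalgebra N Vp \<and> lie_subalgebra N Vm \<and>
     lie_algebra_of N G = V \<and> lie_algebra_of N Gp = Vp \<and> lie_algebra_of N Gm = Vm \<and>
     V = Vp <+>\<^bsub>gl_loops N\<^esub> Vm \<and> Vp \<inter> Vm = {\<zero>\<^bsub>gl_loops N\<^esub>} \<and>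
     Gp \<inter> Gm = {\<one>\<^bsub>loop_group N\<^esub>}"


section \<open>Laurent expansions of loops\<close>

text \<open>\<open>S = \<Sum>m\<in>\<int>. a\<^sub>m w\<^sup>m\<close>, entrywise. For a smooth loop the expansion exists, is unique
  and converges absolutely, so the (unconditional) mode of convergence does not matter.\<close>

definition laurent_sum ::
  "nat \<Rightarrow> complex \<Rightarrow> (int \<Rightarrow> complex mat) \<Rightarrow> complex mat \<Rightarrow> bool" where
  "laurent_sum N w a S \<longleftrightarrow> (\<forall>m. a m \<in> carrier_mat N N) \<and>
     (\<forall>i<N. \<forall>j<N. ((\<lambda>m. a m $$ (i, j) * w powi m) has_sum S $$ (i, j)) UNIV)"

definition power_series_in :: "nat \<Rightarrow> nat \<Rightarrow> loop \<Rightarrow> bool" where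
  "power_series_in N d f \<longleftrightarrow> (\<exists>a. \<forall>z\<in>circle. laurent_sum N (z ^ d) a (f z))"

definition sl_loops :: "nat \<Rightarrow> loop set" where
  "sl_loops N = smooth_loops N (sl N)"

definition sl_loops_plus :: "nat \<Rightarrow> loop set" where
  "sl_loops_plus N = {f \<in> sl_loops N.
     \<exists>a. (\<forall>z\<in>circle. laurent_sum N z a (f z)) \<and> (\<forall>m<0. a m = 0\<^sub>m N N)}"

definition sl_loops_minus :: "nat \<Rightarrow> loop set" where
  "sl_loops_minus N = {f \<in> sl_loops N.
     \<exists>a. (\<forall>z\<in>circle. laurent_sum N z a (f z)) \<and> (\<forall>m\<ge>0. a m = 0\<^sub>m N N)}"


section \<open>The matrix \<open>\<psi>\<close>\<close>

definition alpha :: "nat \<Rightarrow> complex" where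
  "alpha n = exp (of_real pi * \<i> / of_nat n)"

definition diagA :: "nat \<Rightarrow> complex mat" where
  "diagA n = Matrix.mat n n (\<lambda>(i, j). if i = j then alpha n ^ i else 0)"

definition sigma :: "nat \<Rightarrow> nat \<Rightarrow> complex" where
  "sigma n k = (1 - alpha n ^ (2 * k)) / (1 - alpha n ^ 2)"

text \<open>Matrix indices start at \<open>0\<close> here, so the coefficient \<open>\<sigma>\<^sub>k\<close> of \<open>e\<^bsub>k+1,k\<^esub>\<close> is the entry
  in row \<open>k\<close> and column \<open>k - 1\<close>.\<close>

definition Lambda :: "nat \<Rightarrow> complex mat" where
  "Lambda n = Matrix.mat n n (\<lambda>(i, j). if i = j + 1 then sigma n (j + 1) else 0)"

definition coeff_c :: "nat \<Rightarrow> nat \<Rightarrow> complex" where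
  "coeff_c n k = inverse (\<Prod>i = 1..k. sigma n i)"

definition phi :: "nat \<Rightarrow> complex \<Rightarrow> complex mat" where
  "phi n z = Matrix.mat n n (\<lambda>(i, j). \<Sum>k<n. coeff_c n k * (Lambda n ^\<^sub>m k) $$ (i, j) * z ^ k)"

definition psi :: "nat \<Rightarrow> complex \<Rightarrow> complex mat" where
  "psi n z = four_block_mat
     (phi n z)               (0\<^sub>m n n)
     (z ^ n \<cdot>\<^sub>m phi n z)    (diagA n * phi n z * minv (diagA n))"

definition psi_conj :: "nat \<Rightarrow> loop \<Rightarrow> loop" where
  "psi_conj n f = (\<lambda>z\<in>circle. psi n z * f z * minv (psi n z))"


section \<open>The twisted loop algebra and loop group\<close>

definition lie_L :: "nat \<Rightarrow> loop set" where
  "lie_L n = {\<xi> \<in> sl_loops (2 * n). power_series_in (2 * n) (2 * n) (psi_conj n \<xi>)}"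

definition lie_L_plus :: "nat \<Rightarrow> loop set" where
  "lie_L_plus n = lie_L n \<inter> sl_loops_plus (2 * n)"

definition lie_L_minus :: "nat \<Rightarrow> loop set" where
  "lie_L_minus n = lie_L n \<inter> sl_loops_minus (2 * n)"

definition grp_L :: "nat \<Rightarrow> loop set" where
  "grp_L n = {f \<in> smooth_loops (2 * n) (SL (2 * n)).
     power_series_in (2 * n) (2 * n) (psi_conj n f)}"

text \<open>\<open>f\<close>, given on the circle, is the boundary value of an \<open>SL(N, \<complex>)\<close>-valued map \<open>F\<close> that is
  continuous on the closed disc and holomorphic on the open disc.\<close>

definition disc_extension :: "nat \<Rightarrow> (complex \<Rightarrow> complex mat) \<Rightarrow> (complex \<Rightarrow> complex mat) \<Rightarrow> bool" where
  "disc_extension N f F \<longleftrightarrow>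
     (\<forall>z\<in>cball 0 1. F z \<in> SL N) \<and> (\<forall>z\<in>circle. F z = f z) \<and>
     (\<forall>i<N. \<forall>j<N. continuous_on (cball 0 1) (\<lambda>z. F z $$ (i, j)) \<and>
                   (\<lambda>z. F z $$ (i, j)) holomorphic_on ball 0 1)"

definition grp_L_plus :: "nat \<Rightarrow> loop set" where
  "grp_L_plus n = {f \<in> grp_L n. \<exists>F. disc_extension (2 * n) f F}"

text \<open>The exterior domain, including \<open>\<infinity>\<close>, is described in the coordinate \<open>w = 1/\<lambda>\<close>.\<close>

definition grp_L_minus :: "nat \<Rightarrow> loop set" where
  "grp_L_minus n = {f \<in> grp_L n.
     \<exists>F. disc_extension (2 * n) (\<lambda>w. f (1 / w)) F \<and> F 0 = 1\<^sub>m (2 * n)}"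

end

theory Submission
  imports Defs "Jordan_Normal_Form.Schur_Decomposition"
begin

text \<open>
  Let \<open>\<xi> = \<psi>\<^sup>-\<^sup>1 Y \<psi>\<close> with \<open>Y\<close> a power series in \<open>\<lambda>\<^sup>2\<^sup>n\<close>. As \<open>\<psi>\<close> and \<open>\<psi>\<^sup>-\<^sup>1\<close> are polynomials of degree less than \<open>2n\<close>,
  the nonnegative part of \<open>Y\<close> contributes only nonnegative degrees to \<open>\<xi>\<close>, the terms of degree at most \<open>-4n\<close> only
  negative ones, and only the coefficient \<open>E\<close> of \<open>\<lambda>\<^sup>-\<^sup>2\<^sup>n\<close> contributes to both. The crucial fact is that the nonnegative
  part of \<open>\<lambda>\<^sup>-\<^sup>2\<^sup>n \<psi>\<^sup>-\<^sup>1 E \<psi>\<close> is \<open>\<psi>\<^sup>-\<^sup>1 P \<psi>\<close> for a constant matrix \<open>P\<close>; it comes from the identity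
  \<open>\<phi>(q\<lambda>) = \<phi>(\<lambda>) (1 - (1 - q) \<lambda> \<Lambda>)\<close>, \<open>q = \<alpha>\<^sup>2\<close>, of the truncated q-exponential \<open>\<phi>\<close>.

  Being a power series in \<open>\<lambda>\<^sup>2\<^sup>n\<close> means invariance under the rotation by \<open>\<alpha>\<close>, and extending holomorphically to one side
  of the circle means the vanishing of half of the Fourier coefficients. Hence \<open>exp (t\<xi>) = 1 + t\<xi> + O(t\<^sup>2)\<close> transfers
  these conditions from the one-parameter groups to the Lie algebras.
\<close>

hide_const (open) Determinants.det Finite_Cartesian_Product.mat

section \<open>Smooth functions\<close>

text \<open>The obstacle is that cutting a twisted loop at degree 0 destroys the twisting: the
  degrees of \<open>\<lambda>\<close>^(-2n) psi^(-1) E psi run up to 2n - 2, and its nonnegative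
  part must be recognised as a conjugate of something constant. This works because q is a primitive
  n-th root of unity. The coefficients Xi_m of phi(beta z)^(-1) X phi(z) satisfy (q^(m+1) - 1)
  Xi_(m+1) = (1 - q) (beta q^m Lambda Xi_m - Xi_m Lambda), and the factor on the left vanishes first
  for m + 1 = n. So Xi_n is not determined by the recursion and acts as a fresh initial value in
  place of X; the part of degree at least n is z^n times the conjugate of Xi_n. The block z^n phi of
  \<open>psi\<close> and alpha^n = -1 let the corrections of all blocks fit into a single constant
  matrix. Tracelessness of the plus part is not read off from this matrix: the trace extends to both
  sides of the circle and vanishes at infinity. Inverses in SL are adjugates, hence polynomials in
  the entries, so smoothness and holomorphy survive inversion.\<close>

definition ring_closed :: "('x \<Rightarrow> complex) set \<Rightarrow> bool" where
  "ring_closed S \<longleftrightarrow> (\<forall>c. (\<lambda>_. c) \<in> S) \<and>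
     (\<forall>f\<in>S. \<forall>g\<in>S. (\<lambda>x. f x + g x) \<in> S \<and> (\<lambda>x. f x * g x) \<in> S)"

primrec Cn :: "nat \<Rightarrow> (real \<Rightarrow> complex) \<Rightarrow> bool" where
  "Cn 0 g \<longleftrightarrow> True"
| "Cn (Suc k) g \<longleftrightarrow> (\<exists>g'. (\<forall>t. (g has_vector_derivative g' t) (at t)) \<and> Cn k g')"

lemma Cn_SucD: "Cn (Suc k) g \<Longrightarrow> Cn k g"
  by (induction k arbitrary: g) auto

text \<open>\<open>smooth\<close> asks for one sequence of all derivatives, \<open>Cn k\<close> for
  a chain of length k that may depend on k. They agree because derivatives on the real line are
  unique, so every chain consists of the iterates of \<open>vector_derivative\<close>.\<close>

lemma smooth_iff_Cn: "smooth g \<longleftrightarrow> (\<forall>k. Cn k g)"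
proof
  assume "smooth g"
  then obtain D where D: "D 0 = g" "\<And>k t. (D k has_vector_derivative D (Suc k) t) (at t)"
    unfolding smooth_def by blast
  have "Cn k (D j)" for k j
    by (induction k arbitrary: j) (use D in auto)
  then show "\<forall>k. Cn k g" using D(1) by metis
next
  assume all: "\<forall>k. Cn k g"
  define vd :: "(real \<Rightarrow> complex) \<Rightarrow> real \<Rightarrow> complex"
    where "vd g t = vector_derivative g (at t)" for g t
  have vd: "g' = vd g" if "\<forall>t. (g has_vector_derivative g' t) (at t)" for g g'
    using that by (auto simp: vd_def fun_eq_iff intro!: vector_derivative_at[symmetric])
  have step: "(\<forall>t. (g has_vector_derivative vd g t) (at t)) \<and> (\<forall>k. Cn k (vd g))"
    if g: "\<forall>k. Cn k g" for g
  proof -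
    have "(\<forall>t. (g has_vector_derivative vd g t) (at t)) \<and> Cn k (vd g)" for k
    proof -
      from g have "Cn (Suc k) g" by blast
      then obtain g' where "\<forall>t. (g has_vector_derivative g' t) (at t)" "Cn k g'" by auto
      with vd show ?thesis by metis
    qed
    then show ?thesis by blast
  qed
  have it: "\<forall>k. Cn k ((vd ^^ j) g)" for j
    by (induction j) (use all step in auto)
  show "smooth g"
    unfolding smooth_def
    by (rule exI[of _ "\<lambda>j. (vd ^^ j) g"]) (use it step in auto)
qed

text \<open>A family closed under differentiation consists of smooth functions. The families used
  below (multiples of \<open>cis\<close>, rapidly convergent power series, entries of matrix
  exponentials) are chosen so that one derivative lands in the family again; no formula for higher
  derivatives is required.\<close>

lemma smooth_coinduct:
  assumes "g \<in> S" "\<And>g. g \<in> S \<Longrightarrow> \<exists>g'\<in>S. \<forall>t. (g has_vector_derivative g' t) (at t)"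
  shows "smooth g"
proof -
  have "\<forall>g\<in>S. Cn k g" for k
    by (induction k) (use assms(2) in \<open>auto, metis\<close>)
  then show ?thesis using assms(1) smooth_iff_Cn by blast
qed

lemma smooth_const: "smooth (\<lambda>_. c)"
  by (rule smooth_coinduct[of _ "range (\<lambda>c _. c)"]) (auto intro!: has_vector_derivative_const)

lemma Cn_add: "Cn k f \<Longrightarrow> Cn k g \<Longrightarrow> Cn k (\<lambda>x. f x + g x)"
proof (induction k arbitrary: f g)
  case (Suc k)
  then obtain f' g' where "\<forall>t. (f has_vector_derivative f' t) (at t)" "Cn k f'"
     "\<forall>t. (g has_vector_derivative g' t) (at t)" "Cn k g'" by auto
  then show ?case using Suc.IH[of f' g']
    by (auto intro!: exI[of _ "\<lambda>x. f' x + g' x"] has_vector_derivative_add)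
qed auto

lemma Cn_mult: "Cn k f \<Longrightarrow> Cn k g \<Longrightarrow> Cn k (\<lambda>x. f x * g x)"
proof (induction k arbitrary: f g)
  case (Suc k)
  then obtain f' g' where *: "\<forall>t. (f has_vector_derivative f' t) (at t)" "Cn k f'"
     "\<forall>t. (g has_vector_derivative g' t) (at t)" "Cn k g'" by auto
  have "Cn k (\<lambda>x. f x * g' x + f' x * g x)"
    using Suc.IH Suc.prems[THEN Cn_SucD] * by (auto intro!: Cn_add)
  then show ?case using * 
    by (auto intro!: exI[of _ "\<lambda>x. f x * g' x + f' x * g x"] has_vector_derivative_mult)
qed auto

lemma ring_closed_smooth: "ring_closed (Collect smooth)"
  by (auto simp: ring_closed_def smooth_const) (auto simp: smooth_iff_Cn Cn_add Cn_mult)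

lemma smooth_has_derivative:
  assumes "smooth f"
  obtains f' where "smooth f'" "\<And>t. (f has_vector_derivative f' t) (at t)"
proof -
  obtain D where D: "D 0 = f" "\<And>k t. (D k has_vector_derivative D (Suc k) t) (at t)"
    using assms unfolding smooth_def by blast
  then have "smooth (D 1)"
    unfolding smooth_def by (intro exI[of _ "\<lambda>k. D (Suc k)"]) auto
  with D show thesis by (intro that[of "D 1"]) (metis One_nat_def)+
qed

lemma smooth_continuous: "smooth f \<Longrightarrow> continuous_on S f"
  by (meson continuous_at_imp_continuous_on has_vector_derivative_continuous smooth_has_derivative)

text \<open>The family carries a scalar factor because each differentiation of
  \<open>g (- t)\<close> changes the sign.\<close>

lemma smooth_reflect: "smooth g \<Longrightarrow> smooth (\<lambda>t. g (- t))"
proof -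
  assume "smooth g"
  moreover have "\<exists>h'\<in>{\<lambda>t. c * g (- t) | c g. smooth g}. \<forall>t. (h has_vector_derivative h' t) (at t)"
    if "h \<in> {\<lambda>t. c * g (- t) | c g. smooth g}" for h
  proof -
    from that obtain c g where h: "h = (\<lambda>t. c * g (- t))" "smooth g" by blast
    obtain g' where g': "smooth g'" "\<And>t. (g has_vector_derivative g' t) (at t)"
      using h smooth_has_derivative by blast
    have "((\<lambda>t. g (- t)) has_vector_derivative - g' (- t)) (at t)" for t
    proof -
      have "(uminus has_vector_derivative - 1) (at t)"
        using has_vector_derivative_minus[OF has_vector_derivative_id[of "at t"]] by simp
      from vector_diff_chain_at[OF this g'(2)] show ?thesis by (simp add: o_def)
    qed
    then have "(h has_vector_derivative c * (- g' (- t))) (at t)" for t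
      unfolding h by (intro has_vector_derivative_mult_right)
    then show ?thesis using g'(1) by (intro bexI[of _ "\<lambda>t. (- c) * g' (- t)"]) (auto intro!: exI[of _ "-c"] exI[of _ g'])
  qed
  ultimately show ?thesis
    by (intro smooth_coinduct[of _ "{\<lambda>t. c * g (- t) | c g. smooth g}"]) (auto intro!: exI[of _ 1])
qed

lemma has_vector_derivative_cis_mult:
  "((\<lambda>t. cis (a * t)) has_vector_derivative \<i> * of_real a * cis (a * t)) (at t)"
proof -
  have "((\<lambda>z. exp (\<i> * of_real a * z)) has_field_derivative \<i> * of_real a * exp (\<i> * of_real a * of_real t)) (at (of_real t))"
    by (auto intro!: derivative_eq_intros)
  then have "((\<lambda>t. exp (\<i> * of_real a * of_real t)) has_vector_derivative \<i> * of_real a * exp (\<i> * of_real a * of_real t)) (at t)"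
    by (rule has_vector_derivative_real_field)
  then show ?thesis by (simp add: cis_conv_exp mult.assoc)
qed

lemma smooth_cis: "smooth (\<lambda>t. cis (a * t))"
proof (rule smooth_coinduct[of _ "{\<lambda>t. c * cis (a * t) | c. True}"], goal_cases)
  case (2 g)
  then obtain c where c: "g = (\<lambda>t. c * cis (a * t))" by blast
  have "(g has_vector_derivative c * (\<i> * of_real a * cis (a * t))) (at t)" for t
    unfolding c by (intro has_vector_derivative_mult_right has_vector_derivative_cis_mult)
  then show ?case
    by (intro bexI[of _ "\<lambda>t. (c * (\<i> * of_real a)) * cis (a * t)"]) (auto simp: mult.assoc[symmetric])
qed (auto intro!: exI[of _ 1])

text \<open>Termwise differentiation under a summable majorant of the derivatives. \<open>S\<close>
  may be a bounded interval, since for matrix exponentials the majorant is only local.\<close>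

lemma has_vector_derivative_series:
  fixes f :: "nat \<Rightarrow> real \<Rightarrow> complex"
  assumes S: "convex S" "open S"
    and d: "\<And>n t. t \<in> S \<Longrightarrow> (f n has_vector_derivative f' n t) (at t)"
    and B: "\<And>n t. t \<in> S \<Longrightarrow> norm (f' n t) \<le> B n" "summable B"
    and s: "\<And>t. t \<in> S \<Longrightarrow> summable (\<lambda>n. f n t)" and x: "x \<in> S"
  shows "((\<lambda>t. \<Sum>n. f n t) has_vector_derivative (\<Sum>n. f' n x)) (at x)"
proof -
  have ul: "uniform_limit S (\<lambda>n t. \<Sum>m<n. f' m t) (\<lambda>t. \<Sum>m. f' m t) sequentially"
    by (rule Weierstrass_m_test[OF B])
  have "\<exists>G. \<forall>t\<in>S. (\<lambda>m. f m t) sums G t \<and> (G has_derivative (\<lambda>h. h *\<^sub>R (\<Sum>m. f' m t))) (at t within S)"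
  proof (rule has_derivative_series[where f' = "\<lambda>m t h. h *\<^sub>R f' m t"])
    show "(f m has_derivative (\<lambda>h. h *\<^sub>R f' m t)) (at t within S)" if "t \<in> S" for m t
      using d[OF that] unfolding has_vector_derivative_def by (rule has_derivative_at_withinI)
    show "(\<lambda>m. f m x) sums (\<Sum>m. f m x)" by (rule summable_sums[OF s[OF x]])
    show "\<forall>\<^sub>F n in sequentially. \<forall>t\<in>S. \<forall>h. norm ((\<Sum>i<n. h *\<^sub>R f' i t) - h *\<^sub>R (\<Sum>m. f' m t)) \<le> e * norm h" if "e > 0" for e
    proof -
      have "\<forall>\<^sub>F n in sequentially. \<forall>t\<in>S. dist (\<Sum>i<n. f' i t) (\<Sum>m. f' m t) < e"
        using ul that unfolding uniform_limit_iff by blast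
      then show ?thesis
      proof eventually_elim
        case (elim n)
        show ?case
        proof (intro ballI allI)
          fix t h assume t: "t \<in> S"
          have "norm (h *\<^sub>R ((\<Sum>i<n. f' i t) - (\<Sum>m. f' m t))) \<le> \<bar>h\<bar> * e"
            unfolding norm_scaleR using elim t by (intro mult_left_mono) (auto simp: dist_norm less_imp_le)
          then show "norm ((\<Sum>i<n. h *\<^sub>R f' i t) - h *\<^sub>R (\<Sum>m. f' m t)) \<le> e * norm h"
            by (simp add: scaleR_right_diff_distrib scaleR_sum_right mult.commute)
        qed
      qed
    qed
  qed (use S x in auto)
  then obtain G where G: "\<And>t. t \<in> S \<Longrightarrow> (\<lambda>m. f m t) sums G t"
      "\<And>t. t \<in> S \<Longrightarrow> (G has_derivative (\<lambda>h. h *\<^sub>R (\<Sum>m. f' m t))) (at t within S)"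
    by blast
  have "(G has_vector_derivative (\<Sum>m. f' m x)) (at x)"
    using G(2)[OF x] at_within_open[OF x S(2)] by (simp add: has_vector_derivative_def)
  then show ?thesis
    by (rule has_vector_derivative_transform_within_open[OF _ S(2) x]) (use G(1) in \<open>simp add: sums_iff\<close>)
qed

section \<open>Fourier coefficients\<close>

definition fc :: "(real \<Rightarrow> complex) \<Rightarrow> int \<Rightarrow> complex" where
  "fc g m = integral {0..2*pi} (\<lambda>t. g t * cis (- (of_int m * t))) / (2*pi)"

lemma fc_integrable:
  assumes "continuous_on UNIV g"
  shows "(\<lambda>t. g t * cis (- (of_int m * t))) integrable_on {0..2*pi}"
  by (intro integrable_continuous_interval continuous_intros continuous_on_subset[OF assms]) auto

lemma fc_add:
  assumes "continuous_on UNIV f" "continuous_on UNIV g"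
  shows "fc (\<lambda>t. f t + g t) m = fc f m + fc g m"
  unfolding fc_def
  by (simp add: distrib_right add_divide_distrib integral_add fc_integrable assms)

lemma fc_cmult: "fc (\<lambda>t. c * g t) m = c * fc g m"
  unfolding fc_def by (simp add: mult.assoc)

lemma fc_shift: "fc (\<lambda>t. g t * cis (of_int k * t)) m = fc g (m - k)"
  unfolding fc_def by (simp add: mult.assoc cis_mult algebra_simps)

lemma fc_norm_le:
  assumes "continuous_on UNIV g" "\<And>t. t \<in> {0..2*pi} \<Longrightarrow> norm (g t) \<le> B"
  shows "norm (fc g m) \<le> B"
proof -
  have "norm (integral {0..2*pi} (\<lambda>t. g t * cis (- (of_int m * t)))) \<le> B * (2*pi - 0)"
    using assms by (intro integral_bound continuous_intros continuous_on_subset[OF assms(1)]) (auto simp: norm_mult)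
  then show ?thesis unfolding fc_def by (simp add: norm_divide field_simps)
qed

text \<open>Integration by parts. The boundary terms cancel because \<open>g\<close> and
  \<open>cis\<close> take the same values at 0 and at 2 pi.\<close>

lemma fc_deriv:
  assumes "\<And>t. (g has_vector_derivative g' t) (at t)" "continuous_on UNIV g'" "g (2*pi) = g 0"
  shows "fc g' m = \<i> * of_int m * fc g m"
proof -
  have cg: "continuous_on UNIV g"
    using assms(1) by (meson continuous_at_imp_continuous_on has_vector_derivative_continuous)
  have d: "((\<lambda>t. g t * cis (- of_int m * t)) has_vector_derivative
      (g t * (\<i> * of_real (- of_int m) * cis (- of_int m * t)) + g' t * cis (- of_int m * t))) (at t within {0..2*pi})" for t
    by (rule has_vector_derivative_at_within, intro has_vector_derivative_mult assms(1) has_vector_derivative_cis_mult)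
  have "((\<lambda>t. g t * (\<i> * of_real (- of_int m) * cis (- of_int m * t)) + g' t * cis (- of_int m * t)) has_integral
       ((\<lambda>t. g t * cis (- of_int m * t)) (2*pi) - (\<lambda>t. g t * cis (- of_int m * t)) 0)) {0..2*pi}"
    by (rule fundamental_theorem_of_calculus) (use d in auto)
  moreover have "cis (- (of_int m * (2 * pi))) = 1"
    by (metis cis_cnj cis_multiple_2pi complex_cnj_one mult.commute Ints_of_int)
  ultimately have "((\<lambda>t. (- \<i> * of_int m) * (g t * cis (- (of_int m * t))) + g' t * cis (- (of_int m * t))) has_integral 0) {0..2*pi}"
    using assms(3) by (simp add: mult.commute mult.left_commute)
  then have "integral {0..2*pi} (\<lambda>t. (- \<i> * of_int m) * (g t * cis (- (of_int m * t))) + g' t * cis (- (of_int m * t))) = 0"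
    by (rule integral_unique)
  then have "(- \<i> * of_int m) * integral {0..2*pi} (\<lambda>t. g t * cis (- (of_int m * t))) + integral {0..2*pi} (\<lambda>t. g' t * cis (- (of_int m * t))) = 0"
    unfolding integral_add[OF integrable_on_mult_right[OF fc_integrable[OF cg]] fc_integrable[OF assms(2)]]
    by (simp only: integral_mult_right)
  then show ?thesis unfolding fc_def by (simp add: field_simps add_eq_0_iff)
qed

lemma fc_const: "fc (\<lambda>_. c) m = (if m = 0 then c else 0)"
proof (cases "m = 0")
  case False
  \<comment> \<open>The derivative of a constant is 0, so i m times its coefficient is 0.\<close>
  have "fc (\<lambda>_. 0) m = \<i> * of_int m * fc (\<lambda>_. c) m"
    by (rule fc_deriv) auto
  moreover have "fc (\<lambda>_. 0) m = 0" by (simp add: fc_def)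
  ultimately show ?thesis using False by simp
qed (simp add: fc_def scaleR_conv_of_real)

section \<open>Functions on the circle are determined by their Fourier coefficients\<close>

lemma circle_cis: "z \<in> circle \<longleftrightarrow> (\<exists>t. z = cis t)"
proof
  assume "z \<in> circle"
  then have "z = cis (Arg z)" using cis_Arg[of z] by (force simp: sgn_div_norm)
  then show "\<exists>t. z = cis t" ..
qed auto

lemma cis_in_circle [simp]: "cis t \<in> circle"
  by simp

lemma circle_nonzero: "z \<in> circle \<Longrightarrow> z \<noteq> 0"
  by auto

text \<open>Near \<open>z0 = cis t0\<close> the angle \<open>t0 + Arg (z / z0)\<close> is a local
  inverse of \<open>cis\<close>, and it is continuous at \<open>z0\<close> because
  \<open>Arg\<close> is continuous at 1.\<close>

lemma continuous_on_circle:
  assumes "continuous_on UNIV (\<lambda>t. u (cis t) :: complex)"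
  shows "continuous_on circle u"
proof -
  have "continuous (at z0 within circle) u" if z0: "z0 \<in> circle" for z0
  proof -
    obtain t0 where t0: "z0 = cis t0" using z0 circle_cis by blast
    define h where "h z = u (cis (t0 + Arg (z / z0)))" for z
    have nz: "z0 \<noteq> 0" using z0 by auto
    have "isCont (\<lambda>z. Arg (z / z0)) z0"
      by (rule continuous_at_compose[of z0 "\<lambda>z. z / z0" Arg, unfolded o_def])
         (use nz in \<open>auto intro!: continuous_intros continuous_at_Arg\<close>)
    moreover have "isCont (\<lambda>t. u (cis t)) (t0 + Arg (z0 / z0))"
      using assms by (simp add: continuous_on_eq_continuous_at)
    ultimately have "isCont h z0"
      unfolding h_def
      using continuous_at_compose[of z0 "\<lambda>z. t0 + Arg (z / z0)" "\<lambda>t. u (cis t)"]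
      by (auto simp: o_def intro!: continuous_intros)
    then have ch: "continuous (at z0 within circle) h"
      by (simp add: continuous_at_imp_continuous_at_within)
    have "h z = u z" if "z \<in> circle" for z
    proof -
      have "norm (z / z0) = 1" using that z0 by (simp add: norm_divide)
      then have "cis (Arg (z / z0)) = z / z0" using cis_Arg[of "z / z0"] that z0 by (force simp: sgn_div_norm)
      then have "cis (t0 + Arg (z / z0)) = z" using nz by (simp add: cis_mult[symmetric] t0[symmetric])
      then show ?thesis by (simp add: h_def)
    qed
    then show ?thesis
      using ch z0 by (auto simp: continuous_within_eps_delta)
  qed
  then show ?thesis by (simp add: continuous_on_eq_continuous_within)
qed

lemma continuous_on_polynomial_cis_mult:
  fixes g :: "real \<Rightarrow> complex"
  assumes "real_polynomial_function p" "continuous_on UNIV g"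
  shows "continuous_on UNIV (\<lambda>t. of_real (p (cis t)) * g t)"
proof -
  have "continuous_on UNIV p"
    using assms(1) by (simp add: real_polynomial_function_eq continuous_on_polymonial_function)
  then have "continuous_on UNIV (\<lambda>t. p (cis t))"
    by (rule continuous_on_compose2) (auto intro!: continuous_on_cis continuous_on_id)
  then show ?thesis by (auto intro!: continuous_on_mult continuous_on_of_real assms(2))
qed

text \<open>Multiplication by real polynomials in the coordinates preserves the vanishing of all Fourier
  coefficients, and these polynomials are dense.\<close>

lemma fc_zero_mult_polynomial:
  assumes "real_polynomial_function p" "continuous_on UNIV g" "\<And>m. fc g m = 0"
  shows "\<forall>m. fc (\<lambda>t. of_real (p (cis t)) * g t) m = 0"
  using assms
proof (induction p arbitrary: g)
  case (linear f)
  interpret f: bounded_linear f by fact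
  \<comment> \<open>Every real-linear form on the complex plane is \<open>A * z + B * cnj z\<close>.
    On the circle \<open>cnj z\<close> is \<open>cis (- t)\<close>, so multiplication by
    \<open>f\<close> only shifts the Fourier index by 1 and by -1.\<close>
  define A where "A = (of_real (f 1) - \<i> * of_real (f \<i>)) / 2"
  define B where "B = (of_real (f 1) + \<i> * of_real (f \<i>)) / 2"
  have "of_real (f (cis t)) * g t = A * (g t * cis (of_int 1 * t)) + B * (g t * cis (of_int (-1) * t))" for t
  proof -
    have "cis t = cos t *\<^sub>R 1 + sin t *\<^sub>R \<i>" by (simp add: complex_eq_iff)
    then have "f (cis t) = cos t * f 1 + sin t * f \<i>" by (simp add: f.add f.scaleR)
    then show ?thesis
      by (simp add: A_def B_def complex_eq_iff field_simps)
  qed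
  then have "fc (\<lambda>t. of_real (f (cis t)) * g t) m = 0" for m
    using linear fc_shift[of g 1] fc_shift[of g "-1"]
    by (simp add: fc_add fc_cmult continuous_intros continuous_on_cis)
  then show ?case by blast
next
  case (const c)
  then show ?case by (simp add: fc_cmult)
next
  case (add p q)
  then show ?case
    by (simp add: distrib_right fc_add continuous_on_polynomial_cis_mult)
next
  case (mult p q)
  then show ?case
    using mult.IH(1)[OF continuous_on_polynomial_cis_mult[OF mult.hyps(2) mult.prems(1)]]
    by (simp add: mult.assoc)
qed

text \<open>By Stone-Weierstrass \<open>u\<close> is orthogonal to every real continuous function on
  the circle. Testing against \<open>Re u\<close> and \<open>Im u\<close> themselves shows that the
  integrals of their squares vanish.\<close>

lemma fc_zero_imp_zero:
  assumes cont: "continuous_on UNIV (\<lambda>t. u (cis t))" and fc0: "\<And>m. fc (\<lambda>t. u (cis t)) m = 0"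
  shows "u (cis t) = 0"
proof -
  let ?g = "\<lambda>t. u (cis t)"
  obtain B where B: "B > 0" "\<And>t. norm (u (cis t)) \<le> B"
  proof -
    have "compact (u ` circle)"
      by (intro compact_continuous_image continuous_on_circle cont) auto
    then obtain B where "B > 0" "\<forall>x\<in>u ` circle. norm x \<le> B"
      using bounded_pos compact_imp_bounded by metis
    then show thesis using that[of B] by auto
  qed
  have orth: "integral {0..2*pi} (\<lambda>t. of_real (q (cis t)) * u (cis t)) = 0"
    if q: "continuous_on circle q" for q :: "complex \<Rightarrow> real"
  proof -
    have cq: "continuous_on UNIV (\<lambda>t. of_real (q (cis t)) * u (cis t))"
      by (intro continuous_intros cont continuous_on_compose2[OF q]) auto
    have "norm (fc (\<lambda>t. of_real (q (cis t)) * u (cis t)) 0) \<le> e" if e: "e > 0" for e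
    proof -
      obtain p where p: "real_polynomial_function p" "\<And>x. x \<in> circle \<Longrightarrow> \<bar>q x - p x\<bar> < e / B"
        using Stone_Weierstrass_real_polynomial_function[OF compact_sphere q, of "e / B"] e B(1) by auto
      have cp: "continuous_on UNIV (\<lambda>t. of_real (p (cis t)) * u (cis t))"
        by (rule continuous_on_polynomial_cis_mult[OF p(1) cont])
      have eq: "of_real (q (cis t)) * u (cis t) = of_real (q (cis t) - p (cis t)) * u (cis t) + of_real (p (cis t)) * u (cis t)" for t
        by (simp add: algebra_simps)
      have cd: "continuous_on UNIV (\<lambda>t. of_real (q (cis t) - p (cis t)) * u (cis t))"
        using continuous_on_diff[OF cq cp] by (simp add: algebra_simps)
      have "fc (\<lambda>t. of_real (q (cis t)) * u (cis t)) 0 = fc (\<lambda>t. of_real (q (cis t) - p (cis t)) * u (cis t)) 0"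
        unfolding eq using fc_add[OF cd cp] fc_zero_mult_polynomial[OF p(1) cont fc0] by simp
      also have "norm \<dots> \<le> e"
      proof (rule fc_norm_le[OF cd])
        fix t
        have "norm (of_real (q (cis t) - p (cis t)) * u (cis t)) \<le> (e / B) * B"
          unfolding norm_mult norm_of_real using p(2)[of "cis t"] B e by (intro mult_mono) auto
        then show "norm (of_real (q (cis t) - p (cis t)) * u (cis t)) \<le> e" using B by simp
      qed
      finally show ?thesis .
    qed
    then have "fc (\<lambda>t. of_real (q (cis t)) * u (cis t)) 0 = 0"
      using field_le_epsilon[of "norm (fc (\<lambda>t. of_real (q (cis t)) * u (cis t)) 0)" 0] by auto
    then show ?thesis by (simp add: fc_def)
  qed
  have cc: "continuous_on circle u" by (rule continuous_on_circle[OF cont])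
  have zero: "L (u (cis t)) = 0" if t: "t \<in> {0..2*pi}" and L: "L = Re \<or> L = Im" for t L
  proof -
    have bl: "bounded_linear L" using L bounded_linear_Re bounded_linear_Im by blast
    have c1: "continuous_on circle (\<lambda>z. L (u z))"
      using bounded_linear.continuous_on[OF bl cc] .
    have c2: "continuous_on UNIV (\<lambda>t. L (u (cis t)))"
      using bounded_linear.continuous_on[OF bl cont] .
    have "(\<lambda>t. of_real (L (u (cis t))) * u (cis t)) integrable_on {0..2*pi}"
      by (intro integrable_continuous_interval continuous_on_subset[of UNIV _ "{0..2*pi}"] continuous_intros c2 cont) auto
    then have "integral {0..2*pi} (L \<circ> (\<lambda>t. of_real (L (u (cis t))) * u (cis t))) = L (integral {0..2*pi} (\<lambda>t. of_real (L (u (cis t))) * u (cis t)))"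
      by (rule integral_linear[OF _ bl])
    also have "\<dots> = 0" using orth[OF c1] L by auto
    finally have "integral {0..2*pi} (\<lambda>t. (L (u (cis t)))\<^sup>2) = 0"
      using L by (auto simp: o_def power2_eq_square)
    moreover have "continuous_on {0..2*pi} (\<lambda>t. (L (u (cis t)))\<^sup>2)"
      by (intro continuous_intros continuous_on_subset[OF c2]) auto
    ultimately show ?thesis
      using t integral_eq_0_iff[of 0 "2*pi" "\<lambda>t. (L (u (cis t)))\<^sup>2"] by auto
  qed
  \<comment> \<open>The squares are known to vanish only on one period; \<open>t'\<close> is the
    representative of the angle in [0, 2 pi].\<close>
  define t' where "t' = t - 2*pi * of_int \<lfloor>t / (2*pi)\<rfloor>"
  have "0 \<le> t'" "t' \<le> 2*pi"
    unfolding t'_def using floor_divide_lower[of "2*pi" t] floor_divide_upper[of "2*pi" t]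
    by (auto simp: algebra_simps)
  moreover have "cis t' = cis t"
    by (simp add: t'_def cis_divide[symmetric])
  moreover from calculation have "u (cis t') = 0"
    using zero[of t' Re] zero[of t' Im] by (simp add: complex_eq_iff)
  ultimately show ?thesis by simp
qed

section \<open>Laurent expansions of smooth functions on the circle\<close>

definition laurent :: "(int \<Rightarrow> complex) \<Rightarrow> (complex \<Rightarrow> complex) \<Rightarrow> bool" where
  "laurent a u \<longleftrightarrow> (\<forall>z\<in>circle. ((\<lambda>m. a m * z powi m) has_sum u z) UNIV)"

text \<open>After k integrations by parts the coefficient carries the factor (i m)^k, while the
  coefficients of the k-th derivative are bounded by its maximum over a period.\<close>

lemma smooth_fc_decay:
  assumes "smooth (\<lambda>t. u (cis t))"
  shows "\<exists>K. \<forall>m. norm (fc (\<lambda>t. u (cis t)) m) * \<bar>of_int m\<bar> ^ k \<le> K"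
proof -
  obtain D where D: "D 0 = (\<lambda>t. u (cis t))" "\<And>k t. (D k has_vector_derivative D (Suc k) t) (at t)"
    using assms unfolding smooth_def by blast
  have cont: "continuous_on UNIV (D k)" for k
    using D(2) by (meson continuous_at_imp_continuous_on has_vector_derivative_continuous)
  \<comment> \<open>Periodicity passes from each derivative to the next: the shifted function has
    the shifted derivative, and derivatives are unique.\<close>
  have per: "D k (t + 2*pi) = D k t" for k t
  proof (induction k arbitrary: t)
    case 0
    then show ?case by (simp add: D(1) cis_mult[symmetric])
  next
    case (Suc k)
    have "((\<lambda>t. t + 2*pi) has_vector_derivative 1) (at t)"
      by (intro derivative_eq_intros) auto
    from vector_diff_chain_at[OF this, of "D k" "D (Suc k) (t + 2*pi)"] D(2)
    have "(D k has_vector_derivative D (Suc k) (t + 2*pi)) (at t)"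
      by (simp add: o_def Suc.IH)
    then show ?case using D(2) vector_derivative_unique_at by blast
  qed
  have "D k (2*pi) = D k 0" for k using per[of k 0] by simp
  then have fcD: "fc (D k) m = (\<i> * of_int m) ^ k * fc (D 0) m" for k m
    by (induction k) (use fc_deriv[OF D(2) cont] in \<open>auto simp: mult_ac\<close>)
  have "compact (D k ` {0..2*pi})"
    by (intro compact_continuous_image continuous_on_subset[OF cont]) auto
  then obtain K where K: "\<forall>x\<in>D k ` {0..2*pi}. norm x \<le> K"
    using bounded_iff compact_imp_bounded by metis
  have "norm (fc (D 0) m) * \<bar>of_int m\<bar> ^ k \<le> K" for m
  proof -
    have "norm (fc (D k) m) \<le> K"
      by (rule fc_norm_le[OF cont]) (use K in auto)
    then show ?thesis by (subst (asm) fcD) (simp add: norm_mult norm_power mult.commute)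
  qed
  then show ?thesis unfolding D(1) by blast
qed

lemma summable_on_int_inverse_square:
  "(\<lambda>m::int. 1 / (1 + of_int m ^ 2) :: real) summable_on UNIV"
proof -
  have s: "(\<lambda>n::nat. 1 / (1 + real n ^ 2)) summable_on UNIV"
  proof (subst summable_on_UNIV_nonneg_real_iff)
    show "summable (\<lambda>n::nat. 1 / (1 + real n ^ 2))"
    proof (rule summable_comparison_test'[where N = 1])
      show "summable (\<lambda>n::nat. inverse (real n ^ 2))"
        using inverse_power_summable[of 2] by simp
      show "norm (1 / (1 + real n ^ 2)) \<le> inverse (real n ^ 2)" if "n \<ge> 1" for n
        using that by (auto simp: inverse_eq_divide intro!: frac_le)
    qed
  qed auto
  have 1: "(\<lambda>m::int. 1 / (1 + of_int m ^ 2) :: real) summable_on (int ` UNIV)"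
    by (subst summable_on_reindex) (use s in \<open>auto simp: o_def\<close>)
  have 2: "(\<lambda>m::int. 1 / (1 + of_int m ^ 2) :: real) summable_on ((\<lambda>n. - int n) ` UNIV)"
    by (subst summable_on_reindex) (use s in \<open>auto simp: o_def inj_on_def\<close>)
  have 3: "(\<lambda>m::int. 1 / (1 + of_int m ^ 2) :: real) summable_on ((\<lambda>n. - int n) ` UNIV - int ` UNIV)"
    by (rule summable_on_subset_banach[OF 2]) auto
  have "int ` UNIV \<union> ((\<lambda>n. - int n) ` UNIV - int ` UNIV) = UNIV"
  proof -
    have "m \<in> range int \<or> m \<in> range (\<lambda>n. - int n)" for m :: int
      by (cases m rule: int_cases2) auto
    then show ?thesis by blast
  qed
  with summable_on_Un_disjoint[OF 1 3] show ?thesis by simp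
qed

lemma decay_abs_summable:
  fixes a :: "int \<Rightarrow> complex"
  assumes "\<And>k. \<exists>K. \<forall>m. norm (a m) * \<bar>of_int m\<bar> ^ k \<le> K"
  shows "(\<lambda>m. norm (a m)) summable_on UNIV"
proof -
  \<comment> \<open>The decay bounds of orders 0 and 2 add up to a bound on
    \<open>norm (a m) * (1 + m^2)\<close>.\<close>
  obtain K0 K2 where K: "\<And>m. norm (a m) * \<bar>of_int m\<bar> ^ 0 \<le> K0" "\<And>m. norm (a m) * \<bar>of_int m\<bar> ^ 2 \<le> K2"
    using assms by metis
  have "norm (a m) \<le> (K0 + K2) * (1 / (1 + of_int m ^ 2))" for m
  proof -
    have "1 + (of_int m :: real) ^ 2 > 0" by (smt (verit) zero_le_power2)
    moreover have "norm (a m) * (1 + of_int m ^ 2) \<le> K0 + K2"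
      using K(1)[of m] K(2)[of m] by (simp add: algebra_simps)
    ultimately show ?thesis by (simp add: field_simps)
  qed
  then show ?thesis
    by (intro summable_on_comparison_test[OF summable_on_cmult_right[OF summable_on_int_inverse_square, of "K0 + K2"]]) auto
qed

text \<open>Unconditional convergence at the single point 1 already makes the coefficients
  absolutely summable. The M-test then gives uniform convergence on the circle, hence continuity and
  integration term by term.\<close>

lemma laurent_imp_fc:
  assumes "laurent a u"
  shows "continuous_on UNIV (\<lambda>t. u (cis t))" and "fc (\<lambda>t. u (cis t)) m = a m"
    and "(\<lambda>m. norm (a m)) summable_on UNIV"
proof -
  have hs: "((\<lambda>m. a m * cis t powi m) has_sum u (cis t)) UNIV" for t
    using assms cis_in_circle unfolding laurent_def by blast
  have "(\<lambda>m. a m * 1 powi m) summable_on UNIV"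
    using hs[of 0] unfolding summable_on_def by auto
  then show abs: "(\<lambda>m. norm (a m)) summable_on UNIV"
    by (simp add: summable_on_iff_abs_summable_on_complex)
  define F where "F = finite_subsets_at_top (UNIV :: int set)"
  have F: "F \<noteq> bot" by (simp add: F_def)
  have ul: "uniform_limit UNIV (\<lambda>X t. \<Sum>m\<in>X. a m * cis t powi m) (\<lambda>t. u (cis t)) F"
    unfolding F_def
    by (rule Weierstrass_m_test_general'[OF _ _ abs]) (use hs in \<open>auto simp: norm_mult norm_power_int\<close>)
  show cu: "continuous_on UNIV (\<lambda>t. u (cis t))"
    by (rule uniform_limit_theorem[OF _ ul F])
       (auto intro!: always_eventually continuous_intros simp: cis_power_int)
  have fin: "fc (\<lambda>t. \<Sum>k\<in>X. a k * cis t powi k) m = (if m \<in> X then a m else 0)" if "finite X" for X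
    using that
  proof (induction X rule: finite_induct)
    case (insert k X)
    have "fc (\<lambda>t. a k * cis t powi k) m = (if m = k then a m else 0)"
      unfolding cis_power_int fc_shift fc_const by simp
    then show ?case
      using insert by (simp add: fc_add continuous_intros cis_power_int)
  qed (simp add: fc_def)
  have "uniform_limit {0..2*pi} (\<lambda>X t. (\<Sum>k\<in>X. a k * cis t powi k) * cis (- (of_int m * t))) (\<lambda>t. u (cis t) * cis (- (of_int m * t))) F"
  proof (rule uniform_limit_on_subset[OF _ subset_UNIV], unfold uniform_limit_iff, intro allI impI)
    fix e :: real assume "e > 0"
    then have "\<forall>\<^sub>F X in F. \<forall>t\<in>UNIV. dist (\<Sum>k\<in>X. a k * cis t powi k) (u (cis t)) < e"
      using ul unfolding uniform_limit_iff by blast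
    then show "\<forall>\<^sub>F X in F. \<forall>t\<in>UNIV. dist ((\<Sum>k\<in>X. a k * cis t powi k) * cis (- (of_int m * t))) (u (cis t) * cis (- (of_int m * t))) < e"
      by eventually_elim (simp add: dist_norm norm_mult left_diff_distrib[symmetric])
  qed
  then obtain I J where IJ: "\<And>X. ((\<lambda>t. (\<Sum>k\<in>X. a k * cis t powi k) * cis (- (of_int m * t))) has_integral I X) {0..2*pi}"
    "((\<lambda>t. u (cis t) * cis (- (of_int m * t))) has_integral J) {0..2*pi}" "(I \<longlongrightarrow> J) F"
    by (rule uniform_limit_integral) (auto intro!: continuous_intros F simp: cis_power_int)
  have I: "I X / (2*pi) = fc (\<lambda>t. \<Sum>k\<in>X. a k * cis t powi k) m" for X
    unfolding fc_def using integral_unique[OF IJ(1)] by simp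
  have J: "J / (2*pi) = fc (\<lambda>t. u (cis t)) m"
    unfolding fc_def using integral_unique[OF IJ(2)] by simp
  have "((\<lambda>X. I X / (2*pi)) \<longlongrightarrow> J / (2*pi)) F"
    by (intro tendsto_intros IJ(3)) auto
  \<comment> \<open>A partial sum over any finite set containing \<open>m\<close> has exactly the
    coefficient \<open>a m\<close>, so the net is eventually constant.\<close>
  moreover have "\<forall>\<^sub>F X in F. I X / (2*pi) = a m"
  proof -
    have "\<forall>\<^sub>F X in F. finite X \<and> {m} \<subseteq> X"
      unfolding F_def eventually_finite_subsets_at_top by (intro exI[of _ "{m}"]) auto
    then show ?thesis by eventually_elim (subst I, simp add: fin)
  qed
  ultimately have "J / (2*pi) = a m"
    by (intro tendsto_unique[OF F _ tendsto_eventually])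
  then show "fc (\<lambda>t. u (cis t)) m = a m" unfolding J .
qed

lemma laurent_unique:
  assumes "laurent a u" "laurent b u"
  shows "a = b"
proof
  show "a m = b m" for m
    using laurent_imp_fc(2)[OF assms(1), of m] laurent_imp_fc(2)[OF assms(2), of m] by (rule trans[OF sym])
qed

text \<open>Decay makes the Fourier series converge to some continuous \<open>S\<close>. As
  \<open>u\<close> and \<open>S\<close> have the same coefficients, their difference is a continuous
  function with all coefficients zero.\<close>

lemma smooth_laurent:
  assumes "smooth (\<lambda>t. u (cis t))"
  shows "laurent (fc (\<lambda>t. u (cis t))) u"
proof -
  let ?a = "fc (\<lambda>t. u (cis t))"
  have abs: "(\<lambda>m. norm (?a m)) summable_on UNIV"
    by (rule decay_abs_summable[OF smooth_fc_decay[OF assms]])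
  define S where "S z = (\<Sum>\<^sub>\<infinity>m. ?a m * z powi m)" for z
  have S: "laurent ?a S"
    unfolding laurent_def S_def
  proof
    fix z :: complex assume "z \<in> circle"
    then have "(\<lambda>m. norm (?a m * z powi m)) summable_on UNIV"
      using abs by (simp add: norm_mult norm_power_int)
    then show "((\<lambda>m. ?a m * z powi m) has_sum (\<Sum>\<^sub>\<infinity>m. ?a m * z powi m)) UNIV"
      by (rule has_sum_infsum[OF abs_summable_summable])
  qed
  note cu = smooth_continuous[OF assms, of UNIV]
  have "u (cis t) - S (cis t) = 0" for t
  proof (rule fc_zero_imp_zero[of "\<lambda>z. u z - S z"])
    have cS: "continuous_on UNIV (\<lambda>t. - 1 * S (cis t))"
      by (intro continuous_intros laurent_imp_fc[OF S])
    show "continuous_on UNIV (\<lambda>t. u (cis t) - S (cis t))"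
      by (intro continuous_intros cu laurent_imp_fc[OF S])
    show "fc (\<lambda>t. u (cis t) - S (cis t)) m = 0" for m
      using fc_add[OF cu cS, of m] fc_cmult[of "-1" "\<lambda>t. S (cis t)" m] laurent_imp_fc(2)[OF S, of m]
      by simp
  qed
  then show ?thesis using S unfolding laurent_def by (metis circle_cis eq_iff_diff_eq_0)
qed

lemma laurent_reflect: "laurent a u \<Longrightarrow> laurent (\<lambda>m. a (- m)) (\<lambda>z. u (1 / z))"
  unfolding laurent_def
proof
  fix z :: complex
  assume a: "\<forall>z\<in>circle. ((\<lambda>m. a m * z powi m) has_sum u z) UNIV" and z: "z \<in> circle"
  have "1 / z \<in> circle" using z by (simp add: norm_divide)
  with a have "((\<lambda>m. a m * (1 / z) powi m) has_sum u (1 / z)) UNIV"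
    by blast
  moreover have inv: "(1 / z) powi m = z powi (- m)" for m
    unfolding inverse_eq_divide[symmetric] power_int_inverse power_int_minus by (rule refl)
  moreover have "((\<lambda>m. a m * (1 / z) powi m) has_sum u (1 / z)) UNIV \<longleftrightarrow> ((\<lambda>m. a (- m) * z powi m) has_sum u (1 / z)) UNIV"
    by (rule has_sum_reindex_bij_witness[of UNIV uminus uminus])
       (simp_all only: inv minus_minus UNIV_I)
  ultimately show "((\<lambda>m. a (- m) * z powi m) has_sum u (1 / z)) UNIV" by blast
qed

section \<open>Sums of one-sided series\<close>

text \<open>Differentiation in the angle multiplies the m-th coefficient by i m, which preserves
  decay faster than every power of m. Series with such coefficients therefore form a family closed
  under differentiation.\<close>

lemma smooth_power_series:
  fixes b :: "nat \<Rightarrow> complex"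
  assumes "\<And>k. \<exists>K. \<forall>m. norm (b m) * real m ^ k \<le> K"
  shows "smooth (\<lambda>t. \<Sum>m. b m * cis t ^ m)"
proof (rule smooth_coinduct[where S = "{\<lambda>t. \<Sum>m. b m * cis t ^ m | b. \<forall>k. \<exists>K. \<forall>m. norm (b m) * real m ^ k \<le> K}"], goal_cases)
  case 1
  then show ?case using assms by blast
next
  case (2 g)
  then obtain b where g: "g = (\<lambda>t. \<Sum>m. b m * cis t ^ m)" and dec: "\<And>k. \<exists>K. \<forall>m. norm (b m) * real m ^ k \<le> K"
    by auto
  have dec1: "\<exists>K. \<forall>m. norm (\<i> * of_nat m * b m) * real m ^ k \<le> K" for k
    using dec[of "Suc k"] by (simp add: norm_mult mult_ac)
  have summ: "summable (\<lambda>m. norm (c m))" if "\<And>k. \<exists>K. \<forall>m. norm (c m) * real m ^ k \<le> K" for c :: "nat \<Rightarrow> complex"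
  proof -
    from that[of 2] obtain K where K: "\<And>m. norm (c m) * real m ^ 2 \<le> K" by blast
    show ?thesis
    proof (rule summable_comparison_test'[where N = 1])
      show "summable (\<lambda>n::nat. K * inverse (real n ^ 2))"
        using inverse_power_summable[of 2, where 'a = real] by (intro summable_mult) simp
      show "norm (norm (c m)) \<le> K * inverse (real m ^ 2)" if "m \<ge> 1" for m
        using that K[of m] by (simp add: field_simps)
    qed
  qed
  define f' where "f' m t = (\<i> * of_nat m * b m) * cis t ^ m" for m t
  have cis_pow: "cis t ^ m = cis (real m * t)" for t m
    by (rule Complex.DeMoivre)
  have d: "((\<lambda>t. b m * cis t ^ m) has_vector_derivative f' m t) (at t)" for m t
    unfolding f'_def cis_pow
    using has_vector_derivative_mult_right[OF has_vector_derivative_cis_mult[of "real m" t], of "b m"]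
    by (simp only: of_real_of_nat_eq mult.assoc mult.left_commute)
  have s0: "summable (\<lambda>m. norm (b m))" by (rule summ) (rule dec)
  have s1: "summable (\<lambda>m. norm (\<i> * of_nat m * b m))" by (rule summ) (rule dec1)
  have "(g has_vector_derivative (\<Sum>m. f' m t)) (at t)" for t
    unfolding g
  proof (rule has_vector_derivative_series[where S = UNIV, OF _ _ d])
    show "norm (f' n t) \<le> norm (\<i> * of_nat n * b n)" for n t
      by (simp add: f'_def norm_mult norm_power)
    show "summable (\<lambda>m. b m * cis t ^ m)" for t
      by (rule summable_norm_cancel) (use s0 in \<open>simp add: norm_mult norm_power\<close>)
  qed (use s1 in auto)
  then show ?case
    using dec1 by (intro bexI[of _ "\<lambda>t. \<Sum>m. f' m t"]) (auto simp: f'_def intro!: exI[of _ "\<lambda>m. \<i> * of_nat m * b m"])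
qed

section \<open>Boundary values of holomorphic functions\<close>

text \<open>The disc algebra. Besides the smooth functions it is the second ring for which the
  lemmas on matrix entries are used.\<close>

definition disc_fun :: "(complex \<Rightarrow> complex) set" where
  "disc_fun = {F. continuous_on (cball 0 1) F \<and> F holomorphic_on ball 0 1}"

definition extends_inside :: "(complex \<Rightarrow> complex) \<Rightarrow> bool" where
  "extends_inside u \<longleftrightarrow> (\<exists>F\<in>disc_fun. \<forall>z\<in>circle. F z = u z)"

text \<open>The number \<open>c\<close> is the value at infinity, the point 0 in the coordinate 1/z.
  It is recorded because the minus part is normalised there: by 0 in the algebra, by the identity in
  the group.\<close>

definition extends_outside :: "complex \<Rightarrow> (complex \<Rightarrow> complex) \<Rightarrow> bool" where
  "extends_outside c u \<longleftrightarrow> (\<exists>F\<in>disc_fun. F 0 = c \<and> (\<forall>z\<in>circle. F z = u (1 / z)))"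

lemma ring_closed_disc_fun: "ring_closed disc_fun"
  unfolding ring_closed_def disc_fun_def
  by (auto intro!: continuous_intros holomorphic_intros)

lemma inverse_in_circle: "z \<in> circle \<Longrightarrow> 1 / z \<in> circle"
  by (simp add: norm_divide)

text \<open>Cauchy's integral formula at 0 for \<open>F z * z ^ k\<close> with
  \<open>m = - k\<close>. Its value \<open>F 0 * 0 ^ k\<close> covers both cases because
  \<open>0 ^ 0 = 1\<close>.\<close>

lemma disc_fun_fc:
  assumes "F \<in> disc_fun" "m \<le> 0"
  shows "fc (\<lambda>t. F (cis t)) m = (if m = 0 then F 0 else 0)"
proof -
  define k where "k = nat (- m)"
  have m: "m = - int k" using assms(2) by (simp add: k_def)
  have cont: "continuous_on (cball 0 1) (\<lambda>z. F z * z ^ k)"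
    and hol: "(\<lambda>z. F z * z ^ k) holomorphic_on ball 0 1"
    using assms(1) by (auto simp: disc_fun_def intro!: continuous_intros holomorphic_intros)
  have "((\<lambda>u. F u * u ^ k / (u - 0)) has_contour_integral (2 * of_real pi * \<i> * (F 0 * 0 ^ k))) (circlepath 0 1)"
    by (rule Cauchy_integral_circlepath[OF cont hol]) auto
  then have "((\<lambda>t. F (cis t) * cis t ^ k / cis t * \<i> * cis t) has_integral (2 * of_real pi * \<i> * (F 0 * 0 ^ k))) {0..2*pi}"
    unfolding circlepath_def by (subst (asm) has_contour_integral_part_circlepath_iff) auto
  then have "((\<lambda>t. \<i> * (F (cis t) * cis t ^ k)) has_integral (\<i> * (2 * of_real pi * (F 0 * 0 ^ k)))) {0..2*pi}"
    by (simp add: mult.commute mult.left_commute)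
  then have "((\<lambda>t. F (cis t) * cis t ^ k) has_integral (2 * of_real pi * (F 0 * 0 ^ k))) {0..2*pi}"
    by (drule_tac has_integral_mult_right[of _ _ _ "- \<i>"]) simp
  then have "integral {0..2*pi} (\<lambda>t. F (cis t) * cis t ^ k) = 2 * of_real pi * (F 0 * 0 ^ k)"
    by (rule integral_unique)
  then show ?thesis
    unfolding fc_def m by (simp add: Complex.DeMoivre)
qed

text \<open>Maximum modulus principle for the difference.\<close>

lemma disc_fun_unique:
  assumes "F \<in> disc_fun" "G \<in> disc_fun" "\<And>z. z \<in> circle \<Longrightarrow> F z = G z" "z \<in> cball 0 1"
  shows "F z = G z"
proof -
  define H where "H z = F z - G z" for z
  have "norm (H z) \<le> 0"
  proof (rule maximum_modulus_frontier[of H "cball 0 1"])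
    show "H holomorphic_on interior (cball 0 1)" "continuous_on (closure (cball 0 1)) H"
      using assms(1,2) unfolding H_def by (auto simp: disc_fun_def intro!: continuous_intros holomorphic_intros)
    show "norm (H w) \<le> 0" if "w \<in> frontier (cball 0 1)" for w
      using assms(3)[of w] that by (simp add: H_def)
  qed (use assms(4) in auto)
  then show ?thesis by (simp add: H_def)
qed

lemma disc_fun_series:
  assumes "\<And>k. f k \<in> disc_fun" "\<And>k w. w \<in> cball 0 1 \<Longrightarrow> norm (f k w) \<le> B k" "summable B"
  shows "(\<lambda>w. \<Sum>k. f k w) \<in> disc_fun"
proof -
  have ul: "uniform_limit (cball 0 1) (\<lambda>n w. \<Sum>k<n. f k w) (\<lambda>w. \<Sum>k. f k w) sequentially"
    by (rule Weierstrass_m_test[OF assms(2,3)])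
  have f: "continuous_on (cball 0 1) (f k)" "f k holomorphic_on ball 0 1" for k
    using assms(1) by (auto simp: disc_fun_def)
  have "continuous_on (cball 0 1) (\<lambda>w. \<Sum>k. f k w)"
    by (rule uniform_limit_theorem[OF _ ul]) (auto intro!: always_eventually continuous_on_sum f)
  moreover have "(\<lambda>w. \<Sum>k. f k w) holomorphic_on ball 0 1"
  proof (rule holomorphic_uniform_sequence)
    fix x :: complex assume "x \<in> ball 0 1"
    then obtain d where d: "d > 0" "cball x d \<subseteq> ball 0 1"
      using open_contains_cball open_ball by blast
    then have "uniform_limit (cball x d) (\<lambda>n w. \<Sum>k<n. f k w) (\<lambda>w. \<Sum>k. f k w) sequentially"
      by (intro uniform_limit_on_subset[OF ul]) auto
    with d show "\<exists>d>0. cball x d \<subseteq> ball 0 1 \<and> uniform_limit (cball x d) (\<lambda>n w. \<Sum>k<n. f k w) (\<lambda>w. \<Sum>k. f k w) sequentially"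
      by blast
  qed (auto intro!: holomorphic_on_sum f)
  ultimately show ?thesis by (simp add: disc_fun_def)
qed

lemma disc_fun_power_series:
  assumes "summable (\<lambda>k. norm (b k))"
  shows "(\<lambda>w. \<Sum>k. b k * w ^ k) \<in> disc_fun"
  by (rule disc_fun_series[OF _ _ assms])
     (auto simp: disc_fun_def norm_mult norm_power intro!: continuous_intros holomorphic_intros mult_left_le power_le_one)

lemma summable_norm_int_shift:
  fixes a :: "int \<Rightarrow> complex"
  assumes "(\<lambda>m. norm (a m)) summable_on UNIV" "inj (h :: nat \<Rightarrow> int)"
  shows "summable (\<lambda>k. norm (a (h k)))"
proof -
  have "(\<lambda>m. norm (a m)) summable_on (range h)"
    using summable_on_subset_banach[OF assms(1)] by blast
  then have "(\<lambda>k. norm (a (h k))) summable_on UNIV"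
    by (subst (asm) summable_on_reindex) (use assms(2) in \<open>auto simp: o_def\<close>)
  then show ?thesis by (simp add: summable_on_UNIV_nonneg_real_iff)
qed

lemma has_sum_range:
  fixes f :: "int \<Rightarrow> complex"
  assumes "summable (\<lambda>k. norm (f (h k)))" "inj (h :: nat \<Rightarrow> int)"
  shows "(f has_sum (\<Sum>k. f (h k))) (range h)"
  by (subst has_sum_reindex[OF assms(2)])
     (use norm_summable_imp_has_sum[OF assms(1)] summable_norm_cancel[OF assms(1)] in \<open>auto simp: o_def summable_sums\<close>)

lemma range_int: "range int = {0..}"
  by (auto simp: image_def) (metis nat_0_le)

text \<open>Cauchy's formula kills the negative coefficients of a boundary value. Conversely,
  absolute summability of the coefficients makes the remaining power series converge uniformly on
  the closed disc, where it is the extension.\<close>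

lemma laurent_extends_inside:
  assumes "laurent a u"
  shows "extends_inside u \<longleftrightarrow> (\<forall>m<0. a m = 0)"
proof
  assume "extends_inside u"
  then obtain F where F: "F \<in> disc_fun" "\<And>z. z \<in> circle \<Longrightarrow> F z = u z"
    unfolding extends_inside_def by blast
  have "laurent a F" using assms F(2) unfolding laurent_def by simp
  then have "a m = fc (\<lambda>t. F (cis t)) m" for m by (simp add: laurent_imp_fc(2))
  then show "\<forall>m<0. a m = 0" using disc_fun_fc[OF F(1)] by auto
next
  assume a0: "\<forall>m<0. a m = 0"
  note abs = laurent_imp_fc(3)[OF assms]
  have s: "summable (\<lambda>k. norm (a (int k)))" by (rule summable_norm_int_shift[OF abs]) auto
  have "(\<Sum>k. a (int k) * z ^ k) = u z" if z: "z \<in> circle" for z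
  proof -
    have "((\<lambda>m. a m * z powi m) has_sum (\<Sum>k. a (int k) * z powi int k)) (range int)"
      by (rule has_sum_range) (use s z in \<open>auto simp: norm_mult norm_power\<close>)
    then have "((\<lambda>m. a m * z powi m) has_sum (\<Sum>k. a (int k) * z powi int k)) UNIV"
      by (subst (asm) has_sum_cong_neutral[where g = "\<lambda>m. a m * z powi m" and T = UNIV])
         (use a0 in \<open>auto simp: range_int\<close>)
    moreover have "((\<lambda>m. a m * z powi m) has_sum u z) UNIV" using assms z unfolding laurent_def by blast
    ultimately show ?thesis using has_sum_unique by fastforce
  qed
  then show "extends_inside u"
    unfolding extends_inside_def by (intro bexI[OF _ disc_fun_power_series[OF s]]) auto
qed

lemma laurent_extends_outside:
  assumes "laurent a u"
  shows "extends_outside c u \<longleftrightarrow> a 0 = c \<and> (\<forall>m>0. a m = 0)"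
proof -
  let ?v = "\<lambda>z. u (1 / z)"
  have v: "laurent (\<lambda>m. a (- m)) ?v" by (rule laurent_reflect[OF assms])
  \<comment> \<open>The value at infinity is forced: it is the mean of the boundary values, hence
    the coefficient of degree 0.\<close>
  have "F 0 = a 0" if "F \<in> disc_fun" "\<forall>z\<in>circle. F z = ?v z" for F
  proof -
    have "laurent (\<lambda>m. a (- m)) F" using v that(2) unfolding laurent_def by simp
    then have "fc (\<lambda>t. F (cis t)) 0 = a 0" by (simp add: laurent_imp_fc(2))
    then show ?thesis using disc_fun_fc[OF that(1), of 0] by simp
  qed
  then have "extends_outside c u \<longleftrightarrow> a 0 = c \<and> extends_inside ?v"
    unfolding extends_outside_def extends_inside_def by metis
  moreover have "(\<forall>m<0. a (- m) = 0) \<longleftrightarrow> (\<forall>m>0. a m = 0)"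
  proof (intro iffI allI impI)
    fix m :: int
    show "a m = 0" if "\<forall>m<0. a (- m) = 0" "0 < m"
      using that(1)[rule_format, of "- m"] that(2) by simp
    show "a (- m) = 0" if "\<forall>m>0. a m = 0" "m < 0"
      using that(1)[rule_format, of "- m"] that(2) by simp
  qed
  ultimately show ?thesis using laurent_extends_inside[OF v] by simp
qed

text \<open>Liouville's theorem for boundary values: one extension kills the negative degrees, the
  other the positive ones. This yields both trivial intersections as well as the tracelessness of
  the plus part.\<close>

lemma extends_inside_outside:
  assumes "smooth (\<lambda>t. u (cis t))" "extends_inside u" "extends_outside c u" "z \<in> circle"
  shows "u z = c"
proof -
  obtain a where a: "laurent a u" using smooth_laurent[OF assms(1)] by blast
  have a0: "a m = (if m = 0 then c else 0)" for m
    using assms(2,3) laurent_extends_inside[OF a] laurent_extends_outside[OF a] by (cases m "0::int" rule: linorder_cases) auto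
  have "((\<lambda>m. a m * z powi m) has_sum u z) UNIV" using a assms(4) unfolding laurent_def by blast
  moreover have "((\<lambda>m. a m * z powi m) has_sum c) {0}" using has_sum_finite[of "{0}" "\<lambda>m. a m * z powi m"] by (simp add: a0)
  then have "((\<lambda>m. a m * z powi m) has_sum c) UNIV"
    by (subst (asm) has_sum_cong_neutral[where g = "\<lambda>m. a m * z powi m" and T = UNIV]) (auto simp: a0)
  ultimately show ?thesis using has_sum_unique by blast
qed

section \<open>Loops invariant under a rotation\<close>

lemma cis_powi_eq_1:
  assumes "d > 0" "cis (2*pi / real d) powi m = 1"
  shows "int d dvd m"
proof -
  have "exp (\<i> * of_real (of_int m * (2*pi / real d))) = 1"
    using assms(2) unfolding cis_power_int by (simp only: cis_conv_exp)
  then obtain k :: int where "of_int m * (2*pi / real d) = of_int (2 * k) * pi"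
    unfolding exp_eq_1 by auto
  then have "real_of_int m = of_int k * real d" using assms(1) by (simp add: field_simps)
  then have "m = k * int d" using of_int_eq_iff[of m "k * int d", where 'a = real] by simp
  then show ?thesis by simp
qed

text \<open>Rotating the argument multiplies the coefficient of degree m by \<open>w powi m\<close>,
  and expansions are unique. With \<open>cis_powi_eq_1\<close> this leaves only degrees divisible by
  the order of the rotation.\<close>

lemma laurent_invariant:
  assumes "laurent a u" "\<And>z. z \<in> circle \<Longrightarrow> u (w * z) = u z" "w \<in> circle"
  shows "a m * w powi m = a m"
proof -
  have "laurent (\<lambda>m. a m * w powi m) (\<lambda>z. u (w * z))"
    unfolding laurent_def
  proof
    fix z :: complex assume "z \<in> circle"
    then have "w * z \<in> circle" using assms(3) by (simp add: norm_mult)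
    then have "((\<lambda>m. a m * (w * z) powi m) has_sum u (w * z)) UNIV"
      using assms(1) unfolding laurent_def by blast
    then show "((\<lambda>m. a m * w powi m * z powi m) has_sum u (w * z)) UNIV"
      by (simp add: power_int_mult_distrib mult.assoc)
  qed
  then have "laurent (\<lambda>m. a m * w powi m) u"
    using assms(2) unfolding laurent_def by simp
  then show ?thesis using laurent_unique[OF assms(1)] by metis
qed

lemma invariant_power_series:
  assumes "smooth (\<lambda>t. u (cis t))" "d > 0" "\<And>z. z \<in> circle \<Longrightarrow> u (cis (2*pi / real d) * z) = u z"
  shows "\<exists>b. \<forall>z\<in>circle. ((\<lambda>m. b m * (z ^ d) powi m) has_sum u z) UNIV"
proof -
  obtain a where a: "laurent a u" using smooth_laurent[OF assms(1)] by blast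
  have a0: "a m = 0" if "\<not> int d dvd m" for m
    using laurent_invariant[OF a assms(3), of m] cis_powi_eq_1[OF assms(2), of m] that by auto
  show ?thesis
  proof (intro exI[of _ "\<lambda>m. a (int d * m)"] ballI)
    fix z :: complex assume "z \<in> circle"
    then have "((\<lambda>m. a m * z powi m) has_sum u z) UNIV" using a unfolding laurent_def by blast
    then have "((\<lambda>m. a m * z powi m) has_sum u z) (range (\<lambda>m. int d * m))"
      by (subst (asm) has_sum_cong_neutral[where g = "\<lambda>m. a m * z powi m" and T = "range (\<lambda>m. int d * m)"])
         (use a0 in \<open>auto simp: dvd_def image_def\<close>)
    then show "((\<lambda>m. a (int d * m) * (z ^ d) powi m) has_sum u z) UNIV"
      by (subst (asm) has_sum_reindex) (use assms(2) in \<open>auto simp: inj_on_def o_def power_int_mult\<close>)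
  qed
qed

text \<open>The three summands are the part of nonnegative degree, the term of degree \<open>-d\<close> and the rest;
  by invariance no other degrees above \<open>-2d\<close> occur.\<close>

lemma invariant_split:
  assumes u: "smooth (\<lambda>t. u (cis t))" and d: "d > 0"
    and inv: "\<And>z. z \<in> circle \<Longrightarrow> u (cis (2*pi / real d) * z) = u z"
  obtains p c v c' where
    "smooth (\<lambda>t. p (cis t))" "extends_inside p" "\<And>z. z \<in> circle \<Longrightarrow> p (cis (2*pi / real d) * z) = p z"
    "smooth (\<lambda>t. v (cis t))" "extends_outside c' v"
    "\<And>z. z \<in> circle \<Longrightarrow> u z = p z + c * (1 / z) ^ d + (1 / z) ^ (2 * d) * v z"
proof -
  let ?w = "cis (2*pi / real d)"
  define a where "a = fc (\<lambda>t. u (cis t))"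
  have a: "laurent a u" using smooth_laurent[OF u] by (simp add: a_def)
  have ainv: "a m * ?w powi m = a m" for m by (rule laurent_invariant[OF a inv]) auto
  have a0: "a m = 0" if "\<not> int d dvd m" for m
    using ainv[of m] cis_powi_eq_1[OF d, of m] that by auto
  \<comment> \<open>\<open>h\<close> runs down through the degrees from -2d on. The offset leaves
    the factor \<open>(1 / z) ^ (2 * d)\<close> in front of \<open>v\<close>: with d = 2n, one
    factor \<open>(1 / z) ^ d\<close> will absorb \<open>psi_inv\<close> and the other
    \<open>psi\<close>, both of degree less than d.\<close>
  define h where "h k = - int (2 * d) - int k" for k
  have inj: "inj h" by (auto simp: inj_on_def h_def)
  define p where "p z = (\<Sum>k. a (int k) * z ^ k)" for z
  define q where "q z = (\<Sum>k. a (h k) * z ^ k)" for z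
  define v where "v z = q (1 / z)" for z
  note abs = laurent_imp_fc(3)[OF a]
  have dec: "\<exists>K. \<forall>m. norm (a m) * \<bar>of_int m\<bar> ^ k \<le> K" for k
    unfolding a_def by (rule smooth_fc_decay[OF u])
  have sp: "smooth (\<lambda>t. p (cis t))"
    unfolding p_def
  proof (rule smooth_power_series)
    fix k
    obtain K where K: "\<And>m. norm (a m) * \<bar>of_int m\<bar> ^ k \<le> K" using dec by blast
    have "norm (a (int m)) * real m ^ k \<le> K" for m using K[of "int m"] by simp
    then show "\<exists>K. \<forall>m. norm (a (int m)) * real m ^ k \<le> K" by blast
  qed
  have sq: "smooth (\<lambda>t. q (cis t))"
    unfolding q_def
  proof (rule smooth_power_series)
    fix k
    obtain K where K: "\<And>m. norm (a m) * \<bar>of_int m\<bar> ^ k \<le> K" using dec by blast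
    have "norm (a (h m)) * real m ^ k \<le> K" for m
    proof -
      have "norm (a (h m)) * real m ^ k \<le> norm (a (h m)) * \<bar>of_int (h m)\<bar> ^ k"
        by (intro mult_left_mono power_mono) (auto simp: h_def)
      then show ?thesis using K[of "h m"] by linarith
    qed
    then show "\<exists>K. \<forall>m. norm (a (h m)) * real m ^ k \<le> K" by blast
  qed
  have sv: "smooth (\<lambda>t. v (cis t))"
    using smooth_reflect[OF sq] by (simp add: v_def cis_inverse[symmetric] inverse_eq_divide)
  have smp: "summable (\<lambda>k. norm (a (int k)))" by (rule summable_norm_int_shift[OF abs]) auto
  have smq: "summable (\<lambda>k. norm (a (h k)))" by (rule summable_norm_int_shift[OF abs inj])
  have ep: "extends_inside p"
    unfolding extends_inside_def p_def by (intro bexI[OF _ disc_fun_power_series[OF smp]]) auto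
  have ev: "extends_outside (q 0) v"
    unfolding extends_outside_def v_def q_def by (intro bexI[OF _ disc_fun_power_series[OF smq]]) auto
  have pinv: "p (?w * z) = p z" for z
  proof -
    have "a (int k) * (?w * z) ^ k = a (int k) * z ^ k" for k
      using ainv[of "int k"] by (simp only: power_mult_distrib power_int_of_nat mult.assoc[symmetric])
    then show ?thesis by (simp only: p_def)
  qed
  have eq: "u z = p z + a (- int d) * (1 / z) ^ d + (1 / z) ^ (2 * d) * v z" if z: "z \<in> circle" for z
  proof -
    let ?f = "\<lambda>m. a m * z powi m"
    have z0: "z \<noteq> 0" using z by auto
    have 1: "(?f has_sum p z) (range int)"
      using has_sum_range[of ?f int] smp z by (simp add: p_def norm_mult norm_power)
    have "(?f has_sum (\<Sum>k. ?f (h k))) (range h)"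
      by (rule has_sum_range[OF _ inj]) (use smq z in \<open>simp add: norm_mult norm_power_int\<close>)
    moreover have "?f (h k) = (1 / z) ^ (2 * d) * (a (h k) * (1 / z) ^ k)" for k
      using z0 by (simp add: h_def power_int_diff power_int_minus power_divide power_int_of_nat field_simps del: of_nat_mult)
    moreover have "summable (\<lambda>k. a (h k) * (1 / z) ^ k)"
      by (rule summable_norm_cancel) (use smq z in \<open>simp add: norm_mult norm_power norm_divide\<close>)
    ultimately have 2: "(?f has_sum ((1 / z) ^ (2 * d) * v z)) (range h)"
      unfolding v_def q_def by (simp add: suminf_mult)
    have 3: "(?f has_sum (a (- int d) * (1 / z) ^ d)) {- int d}"
      using has_sum_finite[of "{- int d}" ?f] by (simp add: power_int_minus power_divide inverse_eq_divide)
    have hneg: "range h = {..- int (2 * d)}"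
    proof -
      have "m \<in> range h" if "m \<le> - int (2 * d)" for m
        using that by (intro image_eqI[of _ _ "nat (- int (2 * d) - m)"]) (auto simp: h_def)
      then show ?thesis by (auto simp: h_def)
    qed
    have "(?f has_sum (p z + a (- int d) * (1 / z) ^ d + (1 / z) ^ (2 * d) * v z)) (range int \<union> {- int d} \<union> range h)"
      using d by (intro has_sum_Un_disjoint 1 2 3) (auto simp: range_int hneg)
    \<comment> \<open>The degrees left over lie strictly between -2d and 0 and differ from -d, so
      none of them is a multiple of d.\<close>
    moreover have "a m = 0" if "m \<notin> range int \<union> {- int d} \<union> range h" for m
    proof (rule a0)
      show "\<not> int d dvd m"
      proof
        assume "int d dvd m"
        then obtain k where k: "m = int d * k" by (auto simp: dvd_def)
        have "m < 0" "m \<noteq> - int d" "m > - int (2 * d)" using that by (auto simp: range_int hneg)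
        have "int d * k < 0" "int d * (k + 2) > 0"
          using \<open>m < 0\<close> \<open>m > - int (2 * d)\<close> k by (simp_all add: algebra_simps)
        then have "k < 0" "k + 2 > 0"
          using d by (simp_all add: mult_less_0_iff zero_less_mult_iff)
        moreover have "k \<noteq> -1" using \<open>m \<noteq> - int d\<close> k by auto
        ultimately show False by linarith
      qed
    qed
    ultimately have "(?f has_sum (p z + a (- int d) * (1 / z) ^ d + (1 / z) ^ (2 * d) * v z)) UNIV"
      by (subst (asm) has_sum_cong_neutral[where g = ?f and T = UNIV]) auto
    moreover have "(?f has_sum u z) UNIV" using a z unfolding laurent_def by blast
    ultimately show ?thesis using has_sum_unique by blast
  qed
  show thesis
    by (rule that[OF sp ep _ sv ev eq]) (use pinv in auto)
qed

section \<open>Matrices with entries in a ring of functions\<close>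

text \<open>One predicate serves both the smooth loops (\<open>Collect smooth\<close>, a function of
  the angle) and the holomorphic extensions (\<open>disc_fun\<close>). The closure properties below
  are proved once, for any ring of functions containing the constants.\<close>

definition entries_in :: "('x \<Rightarrow> complex) set \<Rightarrow> nat \<Rightarrow> ('x \<Rightarrow> complex mat) \<Rightarrow> bool" where
  "entries_in S N M \<longleftrightarrow> (\<forall>x. M x \<in> carrier_mat N N) \<and> (\<forall>i<N. \<forall>j<N. (\<lambda>x. M x $$ (i, j)) \<in> S)"

lemma entries_inI:
  "(\<And>x. M x \<in> carrier_mat N N) \<Longrightarrow> (\<And>i j. i < N \<Longrightarrow> j < N \<Longrightarrow> (\<lambda>x. M x $$ (i, j)) \<in> S) \<Longrightarrow> entries_in S N M"
  by (simp add: entries_in_def)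

lemma entries_inD:
  assumes "entries_in S N M"
  shows "M x \<in> carrier_mat N N" "i < N \<Longrightarrow> j < N \<Longrightarrow> (\<lambda>x. M x $$ (i, j)) \<in> S"
  using assms by (auto simp: entries_in_def)

lemma mat_mult_entry:
  assumes "A \<in> carrier_mat n m" "B \<in> carrier_mat m k" "i < n" "j < k"
  shows "(A * B) $$ (i, j) = (\<Sum>l<m. A $$ (i, l) * B $$ (l, j))"
  using assms by (auto simp: scalar_prod_def atLeast0LessThan intro!: sum.cong)

lemma mat_mult3_entry:
  assumes "A \<in> carrier_mat N N" "X \<in> carrier_mat N N" "B \<in> carrier_mat N N" "i < N" "j < N"
  shows "(A * X * B) $$ (i, j) = (\<Sum>b<N. (\<Sum>a<N. A $$ (i, a) * X $$ (a, b)) * B $$ (b, j))"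
proof -
  have "(A * X * B) $$ (i, j) = (\<Sum>b<N. (A * X) $$ (i, b) * B $$ (b, j))"
    using assms by (intro mat_mult_entry) auto
  also have "\<dots> = (\<Sum>b<N. (\<Sum>a<N. A $$ (i, a) * X $$ (a, b)) * B $$ (b, j))"
    by (intro sum.cong refl) (simp add: mat_mult_entry[OF assms(1,2,4)] del: index_mult_mat(1))
  finally show ?thesis .
qed

context
  fixes S :: "('x \<Rightarrow> complex) set"
  assumes S: "ring_closed S"
begin

lemma ring_closed_simps:
  "(\<lambda>_. c) \<in> S" "f \<in> S \<Longrightarrow> g \<in> S \<Longrightarrow> (\<lambda>x. f x + g x) \<in> S" "f \<in> S \<Longrightarrow> g \<in> S \<Longrightarrow> (\<lambda>x. f x * g x) \<in> S"
  using S by (auto simp: ring_closed_def)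

lemma ring_closed_sum: "(\<And>a. a \<in> A \<Longrightarrow> f a \<in> S) \<Longrightarrow> (\<lambda>x. \<Sum>a\<in>A. f a x) \<in> S"
  by (induction A rule: infinite_finite_induct) (auto intro!: ring_closed_simps)

lemma ring_closed_prod: "(\<And>a. a \<in> A \<Longrightarrow> f a \<in> S) \<Longrightarrow> (\<lambda>x. \<Prod>a\<in>A. f a x) \<in> S"
  by (induction A rule: infinite_finite_induct) (auto intro!: ring_closed_simps)

lemma entries_in_const: "A \<in> carrier_mat N N \<Longrightarrow> entries_in S N (\<lambda>_. A)"
  by (auto intro!: entries_inI ring_closed_simps)

lemma entries_in_add:
  assumes "entries_in S N M" "entries_in S N L"
  shows "entries_in S N (\<lambda>x. M x + L x)"
proof (rule entries_inI)
  fix i j assume ij: "i < N" "j < N"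
  have "(\<lambda>x. (M x + L x) $$ (i, j)) = (\<lambda>x. M x $$ (i, j) + L x $$ (i, j))"
    using ij by (simp add: carrier_matD[OF entries_inD(1)[OF assms(2)]])
  then show "(\<lambda>x. (M x + L x) $$ (i, j)) \<in> S"
    using ring_closed_simps(2) entries_inD(2)[OF assms(1)] entries_inD(2)[OF assms(2)] ij by simp
qed (use entries_inD(1)[OF assms(1)] entries_inD(1)[OF assms(2)] in auto)

lemma entries_in_smult:
  assumes "f \<in> S" "entries_in S N M"
  shows "entries_in S N (\<lambda>x. f x \<cdot>\<^sub>m M x)"
proof (rule entries_inI)
  fix i j assume ij: "i < N" "j < N"
  have "(\<lambda>x. (f x \<cdot>\<^sub>m M x) $$ (i, j)) = (\<lambda>x. f x * M x $$ (i, j))"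
    using ij by (simp add: carrier_matD[OF entries_inD(1)[OF assms(2)]])
  then show "(\<lambda>x. (f x \<cdot>\<^sub>m M x) $$ (i, j)) \<in> S"
    using ring_closed_simps(3)[OF assms(1)] entries_inD(2)[OF assms(2)] ij by simp
qed (use entries_inD(1)[OF assms(2)] in auto)

lemma entries_in_mult:
  assumes "entries_in S N M" "entries_in S N L"
  shows "entries_in S N (\<lambda>x. M x * L x)"
proof (rule entries_inI)
  fix i j assume ij: "i < N" "j < N"
  have "(\<lambda>x. (M x * L x) $$ (i, j)) = (\<lambda>x. \<Sum>l<N. M x $$ (i, l) * L x $$ (l, j))"
    using entries_inD(1)[OF assms(1)] entries_inD(1)[OF assms(2)] ij by (intro ext mat_mult_entry)
  then show "(\<lambda>x. (M x * L x) $$ (i, j)) \<in> S"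
    using entries_inD(2)[OF assms(1)] entries_inD(2)[OF assms(2)] ij
    by (auto intro!: ring_closed_sum ring_closed_simps(3))
qed (rule mult_carrier_mat[OF entries_inD(1)[OF assms(1)] entries_inD(1)[OF assms(2)]])

lemma entries_in_pow: "entries_in S N M \<Longrightarrow> entries_in S N (\<lambda>x. M x ^\<^sub>m k)"
proof (induction k)
  case 0
  then have "M x ^\<^sub>m 0 = 1\<^sub>m N" for x using entries_inD(1)[OF 0, of x] by simp
  then show ?case using entries_in_const[of "1\<^sub>m N"] by simp
qed (simp add: entries_in_mult)

lemma entries_in_det:
  assumes "entries_in S N M"
  shows "(\<lambda>x. det (M x)) \<in> S"
  unfolding det_def'[OF entries_inD(1)[OF assms]]
  by (intro ring_closed_sum ring_closed_simps ring_closed_prod entries_inD(2)[OF assms])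
     (auto dest: permutes_in_image)

text \<open>Cofactors are determinants of minors up to sign, hence polynomials in the entries. On
  \<open>SL\<close> the adjugate is the inverse, so inversion does not lead out of the ring.\<close>

lemma entries_in_adj:
  assumes "entries_in S N M"
  shows "entries_in S N (\<lambda>x. adj_mat (M x))"
proof (rule entries_inI)
  note car = entries_inD(1)[OF assms]
  show "adj_mat (M x) \<in> carrier_mat N N" for x by (rule adj_mat(1)[OF car])
  fix i j assume ij: "i < N" "j < N"
  have "entries_in S (N - 1) (\<lambda>x. mat_delete (M x) j i)"
  proof (rule entries_inI)
    show "mat_delete (M x) j i \<in> carrier_mat (N - 1) (N - 1)" for x
      by (rule mat_delete_carrier[OF car])
    fix k l assume kl: "k < N - 1" "l < N - 1"
    have "mat_delete (M x) j i $$ (k, l) = M x $$ (if k < j then k else Suc k, if l < i then l else Suc l)" for x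
      using car[of x] kl by (auto simp: mat_delete_def)
    then show "(\<lambda>x. mat_delete (M x) j i $$ (k, l)) \<in> S"
      using entries_inD(2)[OF assms] kl by auto
  qed
  then have "(\<lambda>x. cofactor (M x) j i) \<in> S"
    unfolding cofactor_def by (intro ring_closed_simps entries_in_det)
  moreover have "adj_mat (M x) $$ (i, j) = cofactor (M x) j i" for x
    using car[of x] ij by (simp add: adj_mat_def)
  ultimately show "(\<lambda>x. adj_mat (M x) $$ (i, j)) \<in> S" by simp
qed

end

section \<open>The matrix exponential\<close>

lemma mat_trace_mult_commute:
  assumes "A \<in> carrier_mat N N" "B \<in> carrier_mat N N"
  shows "mat_trace (A * B) = mat_trace (B * A)"
proof -
  have "mat_trace (A * B) = (\<Sum>i<N. \<Sum>l<N. A $$ (i, l) * B $$ (l, i))"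
    using assms by (simp add: mat_trace_def mat_mult_entry[OF assms] del: index_mult_mat(1))
  also have "\<dots> = (\<Sum>l<N. \<Sum>i<N. B $$ (l, i) * A $$ (i, l))"
    by (subst sum.swap) (simp add: mult.commute)
  also have "\<dots> = mat_trace (B * A)"
    using assms by (simp add: mat_trace_def mat_mult_entry[OF assms(2,1)] del: index_mult_mat(1))
  finally show ?thesis .
qed

lemma norm_pow_mat_entry:
  fixes A :: "complex mat"
  assumes "A \<in> carrier_mat N N" "\<And>i j. i < N \<Longrightarrow> j < N \<Longrightarrow> norm (A $$ (i, j)) \<le> B" "i < N" "j < N"
  shows "norm ((A ^\<^sub>m k) $$ (i, j)) \<le> (real N * B) ^ k"
  using assms(3,4)
proof (induction k arbitrary: i j)
  case 0
  then show ?case using assms(1) by (simp add: one_mat_def)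
next
  case (Suc k)
  have "norm ((A ^\<^sub>m Suc k) $$ (i, j)) = norm (\<Sum>l<N. (A ^\<^sub>m k) $$ (i, l) * A $$ (l, j))"
    using mat_mult_entry[OF pow_carrier_mat[OF assms(1)] assms(1) Suc.prems] by simp
  also have "\<dots> \<le> (\<Sum>l<N. (real N * B) ^ k * B)"
  proof (rule sum_norm_le)
    fix l assume "l \<in> {..<N}"
    then have "norm ((A ^\<^sub>m k) $$ (i, l)) \<le> (real N * B) ^ k" "norm (A $$ (l, j)) \<le> B"
      using Suc assms(2) by auto
    then show "norm ((A ^\<^sub>m k) $$ (i, l) * A $$ (l, j)) \<le> (real N * B) ^ k * B"
      unfolding norm_mult by (intro mult_mono) (auto intro: order.trans[OF norm_ge_zero])
  qed
  finally show ?case by (simp add: mult_ac)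
qed

lemma entry_bound:
  fixes A :: "complex mat"
  obtains B where "B \<ge> 0" "\<And>i j. i < N \<Longrightarrow> j < N \<Longrightarrow> norm (A $$ (i, j)) \<le> B"
proof -
  have "finite ((\<lambda>(i, j). norm (A $$ (i, j))) ` ({..<N} \<times> {..<N}))" by simp
  then obtain B where B: "\<And>x. x \<in> (\<lambda>(i, j). norm (A $$ (i, j))) ` ({..<N} \<times> {..<N}) \<Longrightarrow> x \<le> B"
    by (meson bdd_above.unfold bdd_above_finite)
  show thesis
    by (rule that[of "max B 0"]) (auto intro!: B max.coboundedI1)
qed

lemma summable_exp_bound: "summable (\<lambda>k. (c :: real) ^ k / fact k)"
  using summable_exp[of c] by (simp add: divide_inverse mult.commute)

lemma mat_exp_carrier: "A \<in> carrier_mat N N \<Longrightarrow> mat_exp A \<in> carrier_mat N N"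
  by (simp add: mat_exp_def)

lemma mat_exp_sums:
  assumes "A \<in> carrier_mat N N" "i < N" "j < N"
  shows "(\<lambda>k. (A ^\<^sub>m k) $$ (i, j) / fact k) sums (mat_exp A $$ (i, j))"
proof -
  obtain B where B: "\<And>i j. i < N \<Longrightarrow> j < N \<Longrightarrow> norm (A $$ (i, j)) \<le> B" by (metis entry_bound)
  have "summable (\<lambda>k. (A ^\<^sub>m k) $$ (i, j) / fact k)"
    by (rule summable_norm_cancel, rule summable_comparison_test'[OF summable_exp_bound[of "real N * B"]])
       (use norm_pow_mat_entry[OF assms(1) B assms(2,3)] in \<open>auto simp: norm_divide divide_right_mono\<close>)
  moreover have "mat_exp A $$ (i, j) = (\<Sum>k. (A ^\<^sub>m k) $$ (i, j) / fact k)"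
    using assms by (simp add: mat_exp_def)
  ultimately show ?thesis by (simp add: summable_sums)
qed

text \<open>Each entry of \<open>P * X * Q\<close> is a finite linear combination of entries of
  \<open>X\<close>, so conjugation passes through the exponential series.\<close>

lemma mat_exp_similar:
  assumes "P \<in> carrier_mat N N" "Q \<in> carrier_mat N N" "A \<in> carrier_mat N N" "P * Q = 1\<^sub>m N" "Q * P = 1\<^sub>m N"
  shows "mat_exp (P * A * Q) = P * mat_exp A * Q"
proof -
  have wit: "similar_mat_wit (P * A * Q) A P Q"
    using assms by (auto simp: similar_mat_wit_def Let_def)
  have pow: "(P * A * Q) ^\<^sub>m k = P * A ^\<^sub>m k * Q" for k
    using similar_mat_wit_pow[OF wit, of k] similar_mat_witD(3) by blast
  have c: "P * A * Q \<in> carrier_mat N N" using assms by auto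
  note ent = mat_mult3_entry[OF assms(1) _ assms(2)]
  show ?thesis
  proof (rule eq_matI)
    fix i j assume "i < dim_row (P * mat_exp A * Q)" "j < dim_col (P * mat_exp A * Q)"
    then have ij: "i < N" "j < N" using assms by auto
    have "(\<lambda>k. (\<Sum>b<N. (\<Sum>a<N. P $$ (i, a) * ((A ^\<^sub>m k) $$ (a, b) / fact k)) * Q $$ (b, j))) sums ((P * mat_exp A * Q) $$ (i, j))"
      unfolding ent[OF mat_exp_carrier[OF assms(3)] ij]
      by (intro sums_sum sums_mult2 sums_mult mat_exp_sums[OF assms(3)]) auto
    moreover have "(\<Sum>b<N. (\<Sum>a<N. P $$ (i, a) * ((A ^\<^sub>m k) $$ (a, b) / fact k)) * Q $$ (b, j)) = ((P * A * Q) ^\<^sub>m k) $$ (i, j) / fact k" for k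
      unfolding pow ent[OF pow_carrier_mat[OF assms(3)] ij] by (simp add: sum_divide_distrib sum_distrib_right)
    ultimately show "mat_exp (P * A * Q) $$ (i, j) = (P * mat_exp A * Q) $$ (i, j)"
      using mat_exp_sums[OF c ij] by (simp add: sums_iff)
  qed (use assms mat_exp_carrier[OF c] mat_exp_carrier[OF assms(3)] in auto)
qed

lemma upper_triangular_pow:
  assumes "A \<in> carrier_mat N N" "\<And>i j. j < i \<Longrightarrow> i < N \<Longrightarrow> A $$ (i, j) = (0 :: complex)" "i < N"
  shows "(j < i \<longrightarrow> (A ^\<^sub>m k) $$ (i, j) = 0) \<and> (A ^\<^sub>m k) $$ (i, i) = (A $$ (i, i)) ^ k"
  using assms(3)
proof (induction k arbitrary: i j)
  case 0
  then show ?case using assms(1) by auto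
next
  case (Suc k)
  have e: "(A ^\<^sub>m Suc k) $$ (i, j) = (\<Sum>l<N. (A ^\<^sub>m k) $$ (i, l) * A $$ (l, j))" if "j < N" for j
    using mat_mult_entry[OF pow_carrier_mat[OF assms(1)] assms(1) Suc.prems that] by simp
  have "(A ^\<^sub>m Suc k) $$ (i, j) = 0" if "j < i"
  proof -
    have z: "(A ^\<^sub>m k) $$ (i, l) * A $$ (l, j) = 0" if "l < N" for l
      using Suc.IH[OF Suc.prems, of l] assms(2)[OF _ that, of j] \<open>j < i\<close> by (cases "l < i") auto
    have "j < N" using that Suc.prems by simp
    then show ?thesis unfolding e[OF \<open>j < N\<close>] by (intro sum.neutral) (use z in auto)
  qed
  moreover have "(A ^\<^sub>m Suc k) $$ (i, i) = (\<Sum>l<N. if l = i then (A $$ (i, i)) ^ k * A $$ (i, i) else 0)"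
    unfolding e[OF Suc.prems]
  proof (rule sum.cong)
    fix l assume "l \<in> {..<N}"
    then show "(A ^\<^sub>m k) $$ (i, l) * A $$ (l, i) = (if l = i then (A $$ (i, i)) ^ k * A $$ (i, i) else 0)"
      using Suc.IH[OF Suc.prems, of l] assms(2)[of i l] by (cases l i rule: linorder_cases) auto
  qed simp
  ultimately show ?case using Suc.prems by simp
qed

text \<open>Schur triangularisation reduces to upper triangular \<open>B\<close>. The exponential of
  \<open>B\<close> is upper triangular with diagonal entries \<open>exp (B $$ (i, i))\<close>, and
  trace and determinant are invariant under similarity.\<close>

lemma det_mat_exp:
  assumes X: "X \<in> carrier_mat N N"
  shows "det (mat_exp X) = exp (mat_trace X)"
proof -
  obtain as where "char_poly X = (\<Prod>a\<leftarrow>as. [:- a, 1:])" using char_poly_factorized[OF X] by blast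
  then obtain B where B: "B \<in> carrier_mat N N" "upper_triangular B" "similar_mat X B"
    using schur_decomposition_exists[OF X] by blast
  then obtain P Q where "similar_mat_wit X B P Q" by (auto simp: similar_mat_def)
  note w = similar_mat_witD2[OF X this]
  have ut: "B $$ (i, j) = 0" if "j < i" "i < N" for i j using B that by auto
  have tr: "mat_trace X = mat_trace B"
    using mat_trace_mult_commute[of "P * B" N Q] w B(1) by (simp add: assoc_mult_mat[of Q N N P N B N, symmetric])
  have eB: "mat_exp B \<in> carrier_mat N N" by (rule mat_exp_carrier[OF B(1)])
  have dB: "mat_exp B $$ (i, i) = exp (B $$ (i, i))" if i: "i < N" for i
  proof -
    have "(\<lambda>k. (B $$ (i, i)) ^ k / fact k) sums (mat_exp B $$ (i, i))"
      using mat_exp_sums[OF B(1) i i] upper_triangular_pow[OF B(1) ut i] by simp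
    moreover have "(\<lambda>k. (B $$ (i, i)) ^ k / fact k) sums exp (B $$ (i, i))"
      using exp_converges[of "B $$ (i, i)"] by (simp add: scaleR_conv_of_real divide_inverse mult.commute)
    ultimately show ?thesis using sums_unique2 by blast
  qed
  have uB: "upper_triangular (mat_exp B)"
  proof (rule upper_triangularI)
    fix i j assume ij: "j < i" "i < dim_row (mat_exp B)"
    then have "i < N" "j < N" using eB by auto
    then have "(\<lambda>k. 0) sums (mat_exp B $$ (i, j))"
      using mat_exp_sums[OF B(1), of i j] upper_triangular_pow[OF B(1) ut, of i j] ij by simp
    then show "mat_exp B $$ (i, j) = 0" using sums_unique2 sums_zero by blast
  qed
  have "det (mat_exp X) = det (P * mat_exp B * Q)"
    using mat_exp_similar[of P N Q B] w B(1) by simp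
  also have "\<dots> = det (mat_exp B) * (det P * det Q)"
    using w eB by (simp add: Determinant.det_mult[of _ N])
  also have "det P * det Q = 1"
    using w Determinant.det_mult[of P N Q] by simp
  also have "det (mat_exp B) = (\<Prod>i = 0..<N. exp (B $$ (i, i)))"
    using det_upper_triangular[OF uB eB] eB by (simp add: prod_list_diag_prod dB)
  also have "\<dots> = exp (mat_trace B)"
    using B(1) by (simp add: mat_trace_def exp_sum atLeast0LessThan)
  finally show ?thesis by (simp add: tr)
qed

lemma mat_exp_zero: "mat_exp (0\<^sub>m N N) = 1\<^sub>m N"
proof (rule eq_matI)
  let ?Z = "0\<^sub>m N N :: complex mat" and ?I = "1\<^sub>m N :: complex mat"
  fix i j assume ij: "i < dim_row ?I" "j < dim_col ?I"
  have "(?Z ^\<^sub>m k) $$ (i, j) = (if k = 0 then ?I $$ (i, j) else 0)" for k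
    using ij by (cases k) (auto simp: mat_mult_entry[of _ N N _ N])
  then have "(\<lambda>k. (?Z ^\<^sub>m k) $$ (i, j) / fact k) = (\<lambda>k. if k = 0 then ?I $$ (i, j) else 0)"
    by (auto simp: fun_eq_iff simp del: index_one_mat(1))
  then have "(\<lambda>k. if k = 0 then ?I $$ (i, j) else 0) sums (mat_exp ?Z $$ (i, j))"
    using mat_exp_sums[of ?Z N i j] ij by simp
  moreover have "(\<lambda>k::nat. if k = 0 then ?I $$ (i, j) else 0) sums (?I $$ (i, j))"
    using sums_single[of 0 "\<lambda>_. ?I $$ (i, j)"] by simp
  ultimately show "mat_exp ?Z $$ (i, j) = ?I $$ (i, j)" using sums_unique2 by blast
qed (auto simp: mat_exp_def)

lemma smult_pow_mat:
  assumes "A \<in> carrier_mat N N"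
  shows "((c :: complex) \<cdot>\<^sub>m A) ^\<^sub>m k = c ^ k \<cdot>\<^sub>m A ^\<^sub>m k"
proof (induction k)
  case (Suc k)
  then show ?case
    using assms by (simp add: mult_smult_distrib[of _ N N _ N] mult_smult_assoc_mat[of _ N N _ N], intro eq_matI, auto)
qed (use assms in \<open>auto intro!: eq_matI\<close>)

text \<open>For t in [0, 1] the tail of the series from degree 2 on loses a factor t^2 and is
  otherwise dominated by \<open>exp (real N * B)\<close>. The bound depends on \<open>X\<close> only
  through \<open>B\<close>, which makes it uniform along a loop.\<close>

lemma mat_exp_first_order:
  assumes X: "X \<in> carrier_mat N N" and B: "\<And>i j. i < N \<Longrightarrow> j < N \<Longrightarrow> norm (X $$ (i, j)) \<le> B"
    and ij: "i < N" "j < N" and t: "0 \<le> t" "t \<le> 1"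
  shows "norm (mat_exp (of_real t \<cdot>\<^sub>m X) $$ (i, j) - 1\<^sub>m N $$ (i, j) - of_real t * X $$ (i, j)) \<le> t\<^sup>2 * exp (real N * B)"
proof -
  define c where "c = real N * B"
  have "norm (X $$ (i, j)) \<le> B" using B ij by blast
  then have c: "c \<ge> 0" unfolding c_def by (metis norm_ge_zero of_nat_0_le_iff order.trans zero_le_mult_iff)
  define f where "f k = of_real t ^ k * (X ^\<^sub>m k) $$ (i, j) / fact k" for k
  have "f sums (mat_exp (of_real t \<cdot>\<^sub>m X) $$ (i, j))"
    using mat_exp_sums[of "of_real t \<cdot>\<^sub>m X" N i j] X ij
    by (simp add: smult_pow_mat[OF X] f_def[abs_def])
  then have "(\<lambda>k. f (k + 2)) sums (mat_exp (of_real t \<cdot>\<^sub>m X) $$ (i, j) - (\<Sum>k<2. f k))"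
    by (rule sums_split_initial_segment)
  moreover have "(\<Sum>k<2. f k) = 1\<^sub>m N $$ (i, j) + of_real t * X $$ (i, j)"
    using X ij by (simp add: numeral_2_eq_2 f_def)
  ultimately have s: "(\<lambda>k. f (k + 2)) sums (mat_exp (of_real t \<cdot>\<^sub>m X) $$ (i, j) - 1\<^sub>m N $$ (i, j) - of_real t * X $$ (i, j))"
    by (simp add: algebra_simps)
  have bnd: "norm (f (k + 2)) \<le> t\<^sup>2 * (c ^ (k + 2) / fact (k + 2))" for k
  proof -
    have nf: "norm (f m) = t ^ m * norm ((X ^\<^sub>m m) $$ (i, j)) / fact m" for m
      using t unfolding f_def by (simp add: norm_divide norm_mult norm_power)
    have "t ^ (k + 2) \<le> t ^ 2" using t by (intro power_decreasing) auto
    moreover have "norm ((X ^\<^sub>m (k + 2)) $$ (i, j)) \<le> c ^ (k + 2)"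
      unfolding c_def by (rule norm_pow_mat_entry[OF X B ij])
    ultimately have "t ^ (k + 2) * norm ((X ^\<^sub>m (k + 2)) $$ (i, j)) \<le> t\<^sup>2 * c ^ (k + 2)"
      using t by (intro mult_mono) auto
    then show ?thesis
      unfolding nf times_divide_eq_right by (intro divide_right_mono) auto
  qed
  have e: "(\<lambda>k. c ^ k / fact k) sums exp c"
    using exp_converges[of c] by (simp add: divide_inverse mult.commute)
  have se: "summable (\<lambda>k. c ^ (k + 2) / fact (k + 2))"
    using summable_exp_bound[of c] summable_iff_shift[of "\<lambda>k. c ^ k / fact k" 2] by blast
  have sb: "summable (\<lambda>k. t\<^sup>2 * (c ^ (k + 2) / fact (k + 2)))"
    by (rule summable_mult[OF se])
  have "norm (\<Sum>k. f (k + 2)) \<le> (\<Sum>k. t\<^sup>2 * (c ^ (k + 2) / fact (k + 2)))"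
    by (rule norm_suminf_le[OF bnd sb])
  also have "\<dots> = t\<^sup>2 * (\<Sum>k. c ^ (k + 2) / fact (k + 2))"
    by (rule suminf_mult[OF se])
  also have "\<dots> \<le> t\<^sup>2 * exp c"
  proof -
    have "(\<Sum>k. c ^ (k + 2) / fact (k + 2)) = exp c - (\<Sum>k<2. c ^ k / fact k)"
      using suminf_minus_initial_segment[OF summable_exp_bound[of c], of 2] e by (simp add: sums_iff)
    also have "\<dots> \<le> exp c" using c by (simp add: numeral_2_eq_2)
    finally show ?thesis by (intro mult_left_mono) auto
  qed
  finally show ?thesis using s by (simp add: sums_iff c_def)
qed

section \<open>Smoothness and holomorphy of the exponential\<close>

lemma entries_bounded:
  fixes M :: "'x :: topological_space \<Rightarrow> complex mat"
  assumes "\<And>i j. i < N \<Longrightarrow> j < N \<Longrightarrow> continuous_on K (\<lambda>x. M x $$ (i, j))" "compact K"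
  obtains C where "\<And>i j x. i < N \<Longrightarrow> j < N \<Longrightarrow> x \<in> K \<Longrightarrow> norm (M x $$ (i, j)) \<le> C"
proof -
  have "\<exists>B. \<forall>x\<in>K. norm (M x $$ (i, j)) \<le> B" if "i < N" "j < N" for i j
  proof -
    have "bounded ((\<lambda>x. M x $$ (i, j)) ` K)"
      by (intro compact_imp_bounded compact_continuous_image assms that)
    then show ?thesis by (auto simp: bounded_iff)
  qed
  then obtain B where B: "\<And>i j x. i < N \<Longrightarrow> j < N \<Longrightarrow> x \<in> K \<Longrightarrow> norm (M x $$ (i, j)) \<le> B i j"
    by metis
  show thesis
  proof (rule that[of "Max ((\<lambda>(i, j). B i j) ` ({..<N} \<times> {..<N}))"])
    fix i j x assume ij: "i < N" "j < N" "x \<in> K"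
    show "norm (M x $$ (i, j)) \<le> Max ((\<lambda>(i, j). B i j) ` ({..<N} \<times> {..<N}))"
      by (rule order.trans[OF B[OF ij] Max_ge]) (use ij in auto)
  qed
qed

text \<open>The noncommutative Leibniz sum of the products M^i M' M^(k-1-i), which is the derivative
  of M^k when M' is that of M.\<close>

primrec dpow :: "complex mat \<Rightarrow> complex mat \<Rightarrow> nat \<Rightarrow> complex mat" where
  "dpow M M' 0 = 0\<^sub>m (dim_row M) (dim_row M)"
| "dpow M M' (Suc k) = M ^\<^sub>m k * M' + dpow M M' k * M"

lemma dpow_carrier: "M \<in> carrier_mat N N \<Longrightarrow> M' \<in> carrier_mat N N \<Longrightarrow> dpow M M' k \<in> carrier_mat N N"
  by (induction k) (auto intro!: add_carrier_mat mult_carrier_mat[of _ N N] pow_carrier_mat)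

lemma pow_block_mat:
  assumes "M \<in> carrier_mat N N" "M' \<in> carrier_mat N N"
  shows "four_block_mat M M' (0\<^sub>m N N) M ^\<^sub>m k = four_block_mat (M ^\<^sub>m k) (dpow M M' k) (0\<^sub>m N N) (M ^\<^sub>m k)"
proof (induction k)
  case 0
  show ?case using assms by (intro eq_matI) (auto simp: four_block_mat_def Let_def)
next
  case (Suc k)
  have "four_block_mat M M' (0\<^sub>m N N) M ^\<^sub>m Suc k =
      four_block_mat (M ^\<^sub>m k) (dpow M M' k) (0\<^sub>m N N) (M ^\<^sub>m k) * four_block_mat M M' (0\<^sub>m N N) M"
    using Suc by simp
  also have "\<dots> = four_block_mat (M ^\<^sub>m k * M + dpow M M' k * 0\<^sub>m N N) (M ^\<^sub>m k * M' + dpow M M' k * M)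
      (0\<^sub>m N N * M + M ^\<^sub>m k * 0\<^sub>m N N) (0\<^sub>m N N * M' + M ^\<^sub>m k * M)"
    by (intro mult_four_block_mat) (use assms dpow_carrier[OF assms] pow_carrier_mat[OF assms(1)] in auto)
  also have "\<dots> = four_block_mat (M ^\<^sub>m Suc k) (dpow M M' (Suc k)) (0\<^sub>m N N) (M ^\<^sub>m Suc k)"
    using assms dpow_carrier[OF assms, of k] pow_carrier_mat[OF assms(1), of k]
    by (simp add: mult_carrier_mat[of _ N N _ N] left_mult_zero_mat[of _ N N] right_mult_zero_mat[of _ N N]
        right_add_zero_mat[of _ N N] left_add_zero_mat[of _ N N])
  finally show ?case .
qed

text \<open>The derivative of \<open>exp M\<close> is the upper right block of the exponential of
  \<open>[[M, M'], [0, M]]\<close>, hence again an entry of the exponential of a smooth matrix function.\<close>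

lemma smooth_mat_exp:
  assumes "entries_in (Collect smooth) N M" "i < N" "j < N"
  shows "smooth (\<lambda>t. mat_exp (M t) $$ (i, j))"
\<comment> \<open>The matrix size has to vary within the family, since every differentiation doubles
  it.\<close>
proof (rule smooth_coinduct[where S = "{\<lambda>t. mat_exp (M t) $$ (i, j) | N M i j. entries_in (Collect smooth) N M \<and> i < N \<and> j < N}"], goal_cases)
  case 1
  then show ?case using assms by auto
next
  case (2 g)
  then obtain N M i j where g: "g = (\<lambda>t. mat_exp (M t) $$ (i, j))"
    and M: "entries_in (Collect smooth) N M" and ij: "i < N" "j < N" by auto
  note cM = entries_inD(1)[OF M]
  have "\<exists>D. smooth D \<and> (\<forall>t. ((\<lambda>t. M t $$ (i, j)) has_vector_derivative D t) (at t))" if "i < N" "j < N" for i j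
  proof -
    have "smooth (\<lambda>t. M t $$ (i, j))" using entries_inD(2)[OF M that] by simp
    then show ?thesis by (rule smooth_has_derivative) blast
  qed
  then obtain D where D: "\<And>i j. i < N \<Longrightarrow> j < N \<Longrightarrow> smooth (D i j)"
    "\<And>i j t. i < N \<Longrightarrow> j < N \<Longrightarrow> ((\<lambda>t. M t $$ (i, j)) has_vector_derivative D i j t) (at t)"
    by metis
  define M' where "M' t = mat N N (\<lambda>(i, j). D i j t)" for t
  have cM': "M' t \<in> carrier_mat N N" for t by (simp add: M'_def)
  define L where "L t = four_block_mat (M t) (M' t) (0\<^sub>m N N) (M t)" for t
  have cL: "L t \<in> carrier_mat (N + N) (N + N)" for t
    unfolding L_def using cM by (intro four_block_carrier_mat)
  have L: "entries_in (Collect smooth) (N + N) L"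
  proof (rule entries_inI)
    fix a b assume ab: "a < N + N" "b < N + N"
    have "(\<lambda>t. L t $$ (a, b)) = (if a < N then if b < N then (\<lambda>t. M t $$ (a, b)) else D a (b - N)
        else if b < N then (\<lambda>_. 0) else (\<lambda>t. M t $$ (a - N, b - N)))"
      using ab by (auto simp: fun_eq_iff L_def M'_def carrier_matD[OF cM])
    then show "(\<lambda>t. L t $$ (a, b)) \<in> Collect smooth"
      using ab D(1) entries_inD(2)[OF M] smooth_const by auto
  qed (rule cL)
  have powL: "(L t ^\<^sub>m k) $$ (a, b + N) = dpow (M t) (M' t) k $$ (a, b)" if "a < N" "b < N" for a b k t
    using that pow_block_mat[OF cM cM', of t t k] carrier_matD[OF pow_carrier_mat[OF cM, of t k]] carrier_matD[OF dpow_carrier[OF cM cM', of t t k]]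
    by (simp add: L_def)
  have dM: "((\<lambda>t. (M t ^\<^sub>m k) $$ (a, b)) has_vector_derivative dpow (M t) (M' t) k $$ (a, b)) (at t)"
    if "a < N" "b < N" for a b k t
    using that
  proof (induction k arbitrary: a b)
    case 0
    then show ?case by (simp add: carrier_matD[OF cM])
  next
    case (Suc k)
    have e: "(\<lambda>t. (M t ^\<^sub>m Suc k) $$ (a, b)) = (\<lambda>t. \<Sum>l<N. (M t ^\<^sub>m k) $$ (a, l) * M t $$ (l, b))"
      using mat_mult_entry[OF pow_carrier_mat[OF cM] cM Suc.prems] by (simp del: index_mult_mat(1))
    have "dpow (M t) (M' t) (Suc k) $$ (a, b) = (M t ^\<^sub>m k * M' t) $$ (a, b) + (dpow (M t) (M' t) k * M t) $$ (a, b)"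
      using Suc.prems carrier_matD[OF cM, of t] carrier_matD[OF dpow_carrier[OF cM cM', of t t k]]
      by (simp del: index_mult_mat(1))
    also have "\<dots> = (\<Sum>l<N. (M t ^\<^sub>m k) $$ (a, l) * M' t $$ (l, b)) + (\<Sum>l<N. dpow (M t) (M' t) k $$ (a, l) * M t $$ (l, b))"
      using mat_mult_entry[OF pow_carrier_mat[OF cM] cM' Suc.prems] mat_mult_entry[OF dpow_carrier[OF cM cM'] cM Suc.prems]
      by (simp only:)
    also have "\<dots> = (\<Sum>l<N. (M t ^\<^sub>m k) $$ (a, l) * D l b t + dpow (M t) (M' t) k $$ (a, l) * M t $$ (l, b))"
      using Suc.prems by (simp add: sum.distrib M'_def)
    finally have eq: "dpow (M t) (M' t) (Suc k) $$ (a, b) =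
        (\<Sum>l<N. (M t ^\<^sub>m k) $$ (a, l) * D l b t + dpow (M t) (M' t) k $$ (a, l) * M t $$ (l, b))" .
    show ?case
      unfolding e eq using Suc.prems
      by (intro has_vector_derivative_sum has_vector_derivative_mult Suc.IH D(2)) auto
  qed
  have "(g has_vector_derivative mat_exp (L t0) $$ (i, j + N)) (at t0)" for t0
  proof -
    let ?I = "{t0 - 1<..<t0 + 1}"
    \<comment> \<open>The entries of \<open>L\<close> are bounded only on compact sets, so the
      majorant is taken on a closed interval around \<open>t0\<close> and used on its
      interior.\<close>
    obtain C where "\<And>a b t. a < N + N \<Longrightarrow> b < N + N \<Longrightarrow> t \<in> {t0 - 1..t0 + 1} \<Longrightarrow> norm (L t $$ (a, b)) \<le> C"
      by (rule entries_bounded[of "N + N" "{t0 - 1..t0 + 1}" L]) (use entries_inD(2)[OF L] smooth_continuous in auto)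
    then have C: "norm (L t $$ (a, b)) \<le> C" if "a < N + N" "b < N + N" "t \<in> ?I" for a b t
      using that by simp
    have "((\<lambda>t. \<Sum>k. (M t ^\<^sub>m k) $$ (i, j) / fact k) has_vector_derivative (\<Sum>k. (L t0 ^\<^sub>m k) $$ (i, j + N) / fact k)) (at t0)"
    proof (rule has_vector_derivative_series[of ?I])
      show "((\<lambda>t. (M t ^\<^sub>m k) $$ (i, j) / fact k) has_vector_derivative (L t ^\<^sub>m k) $$ (i, j + N) / fact k) (at t)" for k t
        using dM[OF ij] by (auto simp: powL ij intro!: has_vector_derivative_divide)
      show "norm ((L t ^\<^sub>m k) $$ (i, j + N) / fact k) \<le> (real (N + N) * C) ^ k / fact k" if "t \<in> ?I" for k t
        using norm_pow_mat_entry[OF cL C[OF _ _ that], of i "j + N" k] ij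
        by (simp add: norm_divide divide_right_mono)
      show "summable (\<lambda>k. (M t ^\<^sub>m k) $$ (i, j) / fact k)" for t
        using mat_exp_sums[OF cM ij] by (auto simp: sums_iff)
    qed (auto intro: summable_exp_bound)
    moreover have "(\<lambda>t. \<Sum>k. (M t ^\<^sub>m k) $$ (i, j) / fact k) = g"
      unfolding g using mat_exp_sums[OF cM ij] by (auto simp: sums_iff)
    moreover have "(\<Sum>k. (L t0 ^\<^sub>m k) $$ (i, j + N) / fact k) = mat_exp (L t0) $$ (i, j + N)"
      using mat_exp_sums[OF cL, of i "j + N" t0] ij by (simp add: sums_iff)
    ultimately show ?thesis by simp
  qed
  moreover have "\<exists>N' M' i' j'. (\<lambda>t. mat_exp (L t) $$ (i, j + N)) = (\<lambda>t. mat_exp (M' t) $$ (i', j'))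
      \<and> entries_in (Collect smooth) N' M' \<and> i' < N' \<and> j' < N'"
    using L ij by (rule_tac exI[of _ "N + N"], rule_tac exI[of _ L], rule_tac exI[of _ i], rule_tac exI[of _ "j + N"]) simp
  ultimately show ?case
    by (intro bexI[of _ "\<lambda>t. mat_exp (L t) $$ (i, j + N)"] CollectI) simp_all
qed

lemma entries_in_smooth_mat_exp:
  assumes "entries_in (Collect smooth) N M"
  shows "entries_in (Collect smooth) N (\<lambda>t. mat_exp (M t))"
  by (rule entries_inI) (use smooth_mat_exp[OF assms] mat_exp_carrier[OF entries_inD(1)[OF assms]] in auto)

text \<open>Entries of powers lie in the disc algebra, and the closed disc is compact, so the
  exponential series has a uniform majorant there.\<close>

lemma entries_in_disc_mat_exp:
  assumes F: "entries_in disc_fun N F"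
  shows "entries_in disc_fun N (\<lambda>z. mat_exp (F z))"
proof (rule entries_inI)
  note cF = entries_inD(1)[OF F]
  show "mat_exp (F z) \<in> carrier_mat N N" for z by (rule mat_exp_carrier[OF cF])
  fix i j assume ij: "i < N" "j < N"
  obtain C where C: "\<And>a b z. a < N \<Longrightarrow> b < N \<Longrightarrow> z \<in> cball 0 1 \<Longrightarrow> norm (F z $$ (a, b)) \<le> C"
    by (rule entries_bounded[of N "cball 0 1" F]) (use entries_inD(2)[OF F] in \<open>auto simp: disc_fun_def\<close>)
  have "(\<lambda>z. \<Sum>k. (F z ^\<^sub>m k) $$ (i, j) / fact k) \<in> disc_fun"
  proof (rule disc_fun_series)
    fix k
    have "(\<lambda>z. (F z ^\<^sub>m k) $$ (i, j)) \<in> disc_fun"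
      by (rule entries_inD(2)[OF entries_in_pow[OF ring_closed_disc_fun F] ij])
    from ring_closed_simps(3)[OF ring_closed_disc_fun this ring_closed_simps(1)[OF ring_closed_disc_fun, of "1 / fact k"]]
    show "(\<lambda>z. (F z ^\<^sub>m k) $$ (i, j) / fact k) \<in> disc_fun" by simp
    show "norm ((F z ^\<^sub>m k) $$ (i, j) / fact k) \<le> (real N * C) ^ k / fact k" if "z \<in> cball 0 1" for z
      using norm_pow_mat_entry[OF cF C[OF _ _ that], of i j k] ij
      by (simp add: norm_divide divide_right_mono)
  qed (rule summable_exp_bound)
  moreover have "(\<lambda>z. \<Sum>k. (F z ^\<^sub>m k) $$ (i, j) / fact k) = (\<lambda>z. mat_exp (F z) $$ (i, j))"
    using mat_exp_sums[OF cF ij] by (auto simp: sums_iff)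
  ultimately show "(\<lambda>z. mat_exp (F z) $$ (i, j)) \<in> disc_fun" by simp
qed

section \<open>Truncated q-exponentials\<close>

text \<open>For \<open>n \<ge> 1\<close> this is a primitive n-th root of unity, and
  \<open>sigma n k\<close> is the q-number of k. The q-numbers vanish at 0 and at n but not in
  between, which matches the upper and the lower edge of the n by n matrices.\<close>

definition qq :: "nat \<Rightarrow> complex" where "qq n = alpha n ^ 2"

lemma alpha_cis: "alpha n = cis (pi / real n)"
  by (simp add: alpha_def cis_conv_exp mult.commute)

lemma alpha_power_n: "n \<ge> 1 \<Longrightarrow> alpha n ^ n = -1"
  by (simp add: alpha_cis Complex.DeMoivre)

lemma qq_power_n: "n \<ge> 1 \<Longrightarrow> qq n ^ n = 1"
  by (simp add: qq_def power_mult[symmetric] mult.commute[of 2] power_mult alpha_power_n)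

lemma qq_power_neq_1:
  assumes "0 < m" "m < n"
  shows "qq n ^ m \<noteq> 1"
proof
  assume "qq n ^ m = 1"
  then have "cis (2 * pi / real n) powi int m = 1"
    using assms by (simp add: qq_def alpha_cis Complex.DeMoivre)
  then have "int n dvd int m" using cis_powi_eq_1[of n "int m"] assms by simp
  then show False using assms by (simp add: nat_dvd_not_less)
qed

lemma sigma_qq: "sigma n k = (1 - qq n ^ k) / (1 - qq n)"
  by (simp add: sigma_def qq_def power_mult)

lemma sigma_0 [simp]: "sigma n 0 = 0"
  by (simp add: sigma_def)

lemma sigma_n: "n \<ge> 1 \<Longrightarrow> sigma n n = 0"
  by (simp add: sigma_qq qq_power_n)

lemma sigma_nonzero: "0 < k \<Longrightarrow> k < n \<Longrightarrow> sigma n k \<noteq> 0"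
  using qq_power_neq_1[of k n] qq_power_neq_1[of 1 n] by (auto simp: sigma_qq)

lemma sigma_mult: "0 < k \<Longrightarrow> k < n \<Longrightarrow> (1 - qq n) * sigma n k = 1 - qq n ^ k"
  using qq_power_neq_1[of 1 n] by (auto simp: sigma_qq)

text \<open>The coefficients of the inverse of the series with coefficients \<open>c\<^sub>k\<close>.\<close>

definition coeff_d :: "nat \<Rightarrow> nat \<Rightarrow> complex" where
  "coeff_d n k = (-1) ^ k * qq n ^ (k * (k - 1) div 2) * coeff_c n k"

lemma coeff_0 [simp]: "coeff_c n 0 = 1" "coeff_d n 0 = 1"
  by (simp_all add: coeff_c_def coeff_d_def)

lemma coeff_c_Suc: "coeff_c n (Suc k) = coeff_c n k / sigma n (Suc k)"
  by (simp add: coeff_c_def divide_inverse)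

text \<open>Coefficient form of phi(qz) = (1 - (1 - q) z Lambda) phi(z). It stops below n, where
  \<open>sigma n n = 0\<close> would be the divisor.\<close>

lemma coeff_c_rec:
  assumes "Suc k < n"
  shows "(qq n ^ Suc k - 1) * coeff_c n (Suc k) = - (1 - qq n) * coeff_c n k"
proof -
  have s: "sigma n (Suc k) \<noteq> 0" "qq n ^ Suc k - 1 = - ((1 - qq n) * sigma n (Suc k))"
    using sigma_nonzero[of "Suc k" n] sigma_mult[of "Suc k" n] assms by auto
  show ?thesis unfolding s(2) coeff_c_Suc using s(1) by (simp add: algebra_simps)
qed

text \<open>Coefficient form of phi(z)^(-1) = (1 - (1 - q) z Lambda) phi(qz)^(-1); the factor
  \<open>qq n ^ k\<close> comes from the argument qz on the right.\<close>

lemma coeff_d_rec: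
  assumes "Suc k < n"
  shows "(qq n ^ Suc k - 1) * coeff_d n (Suc k) = (1 - qq n) * qq n ^ k * coeff_d n k"
proof -
  have "Suc k * (Suc k - 1) div 2 = k * (k - 1) div 2 + k"
  proof (cases k)
    case (Suc l)
    have "Suc k * (Suc k - 1) = k * (k - 1) + k * 2" by (simp add: Suc algebra_simps)
    then show ?thesis by simp
  qed simp
  then have "coeff_d n (Suc k) = - ((-1) ^ k) * (qq n ^ (k * (k - 1) div 2) * qq n ^ k) * coeff_c n (Suc k)"
    by (simp only: coeff_d_def power_add power_Suc) simp
  then have "(qq n ^ Suc k - 1) * coeff_d n (Suc k) =
      - ((-1) ^ k) * (qq n ^ (k * (k - 1) div 2) * qq n ^ k) * ((qq n ^ Suc k - 1) * coeff_c n (Suc k))"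
    by (simp add: mult_ac)
  also have "\<dots> = (1 - qq n) * qq n ^ k * coeff_d n k"
    unfolding coeff_c_rec[OF assms] coeff_d_def by (simp add: algebra_simps)
  finally show ?thesis .
qed

text \<open>For s at most a and a < n, the entry of Lambda^s in row a and column a - s. For s > a
  the truncated subtraction puts \<open>sigma n 0 = 0\<close> into the product, as it should once
  the column has left the matrix.\<close>

definition falling :: "nat \<Rightarrow> nat \<Rightarrow> nat \<Rightarrow> complex" where
  "falling n a s = (\<Prod>i<s. sigma n (a - i))"

text \<open>For b + t < n, the entry of Lambda^t in row b + t and column b; at the lower edge of the
  matrix the factor \<open>sigma n n = 0\<close> appears.\<close>

definition rising :: "nat \<Rightarrow> nat \<Rightarrow> nat \<Rightarrow> complex" where
  "rising n b t = (\<Prod>i<t. sigma n (b + 1 + i))"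

lemma falling_0 [simp]: "falling n a 0 = 1" and rising_0 [simp]: "rising n b 0 = 1"
  by (simp_all add: falling_def rising_def)

lemma falling_Suc: "falling n a (Suc s) = sigma n a * falling n (a - 1) s"
  unfolding falling_def prod.lessThan_Suc_shift by simp

lemma rising_Suc: "rising n b (Suc t) = sigma n (Suc b) * rising n (Suc b) t"
  unfolding rising_def prod.lessThan_Suc_shift by simp

lemma falling_eq_0: "a < s \<Longrightarrow> falling n a s = 0"
  unfolding falling_def by (rule prod_zero) (auto intro!: bexI[of _ a])

lemma rising_eq_0: "b < n \<Longrightarrow> n \<le> b + t \<Longrightarrow> rising n b t = 0"
  unfolding rising_def by (rule prod_zero) (auto intro!: bexI[of _ "n - 1 - b"] simp: sigma_n)

text \<open>\<open>Xi n \<beta> X m\<close> is the coefficient of \<open>z\<^sup>m\<close> in \<open>\<phi>(\<beta>z)\<^sup>-\<^sup>1 X \<phi>(z)\<close>.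
  As \<open>\<phi>(qz) = \<phi>(z) (1 - (1 - q) z \<Lambda>)\<close> with \<open>q = \<alpha>\<^sup>2\<close>, these coefficients satisfy a first-order
  recursion; its leading factor \<open>q\<^sup>m - 1\<close> depends only on \<open>m\<close> modulo \<open>n\<close>, so the part of degree at
  least \<open>n\<close> is again of the same form.\<close>

definition Xi :: "nat \<Rightarrow> complex \<Rightarrow> (nat \<Rightarrow> nat \<Rightarrow> complex) \<Rightarrow> nat \<Rightarrow> nat \<Rightarrow> nat \<Rightarrow> complex" where
  "Xi n \<beta> X m a b = (\<Sum>s\<le>m. \<beta> ^ s * coeff_d n s * falling n a s * X (a - s) (b + (m - s))
      * rising n b (m - s) * coeff_c n (m - s))"

lemma Xi_0 [simp]: "Xi n \<beta> X 0 a b = X a b"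
  by (simp add: Xi_def)

text \<open>In matrix form the right-hand side is (1 - q) (beta q^m Lambda Xi_m - Xi_m Lambda). At
  the edges \<open>a = 0\<close> and \<open>Suc b = n\<close> the factor \<open>sigma\<close>
  vanishes, so the out-of-range indices do no harm.\<close>

lemma Xi_rec:
  assumes "a < n" "b < n"
  shows "(qq n ^ Suc m - 1) * Xi n \<beta> X (Suc m) a b =
    (1 - qq n) * (\<beta> * qq n ^ m * sigma n a * Xi n \<beta> X m (a - 1) b - sigma n (Suc b) * Xi n \<beta> X m a (Suc b))"
proof -
  \<comment> \<open>\<open>A\<close> belongs to the inverse of phi and \<open>R\<close> to phi.
    Their one-step recursions \<open>AS\<close> and \<open>RS\<close> hold for every index, since
    beyond the edge of the matrix both sides vanish.\<close>
  define A where "A s = coeff_d n s * falling n a s" for s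
  define R where "R t = rising n b t * coeff_c n t" for t
  have A0: "(qq n ^ 0 - 1) * A 0 = 0" by simp
  have AS: "(qq n ^ Suc s - 1) * A (Suc s) = (1 - qq n) * qq n ^ s * sigma n a * (coeff_d n s * falling n (a - 1) s)" for s
  proof (cases "Suc s < n")
    case True
    have "(qq n ^ Suc s - 1) * A (Suc s) = ((qq n ^ Suc s - 1) * coeff_d n (Suc s)) * (sigma n a * falling n (a - 1) s)"
      by (simp add: A_def falling_Suc)
    also have "\<dots> = (1 - qq n) * qq n ^ s * sigma n a * (coeff_d n s * falling n (a - 1) s)"
      unfolding coeff_d_rec[OF True] by simp
    finally show ?thesis .
  next
    case False
    then have "falling n a (Suc s) = 0" using assms by (intro falling_eq_0) simp
    then have "sigma n a * falling n (a - 1) s = 0" "A (Suc s) = 0" by (simp_all add: falling_Suc A_def)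
    then show ?thesis by auto
  qed
  have RS: "(qq n ^ Suc t - 1) * R (Suc t) = - (1 - qq n) * sigma n (Suc b) * (rising n (Suc b) t * coeff_c n t)" for t
  proof (cases "Suc t < n")
    case True
    have "(qq n ^ Suc t - 1) * R (Suc t) = ((qq n ^ Suc t - 1) * coeff_c n (Suc t)) * (sigma n (Suc b) * rising n (Suc b) t)"
      by (simp add: R_def rising_Suc)
    also have "\<dots> = - (1 - qq n) * sigma n (Suc b) * (rising n (Suc b) t * coeff_c n t)"
      unfolding coeff_c_rec[OF True] by simp
    finally show ?thesis .
  next
    case False
    then have "rising n b (Suc t) = 0" using assms by (intro rising_eq_0) auto
    then have "sigma n (Suc b) * rising n (Suc b) t = 0" "R (Suc t) = 0" by (simp_all add: rising_Suc R_def)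
    then show ?thesis by auto
  qed
  define Y where "Y s = X (a - s) (b + (Suc m - s))" for s
  have "Xi n \<beta> X (Suc m) a b = (\<Sum>s\<le>Suc m. \<beta> ^ s * A s * Y s * R (Suc m - s))"
    unfolding Xi_def by (intro sum.cong refl) (simp add: A_def R_def Y_def mult_ac)
  then have "(qq n ^ Suc m - 1) * Xi n \<beta> X (Suc m) a b = (\<Sum>s\<le>Suc m. (qq n ^ Suc m - 1) * (\<beta> ^ s * A s * Y s * R (Suc m - s)))"
    by (simp only: sum_distrib_left)
  \<comment> \<open>Here q^(m+1) - 1 = q^(m+1-s) (q^s - 1) + (q^(m+1-s) - 1), so that each summand
    meets only one of the two recursions. The first part drops out for s = 0, the second for s = m +
    1.\<close>
  also have "\<dots> = (\<Sum>s\<le>Suc m. qq n ^ (Suc m - s) * \<beta> ^ s * ((qq n ^ s - 1) * A s) * Y s * R (Suc m - s)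
      + \<beta> ^ s * A s * Y s * ((qq n ^ (Suc m - s) - 1) * R (Suc m - s)))"
  proof (rule sum.cong)
    fix s assume "s \<in> {..Suc m}"
    then have "qq n ^ Suc m = qq n ^ (Suc m - s) * qq n ^ s" by (simp add: power_add[symmetric])
    then show "(qq n ^ Suc m - 1) * (\<beta> ^ s * A s * Y s * R (Suc m - s)) =
      qq n ^ (Suc m - s) * \<beta> ^ s * ((qq n ^ s - 1) * A s) * Y s * R (Suc m - s)
      + \<beta> ^ s * A s * Y s * ((qq n ^ (Suc m - s) - 1) * R (Suc m - s))"
      by (simp add: algebra_simps del: power_Suc)
  qed simp
  also have "\<dots> = (\<Sum>s\<le>Suc m. qq n ^ (Suc m - s) * \<beta> ^ s * ((qq n ^ s - 1) * A s) * Y s * R (Suc m - s))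
      + (\<Sum>s\<le>Suc m. \<beta> ^ s * A s * Y s * ((qq n ^ (Suc m - s) - 1) * R (Suc m - s)))"
    by (rule sum.distrib)
  also have "(\<Sum>s\<le>Suc m. qq n ^ (Suc m - s) * \<beta> ^ s * ((qq n ^ s - 1) * A s) * Y s * R (Suc m - s)) =
      (\<Sum>s\<le>m. qq n ^ (m - s) * \<beta> ^ Suc s * ((qq n ^ Suc s - 1) * A (Suc s)) * Y (Suc s) * R (m - s))"
    unfolding sum.atMost_Suc_shift A0 by simp
  also have "\<dots> = (1 - qq n) * (\<beta> * qq n ^ m * sigma n a * Xi n \<beta> X m (a - 1) b)"
    unfolding Xi_def sum_distrib_left
  proof (rule sum.cong)
    fix s assume "s \<in> {..m}"
    then have q: "qq n ^ m = qq n ^ (m - s) * qq n ^ s" by (simp add: power_add[symmetric])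
    show "qq n ^ (m - s) * \<beta> ^ Suc s * ((qq n ^ Suc s - 1) * A (Suc s)) * Y (Suc s) * R (m - s) =
      (1 - qq n) * (\<beta> * qq n ^ m * sigma n a * (\<beta> ^ s * coeff_d n s * falling n (a - 1) s * X (a - 1 - s) (b + (m - s))
        * rising n b (m - s) * coeff_c n (m - s)))"
      unfolding AS q by (simp add: Y_def R_def mult_ac)
  qed simp
  also have "(\<Sum>s\<le>Suc m. \<beta> ^ s * A s * Y s * ((qq n ^ (Suc m - s) - 1) * R (Suc m - s))) =
      (\<Sum>s\<le>m. \<beta> ^ s * A s * Y s * ((qq n ^ Suc (m - s) - 1) * R (Suc (m - s))))"
    by (simp add: Suc_diff_le)
  also have "\<dots> = - ((1 - qq n) * (sigma n (Suc b) * Xi n \<beta> X m a (Suc b)))"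
    unfolding Xi_def sum_distrib_left sum_negf[symmetric]
  proof (rule sum.cong)
    fix s assume "s \<in> {..m}"
    then have "Y s = X (a - s) (Suc b + (m - s))" by (simp add: Y_def Suc_diff_le)
    then show "\<beta> ^ s * A s * Y s * ((qq n ^ Suc (m - s) - 1) * R (Suc (m - s))) =
      - ((1 - qq n) * (sigma n (Suc b) * (\<beta> ^ s * coeff_d n s * falling n a s * X (a - s) (Suc b + (m - s))
        * rising n (Suc b) (m - s) * coeff_c n (m - s))))"
      unfolding RS A_def by (simp only: minus_mult_left[symmetric] minus_mult_right[symmetric]) (simp add: mult_ac)
  qed simp
  finally show ?thesis by (simp only: right_diff_distrib add_uminus_conv_diff)
qed

text \<open>Powers of Lambda leading out of the n by n square vanish through \<open>falling\<close>
  or \<open>rising\<close>, so only entries of \<open>X\<close> with both indices below n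
  matter.\<close>

lemma Xi_eq_0:
  assumes "a < n" "b < n" "\<And>s. s \<le> m \<Longrightarrow> s \<le> a \<Longrightarrow> b + (m - s) < n \<Longrightarrow> X (a - s) (b + (m - s)) = 0"
  shows "Xi n \<beta> X m a b = 0"
  unfolding Xi_def
proof (intro sum.neutral ballI)
  fix s assume "s \<in> {..m}"
  then show "\<beta> ^ s * coeff_d n s * falling n a s * X (a - s) (b + (m - s)) * rising n b (m - s) * coeff_c n (m - s) = 0"
    using assms(3)[of s] falling_eq_0[of a s n] rising_eq_0[OF assms(2), of "m - s"]
    by (cases "s \<le> a"; cases "b + (m - s) < n") auto
qed

text \<open>This says that \<open>coeff_d\<close> really gives the inverse of phi. The identity
  commutes with Lambda, so the recursion produces 0 in degree 1 and then in every degree below n;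
  from degree n on, a nonzero term would require a = b + m, which is at least n.\<close>

lemma Xi_delta:
  assumes "a < n" "b < n" "m \<ge> 1"
  shows "Xi n 1 (\<lambda>i j. if i = j then 1 else 0) m a b = 0"
proof (cases "m < n")
  case True
  then show ?thesis
    using assms
  proof (induction m arbitrary: a b)
    case (Suc m)
    let ?X = "\<lambda>i j. if i = j then 1 else 0 :: complex"
    \<comment> \<open>For m = 0 this is the vanishing commutator of Lambda with the identity; for
      larger m both terms vanish by induction or at the edge \<open>Suc b = n\<close>.\<close>
    have z: "qq n ^ m * sigma n a * Xi n 1 ?X m (a - 1) b - sigma n (Suc b) * Xi n 1 ?X m a (Suc b) = 0"
    proof (cases "m = 0")
      case True
      then show ?thesis by (cases a) auto
    next
      case False
      have "Xi n 1 ?X m (a - 1) b = 0" using Suc.IH[of "a - 1" b] Suc.prems False by simp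
      moreover have "sigma n (Suc b) * Xi n 1 ?X m a (Suc b) = 0"
        using Suc.IH[of a "Suc b"] Suc.prems False by (cases "Suc b < n") (auto simp: sigma_n not_less_eq less_Suc_eq)
      ultimately show ?thesis by simp
    qed
    have "(qq n ^ Suc m - 1) * Xi n 1 ?X (Suc m) a b = 0"
      unfolding Xi_rec[OF Suc.prems(2,3)] using z by (simp add: mult.assoc)
    then show ?case using qq_power_neq_1[of "Suc m" n] Suc.prems by simp
  qed simp
next
  case False
  then show ?thesis using assms by (intro Xi_eq_0) auto
qed

text \<open>Both sides agree for j = 0 and obey the same recursion in j. For 0 < j < n the factor
  q^j - 1 is nonzero and can be cancelled; for j at least n both sides vanish because the total
  degree is at most 2n - 2.\<close>

lemma Xi_shift:
  assumes "a < n" "b < n"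
  shows "Xi n \<beta> X (n + j) a b = Xi n \<beta> (Xi n \<beta> X n) j a b"
proof (cases "j < n")
  case True
  then show ?thesis
    using assms
  proof (induction j arbitrary: a b)
    case (Suc j)
    have n: "n \<ge> 1" using Suc.prems by simp
    have "sigma n (Suc b) * Xi n \<beta> X (n + j) a (Suc b) = sigma n (Suc b) * Xi n \<beta> (Xi n \<beta> X n) j a (Suc b)"
    proof (cases "Suc b < n")
      case False
      then have "Suc b = n" using Suc.prems by simp
      then show ?thesis using sigma_n[OF n] by simp
    qed (use Suc in simp)
    moreover have "Xi n \<beta> X (n + j) (a - 1) b = Xi n \<beta> (Xi n \<beta> X n) j (a - 1) b"
      using Suc by simp
    moreover have "qq n ^ (n + k) = qq n ^ k" for k by (simp add: power_add qq_power_n[OF n])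
    ultimately have "(qq n ^ Suc j - 1) * Xi n \<beta> X (n + Suc j) a b = (qq n ^ Suc j - 1) * Xi n \<beta> (Xi n \<beta> X n) (Suc j) a b"
      using Xi_rec[OF Suc.prems(2,3), where m = "n + j"] Xi_rec[OF Suc.prems(2,3), where m = j]
      by (metis add_Suc_right)
    then show ?case using qq_power_neq_1[of "Suc j" n] Suc.prems by simp
  qed simp
next
  case False
  have "Xi n \<beta> X (n + j) a b = 0" using False assms by (intro Xi_eq_0) auto
  moreover have "Xi n \<beta> (Xi n \<beta> X n) j a b = 0"
    using False assms by (intro Xi_eq_0[of a n b]) (auto intro!: Xi_eq_0)
  ultimately show ?thesis by simp
qed

section \<open>Conjugation by \<open>\<phi>\<close>\<close>

definition phi_entry :: "nat \<Rightarrow> complex \<Rightarrow> nat \<Rightarrow> nat \<Rightarrow> complex" where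
  "phi_entry n z i j = (if j \<le> i then rising n j (i - j) * coeff_c n (i - j) * z ^ (i - j) else 0)"

definition phi_inv_entry :: "nat \<Rightarrow> complex \<Rightarrow> nat \<Rightarrow> nat \<Rightarrow> complex" where
  "phi_inv_entry n z i j = (if j \<le> i then coeff_d n (i - j) * falling n i (i - j) * z ^ (i - j) else 0)"

text \<open>An entry of phi(w)^(-1) X phi(z). The arguments are kept separate because the blocks of
  \<open>psi\<close> combine phi at z with phi at alpha z.\<close>

definition conj_entry :: "nat \<Rightarrow> complex \<Rightarrow> complex \<Rightarrow> (nat \<Rightarrow> nat \<Rightarrow> complex) \<Rightarrow> nat \<Rightarrow> nat \<Rightarrow> complex" where
  "conj_entry n w z X a b = (\<Sum>i<n. \<Sum>j<n. phi_inv_entry n w a i * X i j * phi_entry n z j b)"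

lemma conj_entry_expand:
  assumes "a < n" "b < n"
  shows "conj_entry n (\<beta> * z) z X a b = (\<Sum>m<2*n. Xi n \<beta> X m a b * z ^ m)"
proof -
  define g where "g s t = \<beta> ^ s * coeff_d n s * falling n a s * X (a - s) (b + t) * rising n b t * coeff_c n t" for s t
  have g0: "g s t = 0" if "s > a \<or> b + t \<ge> n" for s t
    using that falling_eq_0[of a s n] rising_eq_0[OF assms(2), of t] by (auto simp: g_def)
  have row: "(\<Sum>j<n. phi_inv_entry n (\<beta> * z) a i * X i j * phi_entry n z j b) = (\<Sum>t<n. g (a - i) t * (z ^ (a - i) * z ^ t))"
    if "i \<le> a" for i
  proof -
    have "(\<Sum>j<n. phi_inv_entry n (\<beta> * z) a i * X i j * phi_entry n z j b)
        = (\<Sum>j\<in>{b..<n}. phi_inv_entry n (\<beta> * z) a i * X i j * phi_entry n z j b)"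
      by (rule sum.mono_neutral_right) (auto simp: phi_entry_def)
    also have "\<dots> = (\<Sum>t\<in>{..<n - b}. g (a - i) t * (z ^ (a - i) * z ^ t))"
      by (rule sum.reindex_bij_witness[of _ "\<lambda>t. b + t" "\<lambda>j. j - b"])
         (use that in \<open>auto simp: phi_entry_def phi_inv_entry_def g_def power_mult_distrib mult_ac\<close>)
    also have "\<dots> = (\<Sum>t<n. g (a - i) t * (z ^ (a - i) * z ^ t))"
      by (rule sum.mono_neutral_left) (auto intro!: g0)
    finally show ?thesis .
  qed
  have "conj_entry n (\<beta> * z) z X a b = (\<Sum>i\<in>{..a}. \<Sum>j<n. phi_inv_entry n (\<beta> * z) a i * X i j * phi_entry n z j b)"
    unfolding conj_entry_def by (rule sum.mono_neutral_right) (use assms in \<open>auto simp: phi_inv_entry_def\<close>)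
  also have "\<dots> = (\<Sum>i\<in>{..a}. \<Sum>t<n. g (a - i) t * (z ^ (a - i) * z ^ t))"
    by (intro sum.cong refl row) auto
  also have "\<dots> = (\<Sum>s\<in>{..a}. \<Sum>t<n. g s t * (z ^ s * z ^ t))"
    by (rule sum.reindex_bij_witness[of _ "\<lambda>s. a - s" "\<lambda>s. a - s"]) auto
  also have "\<dots> = (\<Sum>s<n. \<Sum>t<n. g s t * (z ^ s * z ^ t))"
    by (rule sum.mono_neutral_left) (use assms in \<open>auto simp: g0\<close>)
  also have "\<dots> = (\<Sum>(s, t)\<in>{..<n} \<times> {..<n}. g s t * (z ^ s * z ^ t))"
    by (rule sum.cartesian_product)
  \<comment> \<open>The square of exponents is enlarged to a triangle, on which sorting by total
    degree is immediate; the added terms vanish.\<close>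
  also have "\<dots> = (\<Sum>(s, t)\<in>{(s, t). s + t < 2 * n}. g s t * (z ^ s * z ^ t))"
  proof (rule sum.mono_neutral_left)
    show "finite {(s, t). s + t < 2 * n}"
      by (rule finite_subset[of _ "{..<2*n} \<times> {..<2*n}"]) auto
  qed (use assms in \<open>auto intro!: g0\<close>)
  also have "\<dots> = (\<Sum>m<2*n. \<Sum>s\<le>m. g s (m - s) * (z ^ s * z ^ (m - s)))"
    by (rule sum.triangle_reindex)
  also have "\<dots> = (\<Sum>m<2*n. Xi n \<beta> X m a b * z ^ m)"
    unfolding Xi_def sum_distrib_right g_def by (intro sum.cong refl) (simp add: power_add[symmetric])
  finally show ?thesis .
qed

lemma sum_lessThan_add: "(\<Sum>m<n + k. f m) = (\<Sum>m<n. f m) + (\<Sum>j<k. f (n + j :: nat) :: complex)"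
  by (induction k) (auto simp: add.assoc)

text \<open>By \<open>Xi_shift\<close> the part of degree at least n is z^n times the conjugate of
  the degree-n coefficient, so one subtraction removes all of it at once.\<close>

lemma conj_entry_reduce:
  assumes "a < n" "b < n"
  shows "conj_entry n (\<beta> * z) z (\<lambda>i j. X i j - z ^ n * Xi n \<beta> X n i j) a b = (\<Sum>m<n. Xi n \<beta> X m a b * z ^ m)"
proof -
  let ?r = "Xi n \<beta> X n"
  have "conj_entry n (\<beta> * z) z (\<lambda>i j. X i j - z ^ n * ?r i j) a b
      = conj_entry n (\<beta> * z) z X a b - z ^ n * conj_entry n (\<beta> * z) z ?r a b"
    by (simp add: conj_entry_def algebra_simps sum_subtractf sum_distrib_left)
  also have "conj_entry n (\<beta> * z) z X a b = (\<Sum>m<n. Xi n \<beta> X m a b * z ^ m) + (\<Sum>j<n. Xi n \<beta> X (n + j) a b * z ^ (n + j))"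
    unfolding conj_entry_expand[OF assms] mult_2 by (rule sum_lessThan_add)
  \<comment> \<open>A coefficient of degree n has no conjugate terms of degree n or more: together
    they would exceed the maximal total degree 2n - 2.\<close>
  also have "conj_entry n (\<beta> * z) z ?r a b = (\<Sum>m<n. Xi n \<beta> ?r m a b * z ^ m)"
  proof -
    have "Xi n \<beta> ?r m a b = 0" if "m \<ge> n" for m
      using that assms by (intro Xi_eq_0[of a n b]) (auto intro!: Xi_eq_0)
    then show ?thesis
      unfolding conj_entry_expand[OF assms] by (intro sum.mono_neutral_right) auto
  qed
  finally show ?thesis
    unfolding Xi_shift[OF assms] by (simp add: sum_distrib_left power_add mult_ac)
qed

lemma conj_entry_delta:
  assumes "a < n" "b < n"
  shows "conj_entry n z z (\<lambda>i j. if i = j then 1 else 0) a b = (if a = b then 1 else 0)"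
proof -
  have "conj_entry n (1 * z) z (\<lambda>i j. if i = j then 1 else 0) a b = (\<Sum>m\<in>{0}. Xi n 1 (\<lambda>i j. if i = j then 1 else 0) m a b * z ^ m)"
    unfolding conj_entry_expand[OF assms] using Xi_delta[OF assms] assms by (intro sum.mono_neutral_right) (auto simp: Suc_le_eq)
  then show ?thesis by simp
qed

section \<open>Polynomials of degree strictly less than d\<close>

definition polydeg :: "nat \<Rightarrow> (complex \<Rightarrow> complex) \<Rightarrow> bool" where
  "polydeg d f \<longleftrightarrow> (\<exists>c. \<forall>z. f z = (\<Sum>m<d. c m * z ^ m))"

lemma polydegI: "(\<And>z. f z = (\<Sum>m<d. c m * z ^ m)) \<Longrightarrow> polydeg d f"
  by (auto simp: polydeg_def)

lemma polydeg_monom: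
  assumes "k < d"
  shows "polydeg d (\<lambda>z. c * z ^ k)"
proof (rule polydegI)
  show "c * z ^ k = (\<Sum>m<d. (if m = k then c else 0) * z ^ m)" for z
    using assms by (simp add: if_distrib[of "\<lambda>x. x * _"] cong: if_cong)
qed

lemma polydeg_zero: "polydeg d (\<lambda>_. 0)"
  by (rule polydegI[where c = "\<lambda>_. 0"]) simp

lemma polydeg_add: "polydeg d f \<Longrightarrow> polydeg d g \<Longrightarrow> polydeg d (\<lambda>z. f z + g z)"
  unfolding polydeg_def by (elim exE, rule_tac x = "\<lambda>m. c m + ca m" in exI) (simp add: algebra_simps sum.distrib)

lemma polydeg_cmult: "polydeg d f \<Longrightarrow> polydeg d (\<lambda>z. c * f z)"
  unfolding polydeg_def by (elim exE, rule_tac x = "\<lambda>m. c * ca m" in exI) (simp add: mult.assoc sum_distrib_left)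

lemma polydeg_scale: "polydeg d f \<Longrightarrow> polydeg d (\<lambda>z. f (u * z))"
  unfolding polydeg_def by (elim exE, rule_tac x = "\<lambda>m. c m * u ^ m" in exI) (simp add: power_mult_distrib mult_ac)

lemma polydeg_shift:
  assumes "polydeg d f"
  shows "polydeg (k + d) (\<lambda>z. z ^ k * f z)"
proof -
  obtain c where c: "\<And>z. f z = (\<Sum>m<d. c m * z ^ m)" using assms by (auto simp: polydeg_def)
  show ?thesis
    by (rule polydegI[where c = "\<lambda>m. if m < k then 0 else c (m - k)"])
       (simp add: sum_lessThan_add c sum_distrib_left power_add mult_ac)
qed

lemma polydeg_mono:
  assumes "polydeg d f" "d \<le> e"
  shows "polydeg e f"
proof -
  obtain c where c: "\<And>z. f z = (\<Sum>m<d. c m * z ^ m)" using assms by (auto simp: polydeg_def)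
  show ?thesis
    by (rule polydegI[where c = "\<lambda>m. if m < d then c m else 0"])
       (use assms(2) in \<open>auto simp: c split: if_splits intro!: sum.mono_neutral_cong_left\<close>)
qed

section \<open>The matrix \<open>\<psi>\<close> and its inverse\<close>

lemma minv_eqI:
  assumes "A \<in> carrier_mat N N" "B \<in> carrier_mat N N" "A * B = 1\<^sub>m N" "B * A = 1\<^sub>m N"
  shows "minv A = B"
proof (cases "mat_inverse A")
  case None
  from mat_inverse(1)[OF assms(1) this, of "()"] assms have False
    by (auto simp: Units_def ring_mat_def)
  then show ?thesis ..
next
  case (Some C)
  from mat_inverse(2)[OF assms(1) this] have C: "A * C = 1\<^sub>m N" "C \<in> carrier_mat N N" by auto
  have "B = B * (A * C)" using C assms(2) by simp
  also have "\<dots> = B * A * C" by (rule assoc_mult_mat[OF assms(2,1) C(2), symmetric])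
  also have "\<dots> = C" using assms C by simp
  finally show ?thesis using Some by simp
qed

lemma Lambda_power:
  assumes "i < n" "j < n"
  shows "(Lambda n ^\<^sub>m k) $$ (i, j) = (if i = j + k then rising n j k else 0)"
  using assms
proof (induction k arbitrary: j)
  case 0
  then show ?case by (simp add: Lambda_def)
next
  case (Suc k)
  have L: "Lambda n \<in> carrier_mat n n" by (simp add: Lambda_def)
  have "(Lambda n ^\<^sub>m Suc k) $$ (i, j) = (\<Sum>l<n. (Lambda n ^\<^sub>m k) $$ (i, l) * Lambda n $$ (l, j))"
    using mat_mult_entry[OF pow_carrier_mat[OF L] L Suc.prems] by simp
  also have "\<dots> = (\<Sum>l<n. if l = Suc j then (Lambda n ^\<^sub>m k) $$ (i, Suc j) * sigma n (Suc j) else 0)"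
    using Suc.prems by (intro sum.cong) (auto simp: Lambda_def)
  also have "\<dots> = (if i = j + Suc k then rising n j (Suc k) else 0)"
    using Suc by (auto simp: rising_Suc)
  finally show ?case .
qed

lemma phi_index:
  assumes "i < n" "j < n"
  shows "phi n z $$ (i, j) = phi_entry n z i j"
proof -
  have "phi n z $$ (i, j) = (\<Sum>k<n. if k = i - j \<and> j \<le> i then coeff_c n k * rising n j k * z ^ k else 0)"
    using assms by (auto simp: phi_def Lambda_power intro!: sum.cong)
  also have "\<dots> = phi_entry n z i j"
    using assms by (cases "j \<le> i") (auto simp: phi_entry_def)
  finally show ?thesis .
qed

text \<open>Lambda raises the index by one, so conjugation by the diagonal matrix multiplies Lambda
  by alpha. Hence the lower right block of \<open>psi\<close> is phi at alpha z.\<close>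

lemma phi_entry_scale: "alpha n ^ i * phi_entry n z i j * inverse (alpha n) ^ j = phi_entry n (alpha n * z) i j"
proof (cases "j \<le> i")
  case True
  have "alpha n ^ i = alpha n ^ (i - j) * alpha n ^ j" using True by (simp add: power_add[symmetric])
  moreover have "alpha n \<noteq> 0" by (simp add: alpha_def)
  ultimately show ?thesis using True
    by (simp add: phi_entry_def power_mult_distrib power_inverse)
qed (simp add: phi_entry_def)

lemma diagA_inverse: "minv (diagA n) = mat n n (\<lambda>(i, j). if i = j then inverse (alpha n) ^ i else 0)"
proof (rule minv_eqI[where N = n])
  let ?B = "mat n n (\<lambda>(i, j). if i = j then inverse (alpha n) ^ i else 0)"
  have a0: "alpha n \<noteq> 0" by (simp add: alpha_def)
  show c: "diagA n \<in> carrier_mat n n" "?B \<in> carrier_mat n n"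
    by (simp_all add: diagA_def)
  show "diagA n * ?B = 1\<^sub>m n"
  proof (rule eq_matI)
    fix i j assume "i < dim_row (1\<^sub>m n :: complex mat)" "j < dim_col (1\<^sub>m n :: complex mat)"
    then have ij: "i < n" "j < n" by auto
    show "(diagA n * ?B) $$ (i, j) = 1\<^sub>m n $$ (i, j)"
      unfolding mat_mult_entry[OF c ij] using ij a0
      by (auto simp: diagA_def power_inverse if_distrib[of "\<lambda>x. x * _"] cong: if_cong)
  qed (use c in auto)
  show "?B * diagA n = 1\<^sub>m n"
  proof (rule eq_matI)
    fix i j assume "i < dim_row (1\<^sub>m n :: complex mat)" "j < dim_col (1\<^sub>m n :: complex mat)"
    then have ij: "i < n" "j < n" by auto
    show "(?B * diagA n) $$ (i, j) = 1\<^sub>m n $$ (i, j)"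
      unfolding mat_mult_entry[OF c(2,1) ij] using ij a0
      by (auto simp: diagA_def power_inverse if_distrib[of "\<lambda>x. x * _"] cong: if_cong)
  qed (use c in auto)
qed

lemma minv_diagA_carrier: "minv (diagA n) \<in> carrier_mat n n"
  by (subst diagA_inverse) simp

lemma diagA_conj:
  assumes "i < n" "j < n"
  shows "(diagA n * phi n z * minv (diagA n)) $$ (i, j) = phi_entry n (alpha n * z) i j"
proof -
  have c: "diagA n \<in> carrier_mat n n" "phi n z \<in> carrier_mat n n" "minv (diagA n) \<in> carrier_mat n n"
    by (simp add: diagA_def, simp add: phi_def, rule minv_diagA_carrier)
  have "(diagA n * phi n z * minv (diagA n)) $$ (i, j) =
      (\<Sum>b<n. (\<Sum>a<n. if a = i then alpha n ^ i * phi n z $$ (i, b) else 0) * minv (diagA n) $$ (b, j))"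
    unfolding mat_mult3_entry[OF c assms] using assms by (intro sum.cong refl arg_cong2[where f = "(*)"]) (auto simp: diagA_def)
  also have "\<dots> = (\<Sum>b<n. if b = j then alpha n ^ i * phi n z $$ (i, j) * inverse (alpha n) ^ j else 0)"
    using assms by (intro sum.cong refl) (auto simp: diagA_inverse)
  also have "\<dots> = phi_entry n (alpha n * z) i j"
    using assms by (simp add: phi_index phi_entry_scale)
  finally show ?thesis .
qed

definition psi_entry :: "nat \<Rightarrow> complex \<Rightarrow> nat \<Rightarrow> nat \<Rightarrow> complex" where
  "psi_entry n z p q =
     (if p < n then if q < n then phi_entry n z p q else 0
      else if q < n then z ^ n * phi_entry n z (p - n) q else phi_entry n (alpha n * z) (p - n) (q - n))"

text \<open>The inverse of a lower block triangular matrix. In the lower left block, phi(alpha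
  z)^(-1) (z^n phi(z)) phi(z)^(-1) collapses to z^n phi(alpha z)^(-1).\<close>

definition psi_inv_entry :: "nat \<Rightarrow> complex \<Rightarrow> nat \<Rightarrow> nat \<Rightarrow> complex" where
  "psi_inv_entry n z p q =
     (if p < n then if q < n then phi_inv_entry n z p q else 0
      else if q < n then - (z ^ n) * phi_inv_entry n (alpha n * z) (p - n) q
      else phi_inv_entry n (alpha n * z) (p - n) (q - n))"

definition psi_inv :: "nat \<Rightarrow> complex \<Rightarrow> complex mat" where
  "psi_inv n z = mat (2 * n) (2 * n) (\<lambda>(p, q). psi_inv_entry n z p q)"

lemma psi_inv_carrier [simp]: "psi_inv n z \<in> carrier_mat (2 * n) (2 * n)"
  by (simp add: psi_inv_def)

lemma psi_carrier [simp]: "psi n z \<in> carrier_mat (2 * n) (2 * n)"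
  unfolding psi_def mult_2
  by (intro four_block_carrier_mat mult_carrier_mat[OF mult_carrier_mat minv_diagA_carrier]) (auto simp: phi_def diagA_def)

lemma psi_index:
  assumes "p < 2 * n" "q < 2 * n"
  shows "psi n z $$ (p, q) = psi_entry n z p q"
proof -
  have d: "dim_row (phi n z) = n" "dim_col (phi n z) = n" "dim_row (diagA n) = n" "dim_col (diagA n) = n"
    "dim_row (minv (diagA n)) = n" "dim_col (minv (diagA n)) = n"
    using carrier_matD[OF minv_diagA_carrier[of n]] by (simp_all add: phi_def diagA_def)
  show ?thesis
    using assms unfolding psi_def psi_entry_def
    by (auto simp: d phi_index diagA_conj simp del: index_mult_mat(1))
qed

definition psi_conj_entry :: "nat \<Rightarrow> complex \<Rightarrow> (nat \<Rightarrow> nat \<Rightarrow> complex) \<Rightarrow> nat \<Rightarrow> nat \<Rightarrow> complex" where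
  "psi_conj_entry n z Z p q = (\<Sum>i<2*n. \<Sum>j<2*n. psi_inv_entry n z p i * Z i j * psi_entry n z j q)"

text \<open>The triangular shape of \<open>psi\<close> reduces every block to a conjugation by phi,
  with alpha z on the left in the second block row and on the right in the second block
  column.\<close>

lemma psi_conj_entry_blocks:
  assumes "a < n" "b < n"
  shows "psi_conj_entry n z Z a b = conj_entry n z z (\<lambda>i j. Z i j + z ^ n * Z i (n + j)) a b"
    and "psi_conj_entry n z Z a (n + b) = conj_entry n z (alpha n * z) (\<lambda>i j. Z i (n + j)) a b"
    and "psi_conj_entry n z Z (n + a) b = conj_entry n (alpha n * z) z
      (\<lambda>i j. Z (n + i) j + z ^ n * Z (n + i) (n + j) - z ^ n * (Z i j + z ^ n * Z i (n + j))) a b"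
    and "psi_conj_entry n z Z (n + a) (n + b) = conj_entry n (alpha n * z) (alpha n * z)
      (\<lambda>i j. Z (n + i) (n + j) - z ^ n * Z i (n + j)) a b"
  unfolding psi_conj_entry_def conj_entry_def mult_2 sum_lessThan_add psi_inv_entry_def psi_entry_def
  using assms by (simp_all add: algebra_simps sum.distrib sum_subtractf sum_negf)

lemma conj_entry_cong:
  assumes "\<And>i j. i < n \<Longrightarrow> j < n \<Longrightarrow> X i j = Y i j"
  shows "conj_entry n w z X a b = conj_entry n w z Y a b"
  unfolding conj_entry_def by (intro sum.cong refl) (use assms in auto)

lemma conj_entry_zero: "conj_entry n w z (\<lambda>_ _. 0) a b = 0"
  by (simp add: conj_entry_def)

lemma conj_entry_linear:
  "conj_entry n w z (\<lambda>i j. X i j + c * Y i j) a b = conj_entry n w z X a b + c * conj_entry n w z Y a b"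
  by (simp add: conj_entry_def algebra_simps sum.distrib sum_distrib_left)

lemma block_index_cases:
  fixes n :: nat
  assumes "p < 2 * n" "q < 2 * n"
  obtains "p < n" "q < n" | b where "p < n" "b < n" "q = n + b" | a where "a < n" "p = n + a" "q < n"
    | a b where "a < n" "b < n" "p = n + a" "q = n + b"
proof -
  have "p < n \<or> (\<exists>a<n. p = n + a)" "q < n \<or> (\<exists>a<n. q = n + a)"
    using assms by presburger+
  then show thesis using that by blast
qed

lemma psi_conj_entry_delta:
  assumes "p < 2 * n" "q < 2 * n"
  shows "psi_conj_entry n z (\<lambda>i j. if i = j then 1 else 0) p q = (if p = q then 1 else 0)"
  using assms
proof (cases rule: block_index_cases)
  case 1
  then show ?thesis
    unfolding psi_conj_entry_blocks(1)[OF 1] conj_entry_delta[OF 1, of z, symmetric]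
    by (intro conj_entry_cong) auto
next
  case (2 b)
  have "psi_conj_entry n z (\<lambda>i j. if i = j then 1 else 0) p q = conj_entry n z (alpha n * z) (\<lambda>_ _. 0) p b"
    unfolding 2(3) psi_conj_entry_blocks(2)[OF 2(1,2)] by (intro conj_entry_cong) auto
  then show ?thesis using 2 by (simp add: conj_entry_zero)
next
  case (3 a)
  have "psi_conj_entry n z (\<lambda>i j. if i = j then 1 else 0) p q = conj_entry n (alpha n * z) z (\<lambda>_ _. 0) a q"
    unfolding 3(2) psi_conj_entry_blocks(3)[OF 3(1,3)] by (intro conj_entry_cong) auto
  then show ?thesis using 3 by (simp add: conj_entry_zero)
next
  case (4 a b)
  have "psi_conj_entry n z (\<lambda>i j. if i = j then 1 else 0) p q =
      conj_entry n (alpha n * z) (alpha n * z) (\<lambda>i j. if i = j then 1 else 0) a b"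
    unfolding 4(3,4) psi_conj_entry_blocks(4)[OF 4(1,2)] by (intro conj_entry_cong) auto
  then show ?thesis using 4 by (simp add: conj_entry_delta)
qed

lemma psi_inv_mult:
  assumes "Z \<in> carrier_mat (2 * n) (2 * n)" "p < 2 * n" "q < 2 * n"
  shows "(psi_inv n z * Z * psi n z) $$ (p, q) = psi_conj_entry n z (\<lambda>i j. Z $$ (i, j)) p q"
  unfolding mat_mult3_entry[OF psi_inv_carrier assms(1) psi_carrier assms(2,3)] psi_conj_entry_def
  by (subst sum.swap) (use assms in \<open>simp add: sum_distrib_right psi_inv_def psi_index\<close>)

lemma psi_inverse:
  shows "psi_inv n z * psi n z = 1\<^sub>m (2 * n)" and "psi n z * psi_inv n z = 1\<^sub>m (2 * n)"
proof -
  show 1: "psi_inv n z * psi n z = 1\<^sub>m (2 * n)"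
  proof (rule eq_matI)
    fix p q assume "p < dim_row (1\<^sub>m (2 * n) :: complex mat)" "q < dim_col (1\<^sub>m (2 * n) :: complex mat)"
    then have pq: "p < 2 * n" "q < 2 * n" by auto
    have "(psi_inv n z * psi n z) $$ (p, q) = (psi_inv n z * 1\<^sub>m (2 * n) * psi n z) $$ (p, q)"
      using right_mult_one_mat[OF psi_inv_carrier, of n z] by simp
    also have "\<dots> = psi_conj_entry n z (\<lambda>i j. if i = j then 1 else 0) p q"
      unfolding psi_inv_mult[OF one_carrier_mat pq] psi_conj_entry_def by (intro sum.cong refl) auto
    finally show "(psi_inv n z * psi n z) $$ (p, q) = 1\<^sub>m (2 * n) $$ (p, q)"
      using pq by (simp add: psi_conj_entry_delta)
  qed (auto simp: carrier_matD[OF psi_carrier] carrier_matD[OF psi_inv_carrier])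
  show "psi n z * psi_inv n z = 1\<^sub>m (2 * n)"
    by (rule mat_mult_left_right_inverse[OF psi_inv_carrier psi_carrier 1])
qed

lemma minv_psi: "minv (psi n z) = psi_inv n z"
  by (rule minv_eqI[OF psi_carrier psi_inv_carrier psi_inverse(2,1)])

section \<open>Degrees of psi and its inverse, and the constant correction matrix\<close>

lemma polydeg_phi_entry: "i < n \<Longrightarrow> polydeg n (\<lambda>z. phi_entry n z i j)"
  and polydeg_phi_inv_entry: "i < n \<Longrightarrow> polydeg n (\<lambda>z. phi_inv_entry n z i j)"
  unfolding phi_entry_def phi_inv_entry_def by (cases "j \<le> i"; simp add: polydeg_zero polydeg_monom)+

lemma polydeg_psi_entry:
  assumes "p < 2 * n" "q < 2 * n"
  shows "polydeg (2 * n) (\<lambda>z. psi_entry n z p q)"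
  using assms unfolding psi_entry_def
  by (cases "p < n"; cases "q < n")
     (auto simp: mult_2 polydeg_zero intro!: polydeg_shift polydeg_phi_entry
        polydeg_mono[OF polydeg_phi_entry] polydeg_mono[OF polydeg_scale[OF polydeg_phi_entry]])

lemma polydeg_psi_inv_entry:
  assumes "p < 2 * n" "q < 2 * n"
  shows "polydeg (2 * n) (\<lambda>z. psi_inv_entry n z p q)"
proof -
  have "polydeg (n + n) (\<lambda>z. (-1) * (z ^ n * phi_inv_entry n (alpha n * z) (p - n) q))" if "p \<ge> n"
    using that assms by (intro polydeg_cmult polydeg_shift polydeg_scale[OF polydeg_phi_inv_entry]) auto
  then show ?thesis
    using assms unfolding psi_inv_entry_def
    by (cases "p < n"; cases "q < n")
       (auto simp: mult_2 polydeg_zero intro!: polydeg_mono[OF polydeg_phi_inv_entry] polydeg_mono[OF polydeg_scale[OF polydeg_phi_inv_entry]])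
qed

lemma polydeg_conj_entry:
  assumes "a < n" "b < n"
  shows "polydeg (2 * n) (\<lambda>z. conj_entry n (\<beta> * z) z X a b)"
  unfolding conj_entry_expand[OF assms] by (rule polydegI) (rule refl)

lemma polydeg_conj_entry_reduce:
  assumes "a < n" "b < n"
  shows "polydeg n (\<lambda>z. conj_entry n (\<beta> * z) z (\<lambda>i j. X i j - z ^ n * Xi n \<beta> X n i j) a b)"
  unfolding conj_entry_reduce[OF assms] by (rule polydegI) (rule refl)

text \<open>In blocks \<open>E = [[a, b], [c, d]]\<close> the correction is \<open>P = [[k, 0], [k' - b, k]]\<close>, where
  \<open>k\<close> and \<open>k'\<close> are the corrections of \<open>b\<close> and \<open>d - a\<close> under conjugation by \<open>\<phi>\<close>.\<close>

lemma psi_conj_reduce: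
  assumes n: "n \<ge> 1" and E: "E \<in> carrier_mat (2 * n) (2 * n)"
  obtains P where "P \<in> carrier_mat (2 * n) (2 * n)"
    "\<And>p q. p < 2 * n \<Longrightarrow> q < 2 * n \<Longrightarrow>
      polydeg (2 * n) (\<lambda>z. (psi_inv n z * (E - z ^ (2 * n) \<cdot>\<^sub>m P) * psi n z) $$ (p, q))"
proof -
  define a where "a i j = E $$ (i, j)" for i j
  define b where "b i j = E $$ (i, n + j)" for i j
  define c where "c i j = E $$ (n + i, j)" for i j
  define d where "d i j = E $$ (n + i, n + j)" for i j
  define k where "k = Xi n 1 b n"
  define e where "e i j = d i j - a i j" for i j
  define k' where "k' = Xi n (alpha n) e n"
  define P where "P = mat (2 * n) (2 * n) (\<lambda>(i, j). if i < n then if j < n then k i j else 0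
      else if j < n then k' (i - n) j - b (i - n) j else k (i - n) (j - n))"
  have P: "P \<in> carrier_mat (2 * n) (2 * n)" by (simp add: P_def)
  \<comment> \<open>This sign turns -b - z^n k into -(b - (alpha z)^n k), so one and the same k
    corrects both diagonal blocks.\<close>
  have w: "(alpha n * z) ^ n = - (z ^ n)" for z by (simp add: power_mult_distrib alpha_power_n[OF n])
  have z2: "(E - z ^ (2 * n) \<cdot>\<^sub>m P) $$ (i, j) = E $$ (i, j) - z ^ n * z ^ n * P $$ (i, j)"
    if "i < 2 * n" "j < 2 * n" for z i j
    using that E P by (simp add: mult_2 power_add)
  have "polydeg (2 * n) (\<lambda>z. psi_conj_entry n z (\<lambda>i j. (E - z ^ (2 * n) \<cdot>\<^sub>m P) $$ (i, j)) p q)"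
    if "p < 2 * n" "q < 2 * n" for p q
    using that
  proof (cases rule: block_index_cases)
    case 1
    have "psi_conj_entry n z (\<lambda>i j. (E - z ^ (2 * n) \<cdot>\<^sub>m P) $$ (i, j)) p q =
      conj_entry n (1 * z) z a p q + z ^ n * conj_entry n (1 * z) z (\<lambda>i j. b i j - z ^ n * k i j) p q" for z
      unfolding psi_conj_entry_blocks(1)[OF 1] conj_entry_linear[symmetric]
      by (simp only: mult_1 mult_1_left, intro conj_entry_cong) (simp add: z2, simp add: P_def a_def b_def algebra_simps)
    then show ?thesis
      using polydeg_conj_entry[OF 1, of 1 a] polydeg_shift[OF polydeg_conj_entry_reduce[OF 1, of 1 b], of n]
      by (simp add: k_def mult_2[symmetric] polydeg_add)
  next
    case (2 r)
    \<comment> \<open>The upper right block has degree less than 2n without any correction, hence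
      the 0 in \<open>P\<close>. Only its arguments z and alpha z have to be brought to the form
      beta y, y.\<close>
    have alpha_inv: "inverse (alpha n) * (alpha n * z) = z" for z by (simp add: alpha_def)
    have "psi_conj_entry n z (\<lambda>i j. (E - z ^ (2 * n) \<cdot>\<^sub>m P) $$ (i, j)) p q =
      conj_entry n (inverse (alpha n) * (alpha n * z)) (alpha n * z) b p r" for z
      unfolding 2(3) psi_conj_entry_blocks(2)[OF 2(1,2)]
      unfolding alpha_inv by (intro conj_entry_cong) (simp add: z2, simp add: P_def b_def)
    then show ?thesis
      using polydeg_scale[OF polydeg_conj_entry[OF 2(1,2)]] by simp
  next
    case (3 r)
    \<comment> \<open>The summand -b in \<open>P\<close> cancels the term z^(2n) b, and the two
      copies of k cancel in front of z^(3n); what remains is c + z^n (e - z^n k').\<close>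
    have "psi_conj_entry n z (\<lambda>i j. (E - z ^ (2 * n) \<cdot>\<^sub>m P) $$ (i, j)) p q =
      conj_entry n (alpha n * z) z c r q + z ^ n * conj_entry n (alpha n * z) z (\<lambda>i j. e i j - z ^ n * k' i j) r q" for z
      unfolding 3(2) psi_conj_entry_blocks(3)[OF 3(1,3)] conj_entry_linear[symmetric]
      by (intro conj_entry_cong) (simp add: z2, simp add: P_def a_def b_def c_def d_def e_def algebra_simps)
    then show ?thesis
      using polydeg_conj_entry[OF 3(1,3), of "alpha n" c]
        polydeg_shift[OF polydeg_conj_entry_reduce[OF 3(1,3), of "alpha n" e], of n]
      by (simp add: k'_def mult_2[symmetric] polydeg_add)
  next
    case (4 r s)
    have "psi_conj_entry n z (\<lambda>i j. (E - z ^ (2 * n) \<cdot>\<^sub>m P) $$ (i, j)) p q =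
      conj_entry n (1 * (alpha n * z)) (alpha n * z) d r s
      + z ^ n * (-1 * conj_entry n (1 * (alpha n * z)) (alpha n * z) (\<lambda>i j. b i j - (alpha n * z) ^ n * k i j) r s)" for z
      unfolding 4(3,4) psi_conj_entry_blocks(4)[OF 4(1,2)] mult.assoc[symmetric, of "z ^ n" "-1"] conj_entry_linear[symmetric] w
      by (simp only: mult_1 mult_1_left, intro conj_entry_cong) (simp add: z2, simp add: P_def b_def d_def algebra_simps)
    moreover have "polydeg (n + n) (\<lambda>z. z ^ n * (-1 * conj_entry n (1 * (alpha n * z)) (alpha n * z) (\<lambda>i j. b i j - (alpha n * z) ^ n * k i j) r s))"
      unfolding k_def
      by (intro polydeg_shift polydeg_cmult polydeg_scale[OF polydeg_conj_entry_reduce[OF 4(1,2), of 1 b]])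
    ultimately show ?thesis
      using polydeg_scale[OF polydeg_conj_entry[OF 4(1,2), of 1 d], of "alpha n"]
      by (simp only: mult_2[symmetric] polydeg_add)
  qed
  moreover have "E - z ^ (2 * n) \<cdot>\<^sub>m P \<in> carrier_mat (2 * n) (2 * n)" for z
    using E P by auto
  ultimately show thesis
    using that[OF P] by (simp add: psi_inv_mult)
qed

declare mem_sphere [simp del] mem_sphere_0 [simp del]

section \<open>Smooth loops\<close>

lemma smooth_loops_iff:
  "f \<in> smooth_loops N S \<longleftrightarrow>
     f \<in> extensional circle \<and> (\<forall>z\<in>circle. f z \<in> S) \<and> entries_in (Collect smooth) N (\<lambda>t. f (cis t))"
proof
  assume "f \<in> smooth_loops N S"
  then have f: "f \<in> circle \<rightarrow>\<^sub>E (S \<inter> carrier_mat N N)"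
    and s: "\<And>i j. i < N \<Longrightarrow> j < N \<Longrightarrow> smooth (\<lambda>t. f (cis t) $$ (i, j))"
    unfolding smooth_loops_def by blast+
  have "f z \<in> S \<and> f z \<in> carrier_mat N N" if "z \<in> circle" for z
    using PiE_mem[OF f that] by simp
  moreover have "f \<in> extensional circle" using f by (simp add: PiE_def)
  ultimately show "f \<in> extensional circle \<and> (\<forall>z\<in>circle. f z \<in> S) \<and> entries_in (Collect smooth) N (\<lambda>t. f (cis t))"
    using s cis_in_circle by (simp add: entries_in_def)
next
  assume *: "f \<in> extensional circle \<and> (\<forall>z\<in>circle. f z \<in> S) \<and> entries_in (Collect smooth) N (\<lambda>t. f (cis t))"
  then have "f z \<in> S \<inter> carrier_mat N N" if "z \<in> circle" for z
    using that entries_inD(1)[of "Collect smooth" N "\<lambda>t. f (cis t)"] unfolding circle_cis by auto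
  with * show "f \<in> smooth_loops N S"
    unfolding smooth_loops_def entries_in_def PiE_def by simp
qed

lemma smooth_loopsD:
  assumes "f \<in> smooth_loops N S"
  shows "f \<in> extensional circle" "z \<in> circle \<Longrightarrow> f z \<in> S" "z \<in> circle \<Longrightarrow> f z \<in> carrier_mat N N"
    "entries_in (Collect smooth) N (\<lambda>t. f (cis t))"
proof -
  have *: "f \<in> extensional circle" "\<forall>z\<in>circle. f z \<in> S" "entries_in (Collect smooth) N (\<lambda>t. f (cis t))"
    using assms unfolding smooth_loops_iff by blast+
  show "f \<in> extensional circle" "z \<in> circle \<Longrightarrow> f z \<in> S" "entries_in (Collect smooth) N (\<lambda>t. f (cis t))"
    using * by blast+
  show "f z \<in> carrier_mat N N" if "z \<in> circle"
    using that entries_inD(1)[OF *(3)] unfolding circle_cis by auto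
qed

lemma restrict_smooth_loops:
  assumes "entries_in (Collect smooth) N (\<lambda>t. g (cis t))" "\<And>z. z \<in> circle \<Longrightarrow> g z \<in> S"
  shows "(\<lambda>z\<in>circle. g z) \<in> smooth_loops N S"
proof -
  have "(\<lambda>t. (\<lambda>z\<in>circle. g z) (cis t)) = (\<lambda>t. g (cis t))"
    using cis_in_circle by (auto simp: fun_eq_iff restrict_def)
  then show ?thesis using assms unfolding smooth_loops_iff by auto
qed

lemma smooth_polydeg: "polydeg d f \<Longrightarrow> smooth (\<lambda>t. f (cis t))"
proof -
  assume "polydeg d f"
  then obtain c where c: "\<And>z. f z = (\<Sum>m<d. c m * z ^ m)" by (auto simp: polydeg_def)
  have "(\<lambda>t. \<Sum>m<d. c m * cis t ^ m) \<in> Collect smooth"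
    unfolding Complex.DeMoivre
    by (intro ring_closed_sum[OF ring_closed_smooth] ring_closed_simps(3)[OF ring_closed_smooth])
       (auto intro: smooth_const smooth_cis)
  then show ?thesis by (simp add: c)
qed

lemma disc_fun_polydeg:
  assumes "polydeg d f"
  shows "f \<in> disc_fun"
proof -
  obtain c where "\<And>z. f z = (\<Sum>m<d. c m * z ^ m)" using assms by (auto simp: polydeg_def)
  then have "f = (\<lambda>z. \<Sum>m<d. c m * z ^ m)" by auto
  then show ?thesis by (auto simp: disc_fun_def intro!: continuous_intros holomorphic_intros)
qed

lemma entries_in_psi: "entries_in (Collect smooth) (2 * n) (\<lambda>t. psi n (cis t))"
  by (rule entries_inI[OF psi_carrier]) (simp add: psi_index smooth_polydeg[OF polydeg_psi_entry])

lemma entries_in_psi_inv: "entries_in (Collect smooth) (2 * n) (\<lambda>t. psi_inv n (cis t))"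
  by (rule entries_inI[OF psi_inv_carrier]) (simp add: psi_inv_def smooth_polydeg[OF polydeg_psi_inv_entry])

lemma entries_in_disc_psi: "entries_in disc_fun (2 * n) (psi n)"
  by (rule entries_inI[OF psi_carrier]) (simp add: psi_index disc_fun_polydeg[OF polydeg_psi_entry])

lemma entries_in_disc_psi_inv: "entries_in disc_fun (2 * n) (psi_inv n)"
  by (rule entries_inI[OF psi_inv_carrier]) (simp add: psi_inv_def disc_fun_polydeg[OF polydeg_psi_inv_entry])

section \<open>Extension of matrix functions to the disc\<close>

text \<open>The value at the centre is tracked since it becomes the value at infinity in
  \<open>outside\<close>; it changes under sums, products and exponentials just as the loop
  does.\<close>

definition matrix_ext :: "nat \<Rightarrow> complex mat \<Rightarrow> (complex \<Rightarrow> complex mat) \<Rightarrow> bool" where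
  "matrix_ext N C g \<longleftrightarrow> (\<exists>F. entries_in disc_fun N F \<and> F 0 = C \<and> (\<forall>z\<in>circle. F z = g z))"

definition inside :: "nat \<Rightarrow> (complex \<Rightarrow> complex mat) \<Rightarrow> bool" where
  "inside N f \<longleftrightarrow> (\<exists>C. matrix_ext N C f)"

definition outside :: "nat \<Rightarrow> complex mat \<Rightarrow> (complex \<Rightarrow> complex mat) \<Rightarrow> bool" where
  "outside N C f \<longleftrightarrow> matrix_ext N C (\<lambda>z. f (1 / z))"

lemma matrix_ext_cong: "matrix_ext N C f \<Longrightarrow> (\<And>z. z \<in> circle \<Longrightarrow> f z = g z) \<Longrightarrow> matrix_ext N C g"
  by (auto simp: matrix_ext_def)

lemma matrix_ext_carrier: "matrix_ext N C g \<Longrightarrow> C \<in> carrier_mat N N"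
  unfolding matrix_ext_def by (elim exE conjE) (metis entries_inD(1))

lemma matrix_ext_map2:
  assumes "\<And>F G. entries_in disc_fun N F \<Longrightarrow> entries_in disc_fun N G \<Longrightarrow> entries_in disc_fun N (\<lambda>z. h (F z) (G z))"
    "matrix_ext N A f" "matrix_ext N B g"
  shows "matrix_ext N (h A B) (\<lambda>z. h (f z) (g z))"
proof -
  obtain F G where "entries_in disc_fun N F" "F 0 = A" "\<forall>z\<in>circle. F z = f z"
    "entries_in disc_fun N G" "G 0 = B" "\<forall>z\<in>circle. G z = g z"
    using assms(2,3) unfolding matrix_ext_def by blast
  then show ?thesis unfolding matrix_ext_def by (intro exI[of _ "\<lambda>z. h (F z) (G z)"]) (simp add: assms(1))
qed

lemma matrix_ext_add: "matrix_ext N A f \<Longrightarrow> matrix_ext N B g \<Longrightarrow> matrix_ext N (A + B) (\<lambda>z. f z + g z)"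
  and matrix_ext_mult: "matrix_ext N A f \<Longrightarrow> matrix_ext N B g \<Longrightarrow> matrix_ext N (A * B) (\<lambda>z. f z * g z)"
  by (rule matrix_ext_map2[of N "(+)"] matrix_ext_map2[of N "(*)"],
      rule entries_in_add[OF ring_closed_disc_fun] entries_in_mult[OF ring_closed_disc_fun]; assumption)+

lemma matrix_ext_map:
  assumes "\<And>F. entries_in disc_fun N F \<Longrightarrow> entries_in disc_fun N (\<lambda>z. h (F z))" "matrix_ext N A f"
  shows "matrix_ext N (h A) (\<lambda>z. h (f z))"
  using matrix_ext_map2[of N "\<lambda>X _. h X", OF _ assms(2,2)] assms(1) by simp

lemma matrix_ext_adj: "matrix_ext N A f \<Longrightarrow> matrix_ext N (adj_mat A) (\<lambda>z. adj_mat (f z))"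
  by (rule matrix_ext_map) (rule entries_in_adj[OF ring_closed_disc_fun])

lemma matrix_ext_exp: "matrix_ext N A f \<Longrightarrow> matrix_ext N (mat_exp A) (\<lambda>z. mat_exp (f z))"
  by (rule matrix_ext_map) (rule entries_in_disc_mat_exp)

lemma matrix_ext_smult: "matrix_ext N A f \<Longrightarrow> matrix_ext N (c \<cdot>\<^sub>m A) (\<lambda>z. c \<cdot>\<^sub>m f z)"
  by (rule matrix_ext_map[of _ "\<lambda>X. c \<cdot>\<^sub>m X"])
     (rule entries_in_smult[OF ring_closed_disc_fun ring_closed_simps(1)[OF ring_closed_disc_fun]])

lemma matrix_ext_const: "A \<in> carrier_mat N N \<Longrightarrow> matrix_ext N A (\<lambda>_. A)"
  unfolding matrix_ext_def by (intro exI[of _ "\<lambda>_. A"]) (simp add: entries_in_const[OF ring_closed_disc_fun])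

lemma matrix_ext_entries:
  "matrix_ext N C g \<longleftrightarrow> C \<in> carrier_mat N N \<and> (\<forall>z\<in>circle. g z \<in> carrier_mat N N) \<and>
     (\<forall>i<N. \<forall>j<N. \<exists>F\<in>disc_fun. F 0 = C $$ (i, j) \<and> (\<forall>z\<in>circle. F z = g z $$ (i, j)))"
proof
  assume "matrix_ext N C g"
  then obtain F where F: "entries_in disc_fun N F" "F 0 = C" "\<forall>z\<in>circle. F z = g z"
    unfolding matrix_ext_def by blast
  show "C \<in> carrier_mat N N \<and> (\<forall>z\<in>circle. g z \<in> carrier_mat N N) \<and>
     (\<forall>i<N. \<forall>j<N. \<exists>F\<in>disc_fun. F 0 = C $$ (i, j) \<and> (\<forall>z\<in>circle. F z = g z $$ (i, j)))"
  proof (intro conjI allI impI ballI)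
    show "C \<in> carrier_mat N N" using entries_inD(1)[OF F(1), of 0] F(2) by simp
    show "g z \<in> carrier_mat N N" if "z \<in> circle" for z using entries_inD(1)[OF F(1), of z] F(3) that by simp
    show "\<exists>F\<in>disc_fun. F 0 = C $$ (i, j) \<and> (\<forall>z\<in>circle. F z = g z $$ (i, j))" if "i < N" "j < N" for i j
      using entries_inD(2)[OF F(1) that] F(2,3) by (intro bexI[of _ "\<lambda>z. F z $$ (i, j)"]) auto
  qed
next
  assume *: "C \<in> carrier_mat N N \<and> (\<forall>z\<in>circle. g z \<in> carrier_mat N N) \<and>
     (\<forall>i<N. \<forall>j<N. \<exists>F\<in>disc_fun. F 0 = C $$ (i, j) \<and> (\<forall>z\<in>circle. F z = g z $$ (i, j)))"
  then obtain F where F: "\<And>i j. i < N \<Longrightarrow> j < N \<Longrightarrow> F i j \<in> disc_fun"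
    "\<And>i j. i < N \<Longrightarrow> j < N \<Longrightarrow> F i j 0 = C $$ (i, j)"
    "\<And>i j z. i < N \<Longrightarrow> j < N \<Longrightarrow> z \<in> circle \<Longrightarrow> F i j z = g z $$ (i, j)"
    by metis
  show "matrix_ext N C g"
    unfolding matrix_ext_def
  proof (intro exI[of _ "\<lambda>z. mat N N (\<lambda>(i, j). F i j z)"] conjI ballI)
    show "entries_in disc_fun N (\<lambda>z. mat N N (\<lambda>(i, j). F i j z))"
      by (rule entries_inI) (use F(1) in auto)
    show "mat N N (\<lambda>(i, j). F i j 0) = C"
      by (rule eq_matI) (use * F(2) in auto)
    show "mat N N (\<lambda>(i, j). F i j z) = g z" if "z \<in> circle" for z
      by (rule eq_matI) (use * that F(3)[OF _ _ that] in auto)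
  qed
qed

lemma inside_entries:
  "inside N f \<longleftrightarrow> (\<forall>z\<in>circle. f z \<in> carrier_mat N N) \<and> (\<forall>i<N. \<forall>j<N. extends_inside (\<lambda>z. f z $$ (i, j)))"
proof
  assume *: "(\<forall>z\<in>circle. f z \<in> carrier_mat N N) \<and> (\<forall>i<N. \<forall>j<N. extends_inside (\<lambda>z. f z $$ (i, j)))"
  then obtain F where F: "\<And>i j. i < N \<Longrightarrow> j < N \<Longrightarrow> F i j \<in> disc_fun"
    "\<And>i j z. i < N \<Longrightarrow> j < N \<Longrightarrow> z \<in> circle \<Longrightarrow> F i j z = f z $$ (i, j)"
    unfolding extends_inside_def by metis
  show "inside N f"
    unfolding inside_def matrix_ext_entries
    by (intro exI[of _ "mat N N (\<lambda>(i, j). F i j 0)"]) (use * F in \<open>auto intro!: bexI[of _ "F _ _"]\<close>)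
qed (unfold inside_def matrix_ext_entries extends_inside_def, blast)

lemma outside_entries:
  "outside N C f \<longleftrightarrow> C \<in> carrier_mat N N \<and> (\<forall>z\<in>circle. f z \<in> carrier_mat N N) \<and>
     (\<forall>i<N. \<forall>j<N. extends_outside (C $$ (i, j)) (\<lambda>z. f z $$ (i, j)))"
proof -
  have "(\<forall>z\<in>circle. f (1 / z) \<in> carrier_mat N N) \<longleftrightarrow> (\<forall>z\<in>circle. f z \<in> carrier_mat N N)"
  proof
    assume *: "\<forall>z\<in>circle. f (1 / z) \<in> carrier_mat N N"
    show "\<forall>z\<in>circle. f z \<in> carrier_mat N N"
    proof
      fix z assume "z \<in> circle"
      then have "f (1 / (1 / z)) \<in> carrier_mat N N" using * inverse_in_circle by blast
      then show "f z \<in> carrier_mat N N" by simp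
    qed
  qed (use inverse_in_circle in blast)
  then show ?thesis
    unfolding outside_def matrix_ext_entries extends_outside_def by simp
qed

text \<open>An entrywise holomorphic extension takes values in \<open>SL\<close> automatically: its
  determinant lies in the disc algebra and equals 1 on the circle.\<close>

lemma disc_extension_iff:
  assumes "\<And>z. z \<in> circle \<Longrightarrow> g z \<in> SL N" "C \<in> carrier_mat N N"
  shows "(\<exists>F. disc_extension N g F \<and> F 0 = C) \<longleftrightarrow> matrix_ext N C g"
proof
  assume "\<exists>F. disc_extension N g F \<and> F 0 = C"
  then obtain F where F: "disc_extension N g F" "F 0 = C" by blast
  show "matrix_ext N C g"
    unfolding matrix_ext_entries
  proof (intro conjI allI impI ballI)
    show "g z \<in> carrier_mat N N" if "z \<in> circle" for z using assms(1)[OF that] by (simp add: SL_def)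
    show "\<exists>F\<in>disc_fun. F 0 = C $$ (i, j) \<and> (\<forall>z\<in>circle. F z = g z $$ (i, j))" if "i < N" "j < N" for i j
      using F that by (intro bexI[of _ "\<lambda>z. F z $$ (i, j)"]) (auto simp: disc_extension_def disc_fun_def)
  qed (rule assms(2))
next
  assume "matrix_ext N C g"
  then obtain F where F: "entries_in disc_fun N F" "F 0 = C" "\<forall>z\<in>circle. F z = g z"
    unfolding matrix_ext_def by blast
  have "det (F z) = 1" if "z \<in> cball 0 1" for z
    using disc_fun_unique[OF entries_in_det[OF ring_closed_disc_fun F(1)] ring_closed_simps(1)[OF ring_closed_disc_fun, of 1] _ that]
      F(3) assms(1) by (simp add: SL_def)
  then have "disc_extension N g F"
    using F(3) entries_inD[OF F(1)] by (auto simp: disc_extension_def SL_def disc_fun_def)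
  with F(2) show "\<exists>F. disc_extension N g F \<and> F 0 = C" by blast
qed

lemma entry_smooth:
  assumes "f \<in> smooth_loops N S" "i < N" "j < N"
  shows "smooth (\<lambda>t. f (cis t) $$ (i, j))"
  using entries_inD(2)[OF smooth_loopsD(4)[OF assms(1)] assms(2,3)] by simp

lemma laurent_sum_entry:
  assumes "\<forall>z\<in>circle. laurent_sum N z a (f z)" "i < N" "j < N"
  shows "laurent (\<lambda>m. a m $$ (i, j)) (\<lambda>z. f z $$ (i, j))"
  using assms unfolding laurent_def laurent_sum_def by blast

lemma laurent_sum_exists:
  assumes "f \<in> smooth_loops N S" "\<And>i j m. i < N \<Longrightarrow> j < N \<Longrightarrow> m \<in> K \<Longrightarrow> fc (\<lambda>t. f (cis t) $$ (i, j)) m = 0"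
  shows "\<exists>a. (\<forall>z\<in>circle. laurent_sum N z a (f z)) \<and> (\<forall>m\<in>K. a m = 0\<^sub>m N N)"
proof (intro exI[of _ "\<lambda>m. mat N N (\<lambda>(i, j). fc (\<lambda>t. f (cis t) $$ (i, j)) m)"] conjI ballI)
  show "laurent_sum N z (\<lambda>m. mat N N (\<lambda>(i, j). fc (\<lambda>t. f (cis t) $$ (i, j)) m)) (f z)" if "z \<in> circle" for z
    using smooth_laurent[OF entry_smooth[OF assms(1)]] that unfolding laurent_sum_def laurent_def by auto
  show "mat N N (\<lambda>(i, j). fc (\<lambda>t. f (cis t) $$ (i, j)) m) = 0\<^sub>m N N" if "m \<in> K" for m
    by (rule eq_matI) (use assms(2)[OF _ _ that] in auto)
qed

text \<open>The second condition is phrased as agreement with the coefficients of a constant, the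
  form in which the coefficients of \<open>exp_loop\<close> are compared with those of the
  identity.\<close>

lemma extends_fc:
  assumes "smooth (\<lambda>t. u (cis t))"
  shows "extends_inside u \<longleftrightarrow> (\<forall>m<0. fc (\<lambda>t. u (cis t)) m = 0)"
    and "extends_outside c u \<longleftrightarrow> (\<forall>m\<ge>0. fc (\<lambda>t. u (cis t)) m = fc (\<lambda>_. c) m)"
proof -
  note l = smooth_laurent[OF assms]
  show "extends_inside u \<longleftrightarrow> (\<forall>m<0. fc (\<lambda>t. u (cis t)) m = 0)" by (rule laurent_extends_inside[OF l])
  have "(\<forall>m\<ge>0. fc (\<lambda>t. u (cis t)) m = fc (\<lambda>_. c) m) \<longleftrightarrow>
      fc (\<lambda>t. u (cis t)) 0 = c \<and> (\<forall>m>0. fc (\<lambda>t. u (cis t)) m = 0)"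
    unfolding fc_const by (auto simp: order_le_less)
  then show "extends_outside c u \<longleftrightarrow> (\<forall>m\<ge>0. fc (\<lambda>t. u (cis t)) m = fc (\<lambda>_. c) m)"
    using laurent_extends_outside[OF l] by simp
qed

section \<open>One-sided loops and groups described by matrix extensions\<close>

lemma sl_loops_plus_eq: "sl_loops_plus N = {f \<in> sl_loops N. inside N f}"
proof (intro equalityI subsetI)
  fix f assume "f \<in> sl_loops_plus N"
  then obtain a where f: "f \<in> sl_loops N" and a: "\<forall>z\<in>circle. laurent_sum N z a (f z)" "\<forall>m<0. a m = 0\<^sub>m N N"
    unfolding sl_loops_plus_def by blast
  have "extends_inside (\<lambda>z. f z $$ (i, j))" if "i < N" "j < N" for i j
    using laurent_extends_inside[OF laurent_sum_entry[OF a(1) that]] a(2) that by simp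
  then show "f \<in> {f \<in> sl_loops N. inside N f}"
    using f smooth_loopsD(3)[OF f[unfolded sl_loops_def]] by (simp add: inside_entries)
next
  fix f assume "f \<in> {f \<in> sl_loops N. inside N f}"
  then have f: "f \<in> smooth_loops N (sl N)" and i: "inside N f" by (auto simp: sl_loops_def)
  have "fc (\<lambda>t. f (cis t) $$ (i, j)) m = 0" if "i < N" "j < N" "m \<in> {..<0}" for i j m
    using i that extends_fc(1)[OF entry_smooth[OF f that(1,2)]] unfolding inside_entries by simp
  then obtain a where a: "\<forall>z\<in>circle. laurent_sum N z a (f z)" "\<forall>m\<in>{..<0}. a m = 0\<^sub>m N N"
    using laurent_sum_exists[OF f, of "{..<0}"] by blast
  then show "f \<in> sl_loops_plus N"
    using f unfolding sl_loops_plus_def sl_loops_def by auto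
qed

lemma sl_loops_minus_eq: "sl_loops_minus N = {f \<in> sl_loops N. outside N (0\<^sub>m N N) f}"
proof (intro equalityI subsetI)
  fix f assume "f \<in> sl_loops_minus N"
  then obtain a where f: "f \<in> sl_loops N" and a: "\<forall>z\<in>circle. laurent_sum N z a (f z)" "\<forall>m\<ge>0. a m = 0\<^sub>m N N"
    unfolding sl_loops_minus_def by blast
  have "extends_outside (0\<^sub>m N N $$ (i, j)) (\<lambda>z. f z $$ (i, j))" if "i < N" "j < N" for i j
    using laurent_extends_outside[OF laurent_sum_entry[OF a(1) that], of 0] a(2) that by simp
  then show "f \<in> {f \<in> sl_loops N. outside N (0\<^sub>m N N) f}"
    using f smooth_loopsD(3)[OF f[unfolded sl_loops_def]] by (simp add: outside_entries)
next
  fix f assume "f \<in> {f \<in> sl_loops N. outside N (0\<^sub>m N N) f}"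
  then have f: "f \<in> smooth_loops N (sl N)" and i: "outside N (0\<^sub>m N N) f" by (auto simp: sl_loops_def)
  have "fc (\<lambda>t. f (cis t) $$ (i, j)) m = 0" if "i < N" "j < N" "m \<in> {0..}" for i j m
    using i that extends_fc(2)[OF entry_smooth[OF f that(1,2)], of 0] unfolding outside_entries by (simp add: fc_const)
  then obtain a where a: "\<forall>z\<in>circle. laurent_sum N z a (f z)" "\<forall>m\<in>{0..}. a m = 0\<^sub>m N N"
    using laurent_sum_exists[OF f, of "{0..}"] by blast
  then show "f \<in> sl_loops_minus N"
    using f unfolding sl_loops_minus_def sl_loops_def by auto
qed

lemma one_in_SL: "1\<^sub>m N \<in> SL N" by (simp add: SL_def)

lemma grp_L_plus_eq: "grp_L_plus n = {f \<in> grp_L n. inside (2 * n) f}"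
proof -
  have "(\<exists>F. disc_extension (2 * n) f F) \<longleftrightarrow> inside (2 * n) f" if "f \<in> grp_L n" for f
  proof -
    have SL: "\<And>z. z \<in> circle \<Longrightarrow> f z \<in> SL (2 * n)" using that smooth_loopsD(2) by (auto simp: grp_L_def)
    have "(\<exists>F. disc_extension (2 * n) f F) \<longleftrightarrow> (\<exists>C\<in>carrier_mat (2 * n) (2 * n). \<exists>F. disc_extension (2 * n) f F \<and> F 0 = C)"
    proof -
      have "F 0 \<in> carrier_mat (2 * n) (2 * n)" if "disc_extension (2 * n) f F" for F
        using that by (auto simp: disc_extension_def SL_def)
      then show ?thesis by blast
    qed
    also have "\<dots> \<longleftrightarrow> (\<exists>C\<in>carrier_mat (2 * n) (2 * n). matrix_ext (2 * n) C f)"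
      by (rule bex_cong[OF refl disc_extension_iff[OF SL]])
    also have "\<dots> \<longleftrightarrow> inside (2 * n) f"
      unfolding inside_def using matrix_ext_carrier[of "2 * n" _ f] by blast
    finally show ?thesis .
  qed
  then show ?thesis unfolding grp_L_plus_def by blast
qed

lemma grp_L_minus_eq: "grp_L_minus n = {f \<in> grp_L n. outside (2 * n) (1\<^sub>m (2 * n)) f}"
proof -
  have "(\<exists>F. disc_extension (2 * n) (\<lambda>w. f (1 / w)) F \<and> F 0 = 1\<^sub>m (2 * n)) \<longleftrightarrow> outside (2 * n) (1\<^sub>m (2 * n)) f"
    if "f \<in> grp_L n" for f
  proof -
    have "\<And>z. z \<in> circle \<Longrightarrow> f z \<in> SL (2 * n)" using that smooth_loopsD(2) by (auto simp: grp_L_def)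
    then show ?thesis
      unfolding outside_def by (intro disc_extension_iff) (auto intro: inverse_in_circle)
  qed
  then show ?thesis unfolding grp_L_minus_def by blast
qed

section \<open>The twisting condition as invariance under a rotation\<close>

text \<open>This is the number \<open>alpha n\<close>, written as a primitive 2n-th root of unity to
  match \<open>power_series_in_iff\<close>.\<close>

abbreviation rot :: "nat \<Rightarrow> complex" where
  "rot n \<equiv> cis (2 * pi / real (2 * n))"

lemma rot_in_circle: "z \<in> circle \<Longrightarrow> rot n * z \<in> circle"
  by (simp add: norm_mult mem_sphere_0)

text \<open>The rotation fixes z^d, so both values are sums of the same series. Conversely,
  invariance removes every degree not divisible by d, entry by entry.\<close>

lemma power_series_in_iff:
  assumes f: "entries_in (Collect smooth) N (\<lambda>t. f (cis t))" and d: "d > 0"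
  shows "power_series_in N d f \<longleftrightarrow> (\<forall>z\<in>circle. f (cis (2 * pi / real d) * z) = f z)"
proof
  let ?w = "cis (2 * pi / real d)"
  have car: "f z \<in> carrier_mat N N" if "z \<in> circle" for z
    using that entries_inD(1)[OF f] by (auto simp: circle_cis)
  {
    assume "power_series_in N d f"
    then obtain a where a: "\<forall>z\<in>circle. laurent_sum N (z ^ d) a (f z)" unfolding power_series_in_def by blast
    show "\<forall>z\<in>circle. f (?w * z) = f z"
    proof
      fix z :: complex assume z: "z \<in> circle"
      have wz: "?w * z \<in> circle" using z by (simp add: norm_mult mem_sphere_0)
      have "(?w * z) ^ d = z ^ d" using d by (simp add: power_mult_distrib Complex.DeMoivre)
      then have l: "laurent_sum N (z ^ d) a (f (?w * z))" "laurent_sum N (z ^ d) a (f z)"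
        using bspec[OF a z] bspec[OF a wz] by simp_all
      show "f (?w * z) = f z"
      proof (rule eq_matI)
        fix i j assume "i < dim_row (f z)" "j < dim_col (f z)"
        then have "i < N" "j < N" using car[OF z] by auto
        then have "((\<lambda>m. a m $$ (i, j) * (z ^ d) powi m) has_sum f (?w * z) $$ (i, j)) UNIV"
          "((\<lambda>m. a m $$ (i, j) * (z ^ d) powi m) has_sum f z $$ (i, j)) UNIV"
          using l unfolding laurent_sum_def by auto
        then show "f (?w * z) $$ (i, j) = f z $$ (i, j)" by (rule has_sum_unique)
      qed (use car[OF z] car[OF wz] in auto)
    qed
  }
  assume inv: "\<forall>z\<in>circle. f (?w * z) = f z"
  have "\<exists>b. \<forall>z\<in>circle. ((\<lambda>m. b m * (z ^ d) powi m) has_sum f z $$ (i, j)) UNIV" if "i < N" "j < N" for i j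
    by (rule invariant_power_series[OF _ d]) (use entries_inD(2)[OF f that] inv in auto)
  then obtain b where b: "\<And>i j z. i < N \<Longrightarrow> j < N \<Longrightarrow> z \<in> circle \<Longrightarrow>
      ((\<lambda>m. b i j m * (z ^ d) powi m) has_sum f z $$ (i, j)) UNIV"
    by metis
  show "power_series_in N d f"
    unfolding power_series_in_def laurent_sum_def
    by (intro exI[of _ "\<lambda>m. mat N N (\<lambda>(i, j). b i j m)"]) (use b in auto)
qed

text \<open>Replaces the existence of an expansion by an identity between two values, on which
  products, inverses and exponentials act pointwise.\<close>

definition twisted :: "nat \<Rightarrow> loop \<Rightarrow> bool" where
  "twisted n f \<longleftrightarrow> (\<forall>z\<in>circle. psi n (rot n * z) * f (rot n * z) * psi_inv n (rot n * z) = psi n z * f z * psi_inv n z)"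

lemma power_series_psi_conj:
  assumes "n \<ge> 1" "entries_in (Collect smooth) (2 * n) (\<lambda>t. f (cis t))"
  shows "power_series_in (2 * n) (2 * n) (psi_conj n f) \<longleftrightarrow> twisted n f"
proof -
  have "(\<lambda>t. psi_conj n f (cis t)) = (\<lambda>t. psi n (cis t) * f (cis t) * psi_inv n (cis t))"
    unfolding psi_conj_def minv_psi using cis_in_circle by (auto simp: fun_eq_iff restrict_def)
  then have s: "entries_in (Collect smooth) (2 * n) (\<lambda>t. psi_conj n f (cis t))"
    using entries_in_mult[OF ring_closed_smooth entries_in_mult[OF ring_closed_smooth entries_in_psi assms(2)] entries_in_psi_inv]
    by simp
  show ?thesis
    using assms(1) rot_in_circle[of _ n]
    by (subst power_series_in_iff[OF s]) (auto simp: twisted_def psi_conj_def minv_psi)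
qed

lemma power_series_twisted:
  assumes "n \<ge> 1" "f \<in> smooth_loops (2 * n) S"
  shows "power_series_in (2 * n) (2 * n) (psi_conj n f) \<longleftrightarrow> twisted n f"
  by (rule power_series_psi_conj[OF assms(1)]) (rule smooth_loopsD(4)[OF assms(2)])

lemma lie_L_eq: "n \<ge> 1 \<Longrightarrow> lie_L n = {\<xi> \<in> sl_loops (2 * n). twisted n \<xi>}"
  unfolding lie_L_def sl_loops_def by (rule Collect_cong) (use power_series_twisted in blast)

lemma grp_L_eq: "n \<ge> 1 \<Longrightarrow> grp_L n = {f \<in> smooth_loops (2 * n) (SL (2 * n)). twisted n f}"
  unfolding grp_L_def by (rule Collect_cong) (use power_series_twisted in blast)

section \<open>Groups and Lie algebras of loops\<close>

lemma loop_group_simps [simp]: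
  "carrier (loop_group N) = smooth_loops N (SL N)"
  "mult (loop_group N) f g = (\<lambda>z\<in>circle. f z * g z)"
  "one (loop_group N) = (\<lambda>z\<in>circle. 1\<^sub>m N)"
  by (simp_all add: loop_group_def gl_loops_def)

lemma gl_loops_simps [simp]:
  "carrier (gl_loops N) = smooth_loops N (carrier_mat N N)"
  "add (gl_loops N) f g = (\<lambda>z\<in>circle. f z + g z)"
  "zero (gl_loops N) = (\<lambda>z\<in>circle. 0\<^sub>m N N)"
  "module.smult (gl_loops N) a f = (\<lambda>z\<in>circle. a \<cdot>\<^sub>m f z)"
  by (simp_all add: gl_loops_def)

section \<open>Pointwise operations on loops\<close>

lemma SL_carrier: "A \<in> SL N \<Longrightarrow> A \<in> carrier_mat N N"
  by (simp add: SL_def)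

lemma SL_mult: "A \<in> SL N \<Longrightarrow> B \<in> SL N \<Longrightarrow> A * B \<in> SL N"
  by (auto simp: SL_def Determinant.det_mult[of A N B])

lemma SL_adj:
  assumes "A \<in> SL N"
  shows "adj_mat A \<in> SL N" "A * adj_mat A = 1\<^sub>m N" "adj_mat A * A = 1\<^sub>m N"
proof -
  have A: "A \<in> carrier_mat N N" "det A = 1" using assms by (auto simp: SL_def)
  note adj = adj_mat[OF A(1)]
  show 1: "A * adj_mat A = 1\<^sub>m N" "adj_mat A * A = 1\<^sub>m N"
    using adj(2,3) A(2) by (auto intro!: eq_matI)
  have "det A * det (adj_mat A) = 1"
    using Determinant.det_mult[OF A(1) adj(1)] 1(1) by simp
  then show "adj_mat A \<in> SL N" using A(2) adj(1) by (simp add: SL_def)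
qed

lemma smooth_loops_mono: "f \<in> smooth_loops N S \<Longrightarrow> f \<in> smooth_loops N (carrier_mat N N)"
  using smooth_loopsD(3) unfolding smooth_loops_iff by blast

lemma smooth_loops_add:
  assumes "f \<in> smooth_loops N S" "g \<in> smooth_loops N T" "\<And>z. z \<in> circle \<Longrightarrow> f z + g z \<in> U"
  shows "(\<lambda>z\<in>circle. f z + g z) \<in> smooth_loops N U"
  by (rule restrict_smooth_loops[OF _ assms(3)])
     (rule entries_in_add[OF ring_closed_smooth smooth_loopsD(4)[OF assms(1)] smooth_loopsD(4)[OF assms(2)]])

lemma smooth_loops_mult:
  assumes "f \<in> smooth_loops N S" "g \<in> smooth_loops N T" "\<And>z. z \<in> circle \<Longrightarrow> f z * g z \<in> U"
  shows "(\<lambda>z\<in>circle. f z * g z) \<in> smooth_loops N U"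
  by (rule restrict_smooth_loops[OF _ assms(3)])
     (rule entries_in_mult[OF ring_closed_smooth smooth_loopsD(4)[OF assms(1)] smooth_loopsD(4)[OF assms(2)]])

lemma smooth_loops_smult:
  assumes "f \<in> smooth_loops N S" "\<And>z. z \<in> circle \<Longrightarrow> c \<cdot>\<^sub>m f z \<in> U"
  shows "(\<lambda>z\<in>circle. c \<cdot>\<^sub>m f z) \<in> smooth_loops N U"
  by (rule restrict_smooth_loops[OF _ assms(2)])
     (rule entries_in_smult[OF ring_closed_smooth ring_closed_simps(1)[OF ring_closed_smooth] smooth_loopsD(4)[OF assms(1)]])

lemma smooth_loops_adj:
  assumes "f \<in> smooth_loops N S" "\<And>z. z \<in> circle \<Longrightarrow> adj_mat (f z) \<in> U"
  shows "(\<lambda>z\<in>circle. adj_mat (f z)) \<in> smooth_loops N U"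
  by (rule restrict_smooth_loops[OF _ assms(2)])
     (rule entries_in_adj[OF ring_closed_smooth smooth_loopsD(4)[OF assms(1)]])

lemma smooth_loops_const:
  assumes "A \<in> carrier_mat N N" "A \<in> U"
  shows "(\<lambda>z\<in>circle. A) \<in> smooth_loops N U"
  by (rule restrict_smooth_loops[OF _ assms(2)]) (rule entries_in_const[OF ring_closed_smooth assms(1)])

lemma restrict_circle_eqI:
  assumes "f \<in> extensional circle" "\<And>z. z \<in> circle \<Longrightarrow> g z = f z"
  shows "(\<lambda>z\<in>circle. g z) = f"
  using assms by (auto simp: fun_eq_iff restrict_def extensional_def)

lemma restrict_circle_cong: "(\<And>z. z \<in> circle \<Longrightarrow> f z = g z) \<Longrightarrow> (\<lambda>z\<in>circle. f z) = (\<lambda>z\<in>circle. g z)"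
  by (auto simp: fun_eq_iff restrict_def)

lemma group_loop_group: "group (loop_group N)"
proof (rule groupI, unfold loop_group_simps)
  fix f g h
  assume f: "f \<in> smooth_loops N (SL N)"
  note fc = SL_carrier[OF smooth_loopsD(2)[OF f]] and fS = smooth_loopsD(2)[OF f]
  show "(\<lambda>z\<in>circle. (\<lambda>z\<in>circle. 1\<^sub>m N) z * f z) = f"
    by (rule restrict_circle_eqI[OF smooth_loopsD(1)[OF f]]) (simp add: left_mult_one_mat[OF fc])
  show "\<exists>g\<in>smooth_loops N (SL N). (\<lambda>z\<in>circle. g z * f z) = (\<lambda>z\<in>circle. 1\<^sub>m N)"
  proof (rule bexI)
    show "(\<lambda>z\<in>circle. (\<lambda>z\<in>circle. adj_mat (f z)) z * f z) = (\<lambda>z\<in>circle. 1\<^sub>m N)"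
      by (rule restrict_circle_cong) (simp add: SL_adj(3)[OF fS])
    show "(\<lambda>z\<in>circle. adj_mat (f z)) \<in> smooth_loops N (SL N)"
      by (rule smooth_loops_adj[OF f SL_adj(1)[OF fS]])
  qed
  assume g: "g \<in> smooth_loops N (SL N)"
  note gS = smooth_loopsD(2)[OF g]
  show "(\<lambda>z\<in>circle. f z * g z) \<in> smooth_loops N (SL N)"
    by (rule smooth_loops_mult[OF f g SL_mult[OF fS gS]])
  assume h: "h \<in> smooth_loops N (SL N)"
  show "(\<lambda>z\<in>circle. (\<lambda>z\<in>circle. f z * g z) z * h z) = (\<lambda>z\<in>circle. f z * (\<lambda>z\<in>circle. g z * h z) z)"
    by (rule restrict_circle_cong)
       (simp add: assoc_mult_mat[OF fc SL_carrier[OF gS] SL_carrier[OF smooth_loopsD(2)[OF h]]])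
next
  show "(\<lambda>z\<in>circle. 1\<^sub>m N) \<in> smooth_loops N (SL N)"
    by (rule smooth_loops_const) (auto simp: one_in_SL)
qed

lemma inv_loop_group:
  assumes f: "f \<in> smooth_loops N (SL N)"
  shows "m_inv (loop_group N) f = (\<lambda>z\<in>circle. adj_mat (f z))"
proof (rule group.inv_equality[OF group_loop_group], unfold loop_group_simps)
  note fS = smooth_loopsD(2)[OF f]
  show "(\<lambda>z\<in>circle. (\<lambda>z\<in>circle. adj_mat (f z)) z * f z) = (\<lambda>z\<in>circle. 1\<^sub>m N)"
    by (rule restrict_circle_cong) (simp add: SL_adj(3)[OF fS])
  show "(\<lambda>z\<in>circle. adj_mat (f z)) \<in> smooth_loops N (SL N)"
    by (rule smooth_loops_adj[OF f SL_adj(1)[OF fS]])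
qed (rule f)

text \<open>Isolates what the twisting and extension conditions must satisfy to cut out a subgroup,
  so that they can be checked separately and combined by conjunction. Inverses appear as
  adjugates.\<close>

definition group_pred :: "nat \<Rightarrow> (loop \<Rightarrow> bool) \<Rightarrow> bool" where
  "group_pred N R \<longleftrightarrow> R (\<lambda>z\<in>circle. 1\<^sub>m N) \<and>
     (\<forall>f\<in>smooth_loops N (SL N). \<forall>g\<in>smooth_loops N (SL N). R f \<longrightarrow> R g \<longrightarrow>
        R (\<lambda>z\<in>circle. f z * g z) \<and> R (\<lambda>z\<in>circle. adj_mat (f z)))"

text \<open>Closure under the associative product is demanded, which is stronger than closure under
  the bracket. Vanishing of the trace is not preserved by products, so it is treated apart, through
  \<open>sl_loops\<close>.\<close>

definition alg_pred :: "nat \<Rightarrow> (loop \<Rightarrow> bool) \<Rightarrow> bool" where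
  "alg_pred N R \<longleftrightarrow> R (\<lambda>z\<in>circle. 0\<^sub>m N N) \<and>
     (\<forall>f\<in>smooth_loops N (carrier_mat N N). \<forall>g\<in>smooth_loops N (carrier_mat N N). R f \<longrightarrow> R g \<longrightarrow>
        R (\<lambda>z\<in>circle. f z + g z) \<and> R (\<lambda>z\<in>circle. f z * g z) \<and> (\<forall>c. R (\<lambda>z\<in>circle. c \<cdot>\<^sub>m f z)))"

lemma group_pred_conj: "group_pred N R \<Longrightarrow> group_pred N R' \<Longrightarrow> group_pred N (\<lambda>f. R f \<and> R' f)"
  unfolding group_pred_def by simp

lemma alg_pred_conj: "alg_pred N R \<Longrightarrow> alg_pred N R' \<Longrightarrow> alg_pred N (\<lambda>f. R f \<and> R' f)"
  unfolding alg_pred_def by simp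

lemma subgroup_group_pred:
  assumes "group_pred N R"
  shows "subgroup {f \<in> smooth_loops N (SL N). R f} (loop_group N)"
proof (rule group.subgroupI[OF group_loop_group])
  show "{f \<in> smooth_loops N (SL N). R f} \<noteq> {}"
    using assms monoid.one_closed[OF group.is_monoid[OF group_loop_group, of N]] unfolding group_pred_def by auto
next
  fix f assume f: "f \<in> {f \<in> smooth_loops N (SL N). R f}"
  then have "m_inv (loop_group N) f \<in> smooth_loops N (SL N)"
    using group.inv_closed[OF group_loop_group, of f N] by simp
  then show "m_inv (loop_group N) f \<in> {f \<in> smooth_loops N (SL N). R f}"
    using f assms inv_loop_group[of f N] unfolding group_pred_def by auto
next
  fix f g assume fg: "f \<in> {f \<in> smooth_loops N (SL N). R f}" "g \<in> {f \<in> smooth_loops N (SL N). R f}"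
  then have "mult (loop_group N) f g \<in> smooth_loops N (SL N)"
    using monoid.m_closed[OF group.is_monoid[OF group_loop_group], of f N g] by simp
  then show "mult (loop_group N) f g \<in> {f \<in> smooth_loops N (SL N). R f}"
    using fg assms unfolding group_pred_def by auto
qed auto

lemma mat_trace_add: "X \<in> carrier_mat N N \<Longrightarrow> Y \<in> carrier_mat N N \<Longrightarrow> mat_trace (X + Y) = mat_trace X + mat_trace Y"
  by (simp add: mat_trace_def sum.distrib)

lemma mat_trace_smult: "X \<in> carrier_mat N N \<Longrightarrow> mat_trace (c \<cdot>\<^sub>m X) = c * mat_trace X"
  by (simp add: mat_trace_def sum_distrib_left)

lemma sl_add: "X \<in> sl N \<Longrightarrow> Y \<in> sl N \<Longrightarrow> X + Y \<in> sl N"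
  and sl_smult: "X \<in> sl N \<Longrightarrow> c \<cdot>\<^sub>m X \<in> sl N"
  by (auto simp: sl_def mat_trace_add[of X N Y] mat_trace_smult[of X N])

lemma mat_minus_eq: "Y \<in> carrier_mat N N \<Longrightarrow> X - Y = X + (-1) \<cdot>\<^sub>m (Y :: complex mat)"
  by (rule eq_matI) auto

lemma mat_uminus_add: "X \<in> carrier_mat N N \<Longrightarrow> (-1) \<cdot>\<^sub>m X + (X :: complex mat) = 0\<^sub>m N N"
  by (rule eq_matI) auto

lemma vectorspace_gl_loops: "vectorspace class_ring (gl_loops N)"
proof -
  let ?L = "smooth_loops N (carrier_mat N N)"
  have ab: "abelian_group (gl_loops N)"
  proof (rule abelian_groupI, unfold gl_loops_simps)
    fix f g h assume f: "f \<in> ?L"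
    note fc = smooth_loopsD(2)[OF f]
    show "(\<lambda>z\<in>circle. (\<lambda>z\<in>circle. 0\<^sub>m N N) z + f z) = f"
      by (rule restrict_circle_eqI[OF smooth_loopsD(1)[OF f]]) (use fc in auto)
    show "\<exists>y\<in>?L. (\<lambda>z\<in>circle. y z + f z) = (\<lambda>z\<in>circle. 0\<^sub>m N N)"
    proof (rule bexI)
      show "(\<lambda>z\<in>circle. (\<lambda>z\<in>circle. (-1) \<cdot>\<^sub>m f z) z + f z) = (\<lambda>z\<in>circle. 0\<^sub>m N N)"
        by (rule restrict_circle_cong) (simp add: mat_uminus_add[OF fc])
      show "(\<lambda>z\<in>circle. (-1) \<cdot>\<^sub>m f z) \<in> ?L"
        by (rule smooth_loops_smult[OF f]) (use fc in auto)
    qed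
    assume g: "g \<in> ?L"
    note gc = smooth_loopsD(2)[OF g]
    show "(\<lambda>z\<in>circle. f z + g z) \<in> ?L"
      by (rule smooth_loops_add[OF f g]) (use fc gc in auto)
    show "(\<lambda>z\<in>circle. f z + g z) = (\<lambda>z\<in>circle. g z + f z)"
      by (rule restrict_circle_cong) (rule comm_add_mat[OF fc gc])
    assume h: "h \<in> ?L"
    show "(\<lambda>z\<in>circle. (\<lambda>z\<in>circle. f z + g z) z + h z) = (\<lambda>z\<in>circle. f z + (\<lambda>z\<in>circle. g z + h z) z)"
      by (rule restrict_circle_cong) (simp add: assoc_add_mat[OF fc gc smooth_loopsD(2)[OF h]])
  next
    show "(\<lambda>z\<in>circle. 0\<^sub>m N N) \<in> ?L" by (rule smooth_loops_const) auto
  qed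
  have "Module.module class_ring (gl_loops N)"
  proof (rule moduleI[OF class_cring.is_cring ab], unfold gl_loops_simps)
    fix a b :: complex and f g assume f: "f \<in> ?L"
    note fc = smooth_loopsD(2)[OF f]
    show "(\<lambda>z\<in>circle. a \<cdot>\<^sub>m f z) \<in> ?L"
      by (rule smooth_loops_smult[OF f]) (use fc in auto)
    show "(\<lambda>z\<in>circle. (a \<oplus>\<^bsub>class_ring\<^esub> b) \<cdot>\<^sub>m f z) = (\<lambda>z\<in>circle. (\<lambda>z\<in>circle. a \<cdot>\<^sub>m f z) z + (\<lambda>z\<in>circle. b \<cdot>\<^sub>m f z) z)"
      by (rule restrict_circle_cong) (simp add: add_smult_distrib_right_mat[OF fc])
    show "(\<lambda>z\<in>circle. (a \<otimes>\<^bsub>class_ring\<^esub> b) \<cdot>\<^sub>m f z) = (\<lambda>z\<in>circle. a \<cdot>\<^sub>m (\<lambda>z\<in>circle. b \<cdot>\<^sub>m f z) z)"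
      by (rule restrict_circle_cong) (auto intro!: eq_matI)
    show "(\<lambda>z\<in>circle. \<one>\<^bsub>class_ring\<^esub> \<cdot>\<^sub>m f z) = f"
      by (rule restrict_circle_eqI[OF smooth_loopsD(1)[OF f]]) (auto intro!: eq_matI)
    assume g: "g \<in> ?L"
    show "(\<lambda>z\<in>circle. a \<cdot>\<^sub>m (\<lambda>z\<in>circle. f z + g z) z) = (\<lambda>z\<in>circle. (\<lambda>z\<in>circle. a \<cdot>\<^sub>m f z) z + (\<lambda>z\<in>circle. a \<cdot>\<^sub>m g z) z)"
      by (rule restrict_circle_cong) (simp add: add_smult_distrib_left_mat[OF fc smooth_loopsD(2)[OF g]])
  qed
  then show ?thesis by (rule vectorspace.intro[OF _ class_field])
qed

lemma lie_subalgebra_alg_pred: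
  assumes R: "alg_pred N R"
  shows "lie_subalgebra N {\<xi> \<in> sl_loops N. R \<xi>}"
proof -
  let ?V = "{\<xi> \<in> sl_loops N. R \<xi>}"
  note vs = vectorspace_gl_loops[of N]
  have V: "f \<in> smooth_loops N (sl N)" "f \<in> smooth_loops N (carrier_mat N N)" "R f" if "f \<in> ?V" for f
    using that smooth_loops_mono[of f N "sl N"] by (auto simp: sl_loops_def)
  have add: "(\<lambda>z\<in>circle. f z + g z) \<in> ?V" if "f \<in> ?V" "g \<in> ?V" for f g
    using smooth_loops_add[OF V(1)[OF that(1)] V(1)[OF that(2)] sl_add[OF smooth_loopsD(2)[OF V(1)[OF that(1)]] smooth_loopsD(2)[OF V(1)[OF that(2)]]]]
      R V[OF that(1)] V[OF that(2)] by (simp add: sl_loops_def alg_pred_def)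
  have smult: "(\<lambda>z\<in>circle. c \<cdot>\<^sub>m f z) \<in> ?V" if "f \<in> ?V" for f c
    using smooth_loops_smult[OF V(1)[OF that] sl_smult[OF smooth_loopsD(2)[OF V(1)[OF that]]]]
      R V[OF that] by (simp add: sl_loops_def alg_pred_def)
  have "VectorSpace.subspace class_ring ?V (gl_loops N)"
    unfolding VectorSpace.subspace_def
  proof (intro conjI vs submodule.intro vectorspace.axioms(1)[OF vs])
    show "?V \<subseteq> carrier (gl_loops N)" using V(2) by auto
    show "zero (gl_loops N) \<in> ?V"
      using R smooth_loops_const[of "0\<^sub>m N N" N "sl N"] by (simp add: sl_loops_def alg_pred_def sl_def mat_trace_def)
  qed (use add smult in simp_all)
  moreover have "loop_bracket f g \<in> ?V" if fg: "f \<in> ?V" "g \<in> ?V" for f g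
  proof -
    note f = V[OF fg(1)] and g = V[OF fg(2)]
    note fc = smooth_loopsD(2)[OF f(2)] and gc = smooth_loopsD(2)[OF g(2)]
    define h where "h = (\<lambda>z\<in>circle. f z * g z)"
    define k where "k = (\<lambda>z\<in>circle. g z * f z)"
    define l where "l = (\<lambda>z\<in>circle. (-1) \<cdot>\<^sub>m k z)"
    have h: "h \<in> smooth_loops N (carrier_mat N N)"
      unfolding h_def by (rule smooth_loops_mult[OF f(2) g(2) mult_carrier_mat[OF fc gc]])
    have k: "k \<in> smooth_loops N (carrier_mat N N)"
      unfolding k_def by (rule smooth_loops_mult[OF g(2) f(2) mult_carrier_mat[OF gc fc]])
    note hk = h k
    have l: "l \<in> smooth_loops N (carrier_mat N N)"
      unfolding l_def by (rule smooth_loops_smult[OF hk(2)]) (use smooth_loopsD(2)[OF hk(2)] in auto)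
    have "R h" "R k" using R f g unfolding h_def k_def alg_pred_def by blast+
    then have "R l" using R hk unfolding l_def alg_pred_def by blast
    have eq: "loop_bracket f g = (\<lambda>z\<in>circle. h z + l z)"
      unfolding loop_bracket_def
      by (rule restrict_circle_cong) (simp add: h_def l_def k_def mat_minus_eq[OF mult_carrier_mat[OF gc fc]])
    \<comment> \<open>The commutator is traceless by cyclicity of the trace.\<close>
    have "(\<lambda>z\<in>circle. h z + l z) \<in> smooth_loops N (sl N)"
    proof (rule smooth_loops_add[OF hk(1) l])
      fix z :: complex assume z: "z \<in> circle"
      note c = mult_carrier_mat[OF fc[OF z] gc[OF z]] mult_carrier_mat[OF gc[OF z] fc[OF z]]
      have "mat_trace (h z + l z) = mat_trace (f z * g z) - mat_trace (g z * f z)"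
        using z c by (simp add: h_def l_def k_def mat_trace_add[of _ N] mat_trace_smult[of _ N])
      then show "h z + l z \<in> sl N"
        using z smooth_loopsD(2)[OF hk(1) z] smooth_loopsD(2)[OF l z] mat_trace_mult_commute[OF fc[OF z] gc[OF z]]
        by (simp add: sl_def)
    qed
    moreover have "R (\<lambda>z\<in>circle. h z + l z)"
      using R hk(1) l \<open>R h\<close> \<open>R l\<close> unfolding alg_pred_def by blast
    ultimately show ?thesis unfolding eq sl_loops_def by blast
  qed
  ultimately show ?thesis unfolding lie_subalgebra_def by blast
qed

subsection \<open>The twisting condition\<close>

text \<open>For each z an automorphism of the matrix algebra that also commutes with the
  exponential; this makes the twisting condition stable under all operations on loops.\<close>

definition psi_conj_at :: "nat \<Rightarrow> complex \<Rightarrow> complex mat \<Rightarrow> complex mat" where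
  "psi_conj_at n z X = psi n z * X * psi_inv n z"

lemma twisted_conj: "twisted n f \<longleftrightarrow> (\<forall>z\<in>circle. psi_conj_at n (rot n * z) (f (rot n * z)) = psi_conj_at n z (f z))"
  by (simp add: twisted_def psi_conj_at_def)

lemma psi_conj_at_carrier: "X \<in> carrier_mat (2 * n) (2 * n) \<Longrightarrow> psi_conj_at n z X \<in> carrier_mat (2 * n) (2 * n)"
  unfolding psi_conj_at_def by (intro mult_carrier_mat[of _ "2 * n" "2 * n"] psi_carrier psi_inv_carrier)

lemma psi_conj_at_add:
  assumes "X \<in> carrier_mat (2 * n) (2 * n)" "Y \<in> carrier_mat (2 * n) (2 * n)"
  shows "psi_conj_at n z (X + Y) = psi_conj_at n z X + psi_conj_at n z Y"
  unfolding psi_conj_at_def mult_add_distrib_mat[OF psi_carrier assms]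
  by (rule add_mult_distrib_mat[OF mult_carrier_mat[OF psi_carrier assms(1)] mult_carrier_mat[OF psi_carrier assms(2)] psi_inv_carrier])

lemma psi_conj_at_smult:
  assumes "X \<in> carrier_mat (2 * n) (2 * n)"
  shows "psi_conj_at n z (c \<cdot>\<^sub>m X) = c \<cdot>\<^sub>m psi_conj_at n z X"
  unfolding psi_conj_at_def mult_smult_distrib[OF psi_carrier assms]
  by (rule mult_smult_assoc_mat[OF mult_carrier_mat[OF psi_carrier assms] psi_inv_carrier])

lemma psi_cancel:
  assumes "X \<in> carrier_mat (2 * n) (2 * n)"
  shows "psi_inv n z * (psi n z * X) = X" "psi n z * (psi_inv n z * X) = X"
  using assoc_mult_mat[OF psi_inv_carrier psi_carrier assms, of z z] assoc_mult_mat[OF psi_carrier psi_inv_carrier assms, of z z]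
    assms by (simp_all add: psi_inverse)

lemma psi_conj_at_mult:
  assumes "X \<in> carrier_mat (2 * n) (2 * n)" "Y \<in> carrier_mat (2 * n) (2 * n)"
  shows "psi_conj_at n z (X * Y) = psi_conj_at n z X * psi_conj_at n z Y"
proof -
  note P = psi_carrier[of n z] and Q = psi_inv_carrier[of n z]
  have "psi_conj_at n z X * psi_conj_at n z Y = psi n z * X * (psi_inv n z * (psi n z * (Y * psi_inv n z)))"
    unfolding psi_conj_at_def assoc_mult_mat[OF P assms(2) Q]
    by (rule assoc_mult_mat[OF mult_carrier_mat[OF P assms(1)] Q mult_carrier_mat[OF P mult_carrier_mat[OF assms(2) Q]]])
  also have "\<dots> = psi n z * X * (Y * psi_inv n z)"
    unfolding psi_cancel(1)[OF mult_carrier_mat[OF assms(2) Q]] ..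
  also have "\<dots> = psi n z * X * Y * psi_inv n z"
    by (rule assoc_mult_mat[OF mult_carrier_mat[OF P assms(1)] assms(2) Q, symmetric])
  also have "psi n z * X * Y = psi n z * (X * Y)"
    by (rule assoc_mult_mat[OF P assms])
  finally show ?thesis by (simp add: psi_conj_at_def)
qed

lemma psi_conj_at_one: "psi_conj_at n z (1\<^sub>m (2 * n)) = 1\<^sub>m (2 * n)"
  unfolding psi_conj_at_def right_mult_one_mat[OF psi_carrier] by (rule psi_inverse(2))

lemma psi_conj_at_zero: "psi_conj_at n z (0\<^sub>m (2 * n) (2 * n)) = 0\<^sub>m (2 * n) (2 * n)"
  unfolding psi_conj_at_def right_mult_zero_mat[OF psi_carrier] left_mult_zero_mat[OF psi_inv_carrier] ..

lemma psi_conj_at_exp: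
  assumes "X \<in> carrier_mat (2 * n) (2 * n)"
  shows "psi_conj_at n z (mat_exp (c \<cdot>\<^sub>m X)) = mat_exp (c \<cdot>\<^sub>m psi_conj_at n z X)"
  unfolding psi_conj_at_smult[OF assms, symmetric] unfolding psi_conj_at_def
  by (rule mat_exp_similar[symmetric]) (use assms psi_inverse in auto)

lemma twisted_alg_pred: "alg_pred (2 * n) (twisted n)"
  unfolding alg_pred_def twisted_conj
proof (intro conjI ballI impI allI)
  fix f g z c
  assume f: "f \<in> smooth_loops (2 * n) (carrier_mat (2 * n) (2 * n))"
    and g: "g \<in> smooth_loops (2 * n) (carrier_mat (2 * n) (2 * n))"
    and i: "\<forall>z\<in>circle. psi_conj_at n (rot n * z) (f (rot n * z)) = psi_conj_at n z (f z)"
      "\<forall>z\<in>circle. psi_conj_at n (rot n * z) (g (rot n * z)) = psi_conj_at n z (g z)" and z: "z \<in> circle"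
  note rz = rot_in_circle[OF z, of n]
  note fc = smooth_loopsD(2)[OF f] and gc = smooth_loopsD(2)[OF g]
  show "psi_conj_at n (rot n * z) ((\<lambda>z\<in>circle. f z + g z) (rot n * z)) = psi_conj_at n z ((\<lambda>z\<in>circle. f z + g z) z)"
    using z rz i by (simp add: psi_conj_at_add fc gc)
  show "psi_conj_at n (rot n * z) ((\<lambda>z\<in>circle. f z * g z) (rot n * z)) = psi_conj_at n z ((\<lambda>z\<in>circle. f z * g z) z)"
    using z rz i by (simp add: psi_conj_at_mult fc gc)
  show "psi_conj_at n (rot n * z) ((\<lambda>z\<in>circle. c \<cdot>\<^sub>m f z) (rot n * z)) = psi_conj_at n z ((\<lambda>z\<in>circle. c \<cdot>\<^sub>m f z) z)"
    using z rz i by (simp add: psi_conj_at_smult fc)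
qed (use rot_in_circle in \<open>simp add: psi_conj_at_zero\<close>)

lemma twisted_group_pred: "group_pred (2 * n) (twisted n)"
  unfolding group_pred_def twisted_conj
proof (intro conjI ballI impI)
  fix f g z
  assume f: "f \<in> smooth_loops (2 * n) (SL (2 * n))" and g: "g \<in> smooth_loops (2 * n) (SL (2 * n))"
    and i: "\<forall>z\<in>circle. psi_conj_at n (rot n * z) (f (rot n * z)) = psi_conj_at n z (f z)"
      "\<forall>z\<in>circle. psi_conj_at n (rot n * z) (g (rot n * z)) = psi_conj_at n z (g z)" and z: "z \<in> circle"
  note rz = rot_in_circle[OF z, of n]
  note fS = smooth_loopsD(2)[OF f]
  note fc = smooth_loopsD(3)[OF f] and gc = smooth_loopsD(3)[OF g]
  show "psi_conj_at n (rot n * z) ((\<lambda>z\<in>circle. f z * g z) (rot n * z)) = psi_conj_at n z ((\<lambda>z\<in>circle. f z * g z) z)"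
    using z rz i by (simp add: psi_conj_at_mult fc gc)
  have ac: "adj_mat (f z) \<in> carrier_mat (2 * n) (2 * n)" if "z \<in> circle" for z
    by (rule adj_mat(1)[OF fc[OF that]])
  \<comment> \<open>\<open>?C\<close> is a left inverse and \<open>?B\<close> a right inverse of the
    same matrix \<open>?A\<close>, hence they coincide.\<close>
  let ?A = "psi_conj_at n z (f z)" and ?B = "psi_conj_at n z (adj_mat (f z))" and ?C = "psi_conj_at n (rot n * z) (adj_mat (f (rot n * z)))"
  have "?C * ?A = ?C * psi_conj_at n (rot n * z) (f (rot n * z))"
    by (simp only: bspec[OF i(1) z])
  also have "\<dots> = psi_conj_at n (rot n * z) (adj_mat (f (rot n * z)) * f (rot n * z))"
    by (rule psi_conj_at_mult[OF ac[OF rz] fc[OF rz], symmetric])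
  also have "\<dots> = 1\<^sub>m (2 * n)"
    by (simp only: SL_adj(3)[OF fS[OF rz]] psi_conj_at_one)
  finally have "?C * ?A = 1\<^sub>m (2 * n)" .
  moreover have "?A * ?B = 1\<^sub>m (2 * n)"
    unfolding psi_conj_at_mult[OF fc[OF z] ac[OF z], symmetric] SL_adj(2)[OF fS[OF z]] by (rule psi_conj_at_one)
  moreover have "?C * ?A * ?B = ?C * (?A * ?B)"
    by (rule assoc_mult_mat[OF psi_conj_at_carrier[OF ac[OF rz]] psi_conj_at_carrier[OF fc[OF z]] psi_conj_at_carrier[OF ac[OF z]]])
  ultimately have "?C = ?B"
    using left_mult_one_mat[OF psi_conj_at_carrier[OF ac[OF z]]] right_mult_one_mat[OF psi_conj_at_carrier[OF ac[OF rz]]] by simp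
  then show "psi_conj_at n (rot n * z) ((\<lambda>z\<in>circle. adj_mat (f z)) (rot n * z)) = psi_conj_at n z ((\<lambda>z\<in>circle. adj_mat (f z)) z)"
    using z rz by simp
qed (use rot_in_circle in \<open>simp add: psi_conj_at_one\<close>)

subsection \<open>Holomorphic extension\<close>

lemma matrix_ext_restrict: "matrix_ext N C (\<lambda>z. f z) \<Longrightarrow> matrix_ext N C (\<lambda>z. (\<lambda>z\<in>circle. f z) z)"
  by (erule matrix_ext_cong) simp

lemma outside_restrict:
  assumes "matrix_ext N C (\<lambda>z. f (1 / z))"
  shows "outside N C (\<lambda>z\<in>circle. f z)"
  unfolding outside_def by (rule matrix_ext_cong[OF assms]) (simp add: inverse_in_circle)

lemma inside_alg_pred: "alg_pred N (inside N)"
  unfolding alg_pred_def inside_def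
proof (intro conjI ballI impI allI; (elim exE)?)
  show "\<exists>C. matrix_ext N C (\<lambda>z\<in>circle. 0\<^sub>m N N)"
    by (rule exI, rule matrix_ext_restrict, rule matrix_ext_const, rule zero_carrier_mat)
  fix f g :: loop and A B c assume fg: "matrix_ext N A f" "matrix_ext N B g"
  show "\<exists>C. matrix_ext N C (\<lambda>z\<in>circle. f z + g z)"
    using matrix_ext_restrict[OF matrix_ext_add[OF fg]] by blast
  show "\<exists>C. matrix_ext N C (\<lambda>z\<in>circle. f z * g z)"
    using matrix_ext_restrict[OF matrix_ext_mult[OF fg]] by blast
  show "\<exists>C. matrix_ext N C (\<lambda>z\<in>circle. c \<cdot>\<^sub>m f z)"
    using matrix_ext_restrict[OF matrix_ext_smult[OF fg(1)]] by blast
qed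

lemma inside_group_pred: "group_pred N (inside N)"
  unfolding group_pred_def inside_def
proof (intro conjI ballI impI allI; (elim exE)?)
  show "\<exists>C. matrix_ext N C (\<lambda>z\<in>circle. 1\<^sub>m N)"
    by (rule exI, rule matrix_ext_restrict, rule matrix_ext_const, rule one_carrier_mat)
  fix f g :: loop and A B assume fg: "matrix_ext N A f" "matrix_ext N B g"
  show "\<exists>C. matrix_ext N C (\<lambda>z\<in>circle. f z * g z)"
    using matrix_ext_restrict[OF matrix_ext_mult[OF fg]] by blast
  show "\<exists>C. matrix_ext N C (\<lambda>z\<in>circle. adj_mat (f z))"
    using matrix_ext_restrict[OF matrix_ext_adj[OF fg(1)]] by blast
qed

lemma outside_alg_pred: "alg_pred N (outside N (0\<^sub>m N N))"
  unfolding alg_pred_def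
proof (intro conjI ballI impI allI)
  let ?Z = "0\<^sub>m N N :: complex mat"
  show "outside N ?Z (\<lambda>z\<in>circle. ?Z)"
    by (rule outside_restrict) (rule matrix_ext_const, simp)
  fix f g :: loop and c assume fg: "outside N ?Z f" "outside N ?Z g"
  have z: "?Z + ?Z = ?Z" "?Z * ?Z = ?Z" "c \<cdot>\<^sub>m ?Z = ?Z" by (auto intro!: eq_matI)
  show "outside N ?Z (\<lambda>z\<in>circle. f z + g z)"
    by (rule outside_restrict) (use matrix_ext_add[OF fg[unfolded outside_def]] z in simp)
  show "outside N ?Z (\<lambda>z\<in>circle. f z * g z)"
    by (rule outside_restrict) (use matrix_ext_mult[OF fg[unfolded outside_def]] z in simp)
  show "outside N ?Z (\<lambda>z\<in>circle. c \<cdot>\<^sub>m f z)"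
    by (rule outside_restrict) (use matrix_ext_smult[OF fg(1)[unfolded outside_def], of c] z in simp)
qed

lemma outside_group_pred: "group_pred N (outside N (1\<^sub>m N))"
  unfolding group_pred_def
proof (intro conjI ballI impI)
  let ?I = "1\<^sub>m N :: complex mat"
  show "outside N ?I (\<lambda>z\<in>circle. ?I)"
    by (rule outside_restrict) (rule matrix_ext_const, simp)
  fix f g :: loop assume fg: "outside N ?I f" "outside N ?I g"
  have "adj_mat ?I = ?I"
    using SL_adj(2)[OF one_in_SL[of N]] left_mult_one_mat[OF adj_mat(1)[OF SL_carrier[OF one_in_SL[of N]]]] by simp
  then show "outside N ?I (\<lambda>z\<in>circle. adj_mat (f z))"
    by (intro outside_restrict) (use matrix_ext_adj[OF fg(1)[unfolded outside_def]] in simp)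
  show "outside N ?I (\<lambda>z\<in>circle. f z * g z)"
    by (rule outside_restrict) (use matrix_ext_mult[OF fg[unfolded outside_def]] in simp)
qed

subsection \<open>Lie algebras of the groups\<close>

text \<open>Dividing by t and letting t tend to 0; this extracts the linear term of an
  exponential.\<close>

lemma quadratic_bound_zero:
  fixes a :: complex
  assumes "\<And>t :: real. 0 < t \<Longrightarrow> t \<le> 1 \<Longrightarrow> norm (of_real t * a) \<le> t\<^sup>2 * K"
  shows "a = 0"
proof (rule ccontr)
  assume "a \<noteq> 0"
  have K: "norm a \<le> t * K" if "0 < t" "t \<le> 1" for t
    using assms[OF that] that by (simp add: norm_mult power2_eq_square)
  have "K > 0" using K[of 1] \<open>a \<noteq> 0\<close> zero_less_norm_iff[of a] by linarith
  define t where "t = min 1 (norm a / (2 * K))"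
  have "0 < t" "t \<le> 1" using \<open>K > 0\<close> \<open>a \<noteq> 0\<close> by (auto simp: t_def)
  then have "norm a \<le> t * K" by (rule K)
  also have "\<dots> \<le> norm a / (2 * K) * K" using \<open>K > 0\<close> by (intro mult_right_mono) (auto simp: t_def)
  also have "\<dots> = norm a / 2" using \<open>K > 0\<close> by simp
  finally show False using \<open>a \<noteq> 0\<close> by simp
qed

lemma mat_exp_inj:
  assumes A: "A \<in> carrier_mat N N" and B: "B \<in> carrier_mat N N"
    and eq: "\<And>t :: real. mat_exp (of_real t \<cdot>\<^sub>m A) = mat_exp (of_real t \<cdot>\<^sub>m B)"
  shows "A = B"
proof (rule eq_matI)
  fix i j assume "i < dim_row B" "j < dim_col B"
  then have ij: "i < N" "j < N" using B by auto
  obtain K where K: "\<And>i j. i < N \<Longrightarrow> j < N \<Longrightarrow> norm (A $$ (i, j)) \<le> K" by (metis entry_bound)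
  obtain L where L: "\<And>i j. i < N \<Longrightarrow> j < N \<Longrightarrow> norm (B $$ (i, j)) \<le> L" by (metis entry_bound)
  have "A $$ (i, j) - B $$ (i, j) = 0"
  proof (rule quadratic_bound_zero)
    fix t :: real assume t: "0 < t" "t \<le> 1"
    let ?e = "mat_exp (of_real t \<cdot>\<^sub>m A) $$ (i, j) - 1\<^sub>m N $$ (i, j)"
    have "norm (?e - of_real t * A $$ (i, j)) \<le> t\<^sup>2 * exp (real N * K)"
      by (rule mat_exp_first_order[OF A K ij]) (use t in auto)
    moreover have "norm (?e - of_real t * B $$ (i, j)) \<le> t\<^sup>2 * exp (real N * L)"
      unfolding eq by (rule mat_exp_first_order[OF B L ij]) (use t in auto)
    moreover have "of_real t * (A $$ (i, j) - B $$ (i, j)) = (?e - of_real t * B $$ (i, j)) - (?e - of_real t * A $$ (i, j))"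
      by (simp add: algebra_simps)
    ultimately show "norm (of_real t * (A $$ (i, j) - B $$ (i, j))) \<le> t\<^sup>2 * (exp (real N * K) + exp (real N * L))"
      using norm_triangle_ineq4[of "?e - of_real t * B $$ (i, j)" "?e - of_real t * A $$ (i, j)"]
      by (simp only: distrib_left)
  qed
  then show "A $$ (i, j) = B $$ (i, j)" by simp
qed (use A B in auto)

definition exp_loop :: "real \<Rightarrow> loop \<Rightarrow> loop" where
  "exp_loop t \<xi> = (\<lambda>z\<in>circle. mat_exp (of_real t \<cdot>\<^sub>m \<xi> z))"

lemma entries_in_exp_loop:
  assumes "\<xi> \<in> smooth_loops N S"
  shows "entries_in (Collect smooth) N (\<lambda>\<theta>. mat_exp (of_real t \<cdot>\<^sub>m \<xi> (cis \<theta>)))"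
  by (intro entries_in_smooth_mat_exp entries_in_smult[OF ring_closed_smooth] ring_closed_simps(1)[OF ring_closed_smooth]
      smooth_loopsD(4)[OF assms])

text \<open>The determinant of exp(t X) is exp(t tr X), which equals 1 for all real t exactly when
  the trace vanishes.\<close>

lemma exp_loop_SL:
  assumes \<xi>: "\<xi> \<in> smooth_loops N (carrier_mat N N)"
  shows "(\<forall>t. exp_loop t \<xi> \<in> smooth_loops N (SL N)) \<longleftrightarrow> \<xi> \<in> sl_loops N"
proof
  note \<xi>c = smooth_loopsD(2)[OF \<xi>]
  have det: "det (mat_exp (of_real t \<cdot>\<^sub>m \<xi> z)) = exp (of_real t * mat_trace (\<xi> z))" if "z \<in> circle" for t z
    using det_mat_exp[OF smult_carrier_mat[OF \<xi>c[OF that]], of "of_real t"] mat_trace_smult[OF \<xi>c[OF that]] by simp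
  {
    assume *: "\<forall>t. exp_loop t \<xi> \<in> smooth_loops N (SL N)"
    have "\<xi> z \<in> sl N" if z: "z \<in> circle" for z
    proof -
      let ?c = "mat_trace (\<xi> z)"
      have e: "exp (of_real t * ?c) = 1" for t
        using smooth_loopsD(2)[OF *[rule_format, of t] z] z det[OF z, of t] by (simp add: exp_loop_def SL_def)
      \<comment> \<open>With this t the number t tr X has norm at most 1, less than 2 pi, so among
        the multiples of 2 pi i only 0 is possible.\<close>
      define t where "t = 1 / (1 + norm ?c)"
      have "1 + norm ?c > 0" by (smt (verit) norm_ge_zero)
      then have t: "t > 0" by (simp add: t_def)
      have "norm (of_real t * ?c) = t * norm ?c" using t by (simp add: norm_mult)
      also have "\<dots> \<le> 1" using \<open>1 + norm ?c > 0\<close> by (simp add: t_def field_simps)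
      finally have "norm (of_real t * ?c) \<le> 1" .
      then have "\<bar>Im (of_real t * ?c)\<bar> \<le> 1" using abs_Im_le_cmod order.trans by blast
      moreover obtain n :: int where "Re (of_real t * ?c) = 0" "Im (of_real t * ?c) = of_int (2 * n) * pi"
        using e[of t] unfolding exp_eq_1 by auto
      moreover have "n = 0"
      proof (rule ccontr)
        assume "n \<noteq> 0"
        then have "\<bar>real_of_int (2 * n)\<bar> \<ge> 2" by linarith
        then have "\<bar>of_int (2 * n) * pi\<bar> \<ge> 2 * pi" unfolding abs_mult by (intro mult_mono) auto
        then show False using calculation pi_gt3 by linarith
      qed
      ultimately have "of_real t * ?c = 0" by (simp add: complex_eq_iff)
      then show ?thesis using t \<xi>c[OF z] by (simp add: sl_def)
    qed
    then show "\<xi> \<in> sl_loops N" using \<xi> by (simp add: sl_loops_def smooth_loops_iff)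
  }
  assume *: "\<xi> \<in> sl_loops N"
  show "\<forall>t. exp_loop t \<xi> \<in> smooth_loops N (SL N)"
    unfolding exp_loop_def
  proof (intro allI restrict_smooth_loops entries_in_exp_loop[OF \<xi>])
    fix t z assume z: "z \<in> circle"
    have "mat_trace (\<xi> z) = 0" using smooth_loopsD(2)[OF *[unfolded sl_loops_def] z] by (simp add: sl_def)
    then show "mat_exp (of_real t \<cdot>\<^sub>m \<xi> z) \<in> SL N"
      using det[OF z, of t] mat_exp_carrier[OF smult_carrier_mat[OF \<xi>c[OF z]]] by (simp add: SL_def)
  qed
qed

lemma lie_algebra_of_eq:
  assumes "\<And>\<xi>. \<xi> \<in> sl_loops N \<Longrightarrow> (\<forall>t. R (exp_loop t \<xi>)) \<longleftrightarrow> R' \<xi>"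
  shows "lie_algebra_of N {f \<in> smooth_loops N (SL N). R f} = {\<xi> \<in> sl_loops N. R' \<xi>}"
proof -
  have "\<xi> \<in> smooth_loops N (carrier_mat N N)" if "\<xi> \<in> sl_loops N" for \<xi>
    using that smooth_loops_mono unfolding sl_loops_def by blast
  then show ?thesis
    using assms exp_loop_SL[of _ N] unfolding lie_algebra_of_def exp_loop_def[symmetric] by blast
qed

text \<open>Conjugation commutes with the exponential, and one-parameter groups determine their
  generators by \<open>mat_exp_inj\<close>.\<close>

lemma twisted_exp:
  assumes \<xi>: "\<xi> \<in> sl_loops (2 * n)"
  shows "(\<forall>t. twisted n (exp_loop t \<xi>)) \<longleftrightarrow> twisted n \<xi>"
proof -
  note c = smooth_loopsD(3)[OF \<xi>[unfolded sl_loops_def]]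
  have e: "psi_conj_at n z (exp_loop t \<xi> z) = mat_exp (of_real t \<cdot>\<^sub>m psi_conj_at n z (\<xi> z))" if "z \<in> circle" for t z
    using that psi_conj_at_exp[OF c[OF that], of z "of_real t"] by (simp add: exp_loop_def)
  have "(\<forall>t. mat_exp (of_real t \<cdot>\<^sub>m psi_conj_at n (rot n * z) (\<xi> (rot n * z))) = mat_exp (of_real t \<cdot>\<^sub>m psi_conj_at n z (\<xi> z))) \<longleftrightarrow>
      psi_conj_at n (rot n * z) (\<xi> (rot n * z)) = psi_conj_at n z (\<xi> z)" if z: "z \<in> circle" for z
  proof
    assume "\<forall>t. mat_exp (of_real t \<cdot>\<^sub>m psi_conj_at n (rot n * z) (\<xi> (rot n * z))) = mat_exp (of_real t \<cdot>\<^sub>m psi_conj_at n z (\<xi> z))"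
    then show "psi_conj_at n (rot n * z) (\<xi> (rot n * z)) = psi_conj_at n z (\<xi> z)"
      by (intro mat_exp_inj[OF psi_conj_at_carrier[OF c[OF rot_in_circle[OF z]]] psi_conj_at_carrier[OF c[OF z]]]) blast
  qed simp
  then have "(\<forall>z\<in>circle. \<forall>t. mat_exp (of_real t \<cdot>\<^sub>m psi_conj_at n (rot n * z) (\<xi> (rot n * z))) = mat_exp (of_real t \<cdot>\<^sub>m psi_conj_at n z (\<xi> z))) \<longleftrightarrow> twisted n \<xi>"
    unfolding twisted_conj by (rule ball_cong[OF refl])
  then show ?thesis
    unfolding twisted_conj[of n "exp_loop _ _"] using e e[OF rot_in_circle] by auto
qed

text \<open>Write exp(t \<open>\<xi>\<close>) = 1 + t \<open>\<xi>\<close> + r. By compactness of a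
  period the remainder r is of order t^2 uniformly in the angle, so t times the coefficient of
  \<open>\<xi>\<close> is of order t^2 as well.\<close>

lemma fc_exp_loop_zero:
  assumes \<xi>: "\<xi> \<in> smooth_loops N S" and ij: "i < N" "j < N"
    and eq: "\<And>t. fc (\<lambda>\<theta>. exp_loop t \<xi> (cis \<theta>) $$ (i, j)) m = fc (\<lambda>_. 1\<^sub>m N $$ (i, j)) m"
  shows "fc (\<lambda>\<theta>. \<xi> (cis \<theta>) $$ (i, j)) m = 0"
proof -
  note X = smooth_loopsD(4)[OF \<xi>]
  obtain C where "\<And>a b \<theta>. a < N \<Longrightarrow> b < N \<Longrightarrow> \<theta> \<in> {0..2*pi} \<Longrightarrow> norm (\<xi> (cis \<theta>) $$ (a, b)) \<le> C"
    by (rule entries_bounded[of N "{0..2*pi}" "\<lambda>\<theta>. \<xi> (cis \<theta>)"]) (use smooth_continuous[OF entry_smooth[OF \<xi>]] in auto)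
  then have C: "norm (\<xi> (cis \<theta>) $$ (a, b)) \<le> C" if "\<theta> \<in> {0..2*pi}" "a < N" "b < N" for a b \<theta>
    using that by blast
  show ?thesis
  proof (rule quadratic_bound_zero)
    fix t :: real assume t: "0 < t" "t \<le> 1"
    define e where "e \<theta> = mat_exp (of_real t \<cdot>\<^sub>m \<xi> (cis \<theta>)) $$ (i, j)" for \<theta>
    define u where "u \<theta> = \<xi> (cis \<theta>) $$ (i, j)" for \<theta>
    define k where "k = (1\<^sub>m N :: complex mat) $$ (i, j)"
    have ce: "continuous_on UNIV e" "continuous_on UNIV u"
      using entries_inD(2)[OF entries_in_exp_loop[OF \<xi>] ij] entry_smooth[OF \<xi> ij] smooth_continuous
      unfolding e_def u_def by auto
    have e: "(\<lambda>\<theta>. exp_loop t \<xi> (cis \<theta>) $$ (i, j)) = e"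
      by (simp add: exp_loop_def e_def[abs_def])
    define r where "r \<theta> = e \<theta> - k - of_real t * u \<theta>" for \<theta>
    have cr: "continuous_on UNIV r" unfolding r_def by (intro continuous_intros ce)
    have "e = (\<lambda>\<theta>. r \<theta> + (k + of_real t * u \<theta>))" by (simp add: r_def)
    moreover have "continuous_on UNIV (\<lambda>\<theta>. k + of_real t * u \<theta>)" "continuous_on UNIV (\<lambda>\<theta>. of_real t * u \<theta>)"
      by (intro continuous_intros ce)+
    ultimately have "fc e m = fc r m + (fc (\<lambda>_. k) m + of_real t * fc u m)"
      using fc_add[OF cr, of "\<lambda>\<theta>. k + of_real t * u \<theta>"] fc_add[of "\<lambda>_. k" "\<lambda>\<theta>. of_real t * u \<theta>"]
      by (simp add: fc_cmult)
    then have "of_real t * fc u m = - fc r m" using eq[of t] unfolding e k_def[symmetric] by (simp add: add_eq_0_iff)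
    moreover have "norm (fc r m) \<le> t\<^sup>2 * exp (real N * C)"
    proof (rule fc_norm_le[OF cr])
      fix \<theta> assume \<theta>: "\<theta> \<in> {0..2*pi}"
      show "norm (r \<theta>) \<le> t\<^sup>2 * exp (real N * C)"
        unfolding r_def e_def k_def u_def
        by (rule mat_exp_first_order[OF entries_inD(1)[OF X] C[OF \<theta>] ij]) (use t in auto)
    qed
    ultimately show "norm (of_real t * fc (\<lambda>\<theta>. \<xi> (cis \<theta>) $$ (i, j)) m) \<le> t\<^sup>2 * exp (real N * C)"
      by (simp add: u_def[abs_def])
  qed
qed

lemma matrix_ext_exp_smult: "matrix_ext N A f \<Longrightarrow> matrix_ext N (mat_exp (c \<cdot>\<^sub>m A)) (\<lambda>z. mat_exp (c \<cdot>\<^sub>m f z))"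
  by (rule matrix_ext_exp[OF matrix_ext_smult])

lemma inside_exp:
  assumes \<xi>: "\<xi> \<in> sl_loops N"
  shows "(\<forall>t. inside N (exp_loop t \<xi>)) \<longleftrightarrow> inside N \<xi>"
proof
  note \<xi>' = \<xi>[unfolded sl_loops_def]
  have es: "exp_loop t \<xi> \<in> smooth_loops N (SL N)" for t
    using exp_loop_SL[OF smooth_loops_mono[OF \<xi>']] \<xi> by blast
  {
    assume *: "\<forall>t. inside N (exp_loop t \<xi>)"
    show "inside N \<xi>"
      unfolding inside_entries
    proof (intro conjI ballI allI impI)
      fix i j assume ij: "i < N" "j < N"
      have "fc (\<lambda>\<theta>. \<xi> (cis \<theta>) $$ (i, j)) m = 0" if "m < 0" for m
      proof (rule fc_exp_loop_zero[OF \<xi>' ij])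
        fix t
        show "fc (\<lambda>\<theta>. exp_loop t \<xi> (cis \<theta>) $$ (i, j)) m = fc (\<lambda>_. 1\<^sub>m N $$ (i, j)) m"
          using *[rule_format, of t] ij that extends_fc(1)[OF entry_smooth[OF es[of t] ij]] unfolding inside_entries fc_const by simp
      qed
      then show "extends_inside (\<lambda>z. \<xi> z $$ (i, j))"
        using extends_fc(1)[OF entry_smooth[OF \<xi>' ij]] by simp
    qed (rule smooth_loopsD(3)[OF \<xi>'])
  }
  assume "inside N \<xi>"
  then obtain C where "matrix_ext N C \<xi>" unfolding inside_def by blast
  then show "\<forall>t. inside N (exp_loop t \<xi>)"
    unfolding inside_def exp_loop_def using matrix_ext_restrict[OF matrix_ext_exp_smult] by blast
qed

lemma outside_exp:
  assumes \<xi>: "\<xi> \<in> sl_loops N"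
  shows "(\<forall>t. outside N (1\<^sub>m N) (exp_loop t \<xi>)) \<longleftrightarrow> outside N (0\<^sub>m N N) \<xi>"
proof
  note \<xi>' = \<xi>[unfolded sl_loops_def]
  have es: "exp_loop t \<xi> \<in> smooth_loops N (SL N)" for t
    using exp_loop_SL[OF smooth_loops_mono[OF \<xi>']] \<xi> by blast
  {
    assume *: "\<forall>t. outside N (1\<^sub>m N) (exp_loop t \<xi>)"
    show "outside N (0\<^sub>m N N) \<xi>"
      unfolding outside_entries
    proof (intro conjI ballI allI impI)
      fix i j assume ij: "i < N" "j < N"
      have "fc (\<lambda>\<theta>. \<xi> (cis \<theta>) $$ (i, j)) m = 0" if "m \<ge> 0" for m
      proof (rule fc_exp_loop_zero[OF \<xi>' ij])
        fix t
        show "fc (\<lambda>\<theta>. exp_loop t \<xi> (cis \<theta>) $$ (i, j)) m = fc (\<lambda>_. 1\<^sub>m N $$ (i, j)) m"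
          using *[rule_format, of t] ij that extends_fc(2)[OF entry_smooth[OF es[of t] ij]] unfolding outside_entries by blast
      qed
      then show "extends_outside (0\<^sub>m N N $$ (i, j)) (\<lambda>z. \<xi> z $$ (i, j))"
        using extends_fc(2)[OF entry_smooth[OF \<xi>' ij], of 0] ij by (simp add: fc_const)
    qed (use smooth_loopsD(3)[OF \<xi>'] in auto)
  }
  assume "outside N (0\<^sub>m N N) \<xi>"
  \<comment> \<open>The value 0 at infinity is carried to exp 0, the identity, which is the
    normalisation of the minus group.\<close>
  then have "matrix_ext N (mat_exp (of_real t \<cdot>\<^sub>m 0\<^sub>m N N)) (\<lambda>z. mat_exp (of_real t \<cdot>\<^sub>m \<xi> (1 / z)))" for t
    unfolding outside_def by (rule matrix_ext_exp_smult)
  moreover have "c \<cdot>\<^sub>m 0\<^sub>m N N = 0\<^sub>m N N" for c :: complex by (rule eq_matI) auto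
  ultimately show "\<forall>t. outside N (1\<^sub>m N) (exp_loop t \<xi>)"
    unfolding exp_loop_def by (intro allI outside_restrict) (simp add: mat_exp_zero)
qed

section \<open>The splitting\<close>

text \<open>In the coordinate w = 1/z the exponents become d - m, all at least 1 because the degree
  bound is strict; hence the value 0 at infinity.\<close>

lemma extends_outside_polydeg:
  assumes "polydeg d f"
  shows "extends_outside 0 (\<lambda>z. (1 / z) ^ d * f z)"
proof -
  obtain c where c: "\<And>z. f z = (\<Sum>m<d. c m * z ^ m)" using assms by (auto simp: polydeg_def)
  show ?thesis
    unfolding extends_outside_def
  proof (intro bexI conjI ballI)
    show "(\<lambda>w. \<Sum>m<d. c m * w ^ (d - m)) \<in> disc_fun"
      by (auto simp: disc_fun_def intro!: continuous_intros holomorphic_intros)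
    show "(\<Sum>m<d. c m * 0 ^ (d - m)) = 0" by (intro sum.neutral) auto
    fix z :: complex assume "z \<in> circle"
    then have z0: "z \<noteq> 0" using circle_nonzero by blast
    have "z ^ (d - m) = z ^ d * (1 / z) ^ m" if "m < d" for m
    proof -
      have "z ^ d = z ^ (d - m) * z ^ m" using that by (simp add: power_add[symmetric])
      then show ?thesis using z0 by (simp add: power_divide)
    qed
    then show "(\<Sum>m<d. c m * z ^ (d - m)) = (1 / (1 / z)) ^ d * f (1 / z)"
      by (simp add: c sum_distrib_left mult.left_commute)
  qed
qed

text \<open>The rearrangement behind \<open>\<zeta>_form\<close>: one factor \<open>s\<close> stays
  with the left matrix, the other moves to the right one.\<close>

lemma sum_distrib_two:
  fixes s :: complex
  shows "(\<Sum>j\<in>J. (\<Sum>i\<in>I. s * x i j + y i j * s) * r j) =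
    s * (\<Sum>j\<in>J. (\<Sum>i\<in>I. x i j) * r j) + (\<Sum>j\<in>J. (\<Sum>i\<in>I. y i j) * (s * r j))"
proof -
  have "(\<Sum>i\<in>I. s * x i j + y i j * s) * r j = s * ((\<Sum>i\<in>I. x i j) * r j) + (\<Sum>i\<in>I. y i j) * (s * r j)" for j
    unfolding sum.distrib sum_distrib_left[symmetric] sum_distrib_right[symmetric] by (simp add: algebra_simps)
  then show ?thesis by (simp only: sum.distrib sum_distrib_left)
qed

lemma splitting_decomposition:
  assumes n: "n \<ge> 1" and \<xi>: "\<xi> \<in> lie_L n"
  obtains \<eta> \<zeta> where "\<eta> \<in> lie_L_plus n" "\<zeta> \<in> lie_L_minus n" "\<xi> = (\<lambda>z\<in>circle. \<eta> z + \<zeta> z)"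
proof -
  let ?d = "2 * n" and ?w = "cis (2 * pi / real (2 * n))"
  have d: "?d > 0" using n by simp
  have \<xi>s: "\<xi> \<in> smooth_loops ?d (sl ?d)" and tw: "twisted n \<xi>"
    using \<xi> unfolding lie_L_eq[OF n] sl_loops_def by auto
  note \<xi>c = smooth_loopsD(3)[OF \<xi>s]
  define Y where "Y z = psi_conj_at n z (\<xi> z)" for z
  have Yc: "Y z \<in> carrier_mat ?d ?d" if "z \<in> circle" for z
    unfolding Y_def by (rule psi_conj_at_carrier[OF \<xi>c[OF that]])
  have Ys: "entries_in (Collect smooth) ?d (\<lambda>t. Y (cis t))"
    unfolding Y_def psi_conj_at_def
    by (intro entries_in_mult[OF ring_closed_smooth] entries_in_psi entries_in_psi_inv smooth_loopsD(4)[OF \<xi>s])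
  have Yinv: "Y (?w * z) = Y z" if "z \<in> circle" for z
    using tw that unfolding twisted_conj Y_def by blast
  \<comment> \<open>The data split off from one entry are packed into a tuple, so that a single
    choice provides them for all entries.\<close>
  define Q where "Q i j q \<longleftrightarrow> (case q of (p, c, v, c') \<Rightarrow>
      smooth (\<lambda>t. p (cis t)) \<and> extends_inside p \<and> (\<forall>z\<in>circle. p (?w * z) = p z) \<and> extends_outside c' v \<and>
      (\<forall>z\<in>circle. Y z $$ (i, j) = p z + c * (1 / z) ^ ?d + (1 / z) ^ (2 * ?d) * v z))" for i j q
  have "\<exists>q. Q i j q" if ij: "i < ?d" "j < ?d" for i j
  proof -
    have Yij: "smooth (\<lambda>t. Y (cis t) $$ (i, j))" using entries_inD(2)[OF Ys ij] by simp
    have "Y (?w * z) $$ (i, j) = Y z $$ (i, j)" if "z \<in> circle" for z by (simp only: Yinv[OF that])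
    from invariant_split[OF Yij d this] obtain p c v c' where "smooth (\<lambda>t. p (cis t))" "extends_inside p"
      "\<And>z. z \<in> circle \<Longrightarrow> p (?w * z) = p z" "extends_outside c' v"
      "\<And>z. z \<in> circle \<Longrightarrow> Y z $$ (i, j) = p z + c * (1 / z) ^ ?d + (1 / z) ^ (2 * ?d) * v z"
      by metis
    then show ?thesis unfolding Q_def by (intro exI[of _ "(p, c, v, c')"]) blast
  qed
  then obtain q where q: "\<And>i j. i < ?d \<Longrightarrow> j < ?d \<Longrightarrow> Q i j (q i j)" by metis
  define p where "p i j = fst (q i j)" for i j
  define c where "c i j = fst (snd (q i j))" for i j
  define v where "v i j = fst (snd (snd (q i j)))" for i j
  define c' where "c' i j = snd (snd (snd (q i j)))" for i j
  have p: "\<And>i j. i < ?d \<Longrightarrow> j < ?d \<Longrightarrow> smooth (\<lambda>t. p i j (cis t))" "\<And>i j. i < ?d \<Longrightarrow> j < ?d \<Longrightarrow> extends_inside (p i j)"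
      "\<And>i j z. i < ?d \<Longrightarrow> j < ?d \<Longrightarrow> z \<in> circle \<Longrightarrow> p i j (?w * z) = p i j z" and
    v: "\<And>i j. i < ?d \<Longrightarrow> j < ?d \<Longrightarrow> extends_outside (c' i j) (v i j)" and
    eq: "\<And>i j z. i < ?d \<Longrightarrow> j < ?d \<Longrightarrow> z \<in> circle \<Longrightarrow>
        Y z $$ (i, j) = p i j z + c i j * (1 / z) ^ ?d + (1 / z) ^ (2 * ?d) * v i j z"
    using q unfolding Q_def p_def c_def v_def c'_def case_prod_unfold by blast+
  define E where "E = mat ?d ?d (\<lambda>(i, j). c i j)"
  define V where "V z = mat ?d ?d (\<lambda>(i, j). v i j z)" for z
  have E: "E \<in> carrier_mat ?d ?d" and V: "V z \<in> carrier_mat ?d ?d" for z by (simp_all add: E_def V_def)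
  obtain P where P: "P \<in> carrier_mat ?d ?d"
    and Pdeg: "\<And>a b. a < ?d \<Longrightarrow> b < ?d \<Longrightarrow> polydeg ?d (\<lambda>z. (psi_inv n z * (E - z ^ ?d \<cdot>\<^sub>m P) * psi n z) $$ (a, b))"
    using psi_conj_reduce[OF n E] by blast
  \<comment> \<open>Adding the constant \<open>P\<close> keeps the invariance under the rotation, so
    its conjugate is twisted; the conjugate is polynomial, so it still extends inside.\<close>
  define Y' where "Y' z = mat ?d ?d (\<lambda>(i, j). p i j z) + P" for z
  have Y'c: "Y' z \<in> carrier_mat ?d ?d" for z using P by (simp add: Y'_def)
  define \<eta> where "\<eta> = (\<lambda>z\<in>circle. psi_inv n z * Y' z * psi n z)"
  have \<eta>s: "\<eta> \<in> smooth_loops ?d (carrier_mat ?d ?d)"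
    unfolding \<eta>_def
  proof (rule restrict_smooth_loops)
    have "entries_in (Collect smooth) ?d (\<lambda>t. mat ?d ?d (\<lambda>(i, j). p i j (cis t)))"
      by (rule entries_inI) (use p(1) in auto)
    then show "entries_in (Collect smooth) ?d (\<lambda>t. psi_inv n (cis t) * Y' (cis t) * psi n (cis t))"
      unfolding Y'_def
      by (intro entries_in_mult[OF ring_closed_smooth] entries_in_psi entries_in_psi_inv
          entries_in_add[OF ring_closed_smooth] entries_in_const[OF ring_closed_smooth] P)
  qed (intro mult_carrier_mat[of _ ?d ?d] psi_inv_carrier psi_carrier Y'c)
  note \<eta>c = smooth_loopsD(2)[OF \<eta>s]
  have conj\<eta>: "psi_conj_at n z (\<eta> z) = Y' z" if "z \<in> circle" for z
  proof -
    have "psi_conj_at n z (\<eta> z) = psi n z * (psi_inv n z * (Y' z * psi n z)) * psi_inv n z"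
      using that assoc_mult_mat[OF psi_inv_carrier Y'c psi_carrier, of z z z] by (simp add: psi_conj_at_def \<eta>_def)
    also have "\<dots> = Y' z * psi n z * psi_inv n z"
      by (simp only: psi_cancel(2)[OF mult_carrier_mat[OF Y'c psi_carrier]])
    also have "\<dots> = Y' z"
      unfolding assoc_mult_mat[OF Y'c psi_carrier psi_inv_carrier] psi_inverse by (rule right_mult_one_mat[OF Y'c])
    finally show ?thesis .
  qed
  have tw\<eta>: "twisted n \<eta>"
    unfolding twisted_conj
  proof
    fix z assume z: "z \<in> circle"
    have "Y' (?w * z) = Y' z"
      unfolding Y'_def by (rule arg_cong[where f = "\<lambda>X. X + P"], rule eq_matI) (simp_all add: p(3)[OF _ _ z] del: of_nat_mult)
    then show "psi_conj_at n (?w * z) (\<eta> (?w * z)) = psi_conj_at n z (\<eta> z)"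
      unfolding conj\<eta>[OF z] conj\<eta>[OF rot_in_circle[OF z]] .
  qed
  have in\<eta>: "inside ?d \<eta>"
  proof -
    have "inside ?d (\<lambda>z. mat ?d ?d (\<lambda>(i, j). p i j z))"
      unfolding inside_entries using p(2) by simp
    then obtain C where C: "matrix_ext ?d C (\<lambda>z. mat ?d ?d (\<lambda>(i, j). p i j z))"
      unfolding inside_def by blast
    have "matrix_ext ?d (psi n 0) (psi n)" "matrix_ext ?d (psi_inv n 0) (psi_inv n)"
      unfolding matrix_ext_def using entries_in_disc_psi entries_in_disc_psi_inv by blast+
    from matrix_ext_mult[OF matrix_ext_mult[OF this(2) matrix_ext_add[OF C matrix_ext_const[OF P]]] this(1)]
    show ?thesis
      unfolding inside_def \<eta>_def Y'_def by (intro exI matrix_ext_restrict)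
  qed
  define \<zeta> where "\<zeta> = (\<lambda>z\<in>circle. \<xi> z + (\<lambda>z\<in>circle. (-1) \<cdot>\<^sub>m \<eta> z) z)"
  define \<eta>' where "\<eta>' = (\<lambda>z\<in>circle. (-1) \<cdot>\<^sub>m \<eta> z)"
  have \<eta>'s: "\<eta>' \<in> smooth_loops ?d (carrier_mat ?d ?d)"
    unfolding \<eta>'_def by (rule smooth_loops_smult[OF \<eta>s]) (use \<eta>c in auto)
  have \<zeta>_eq: "\<zeta> = (\<lambda>z\<in>circle. \<xi> z + \<eta>' z)" by (simp add: \<zeta>_def \<eta>'_def)
  note \<xi>s' = smooth_loops_mono[OF \<xi>s]
  have \<zeta>s: "\<zeta> \<in> smooth_loops ?d (carrier_mat ?d ?d)"
    unfolding \<zeta>_eq by (rule smooth_loops_add[OF \<xi>s \<eta>'s]) (use \<xi>c smooth_loopsD(2)[OF \<eta>'s] in auto)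
  have tw\<zeta>: "twisted n \<zeta>"
  proof -
    have "twisted n \<eta>'"
      using twisted_alg_pred[of n] \<eta>s tw\<eta> unfolding alg_pred_def \<eta>'_def by blast
    then show ?thesis
      using twisted_alg_pred[of n] \<xi>s' \<eta>'s tw unfolding alg_pred_def \<zeta>_eq by blast
  qed
  \<comment> \<open>The factor \<open>(1 / z) ^ (2 * ?d)\<close> of \<open>V\<close> is divided
    evenly between \<open>psi_inv\<close> and \<open>psi\<close>, so each becomes holomorphic
    outside and vanishes at infinity. The first summand has this property by the choice of
    \<open>P\<close>.\<close>
  have \<zeta>_form: "\<zeta> z = (1 / z) ^ ?d \<cdot>\<^sub>m (psi_inv n z * (E - z ^ ?d \<cdot>\<^sub>m P) * psi n z) +
      ((1 / z) ^ ?d \<cdot>\<^sub>m psi_inv n z) * V z * ((1 / z) ^ ?d \<cdot>\<^sub>m psi n z)" if z: "z \<in> circle" for z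
  proof -
    let ?s = "(1 / z) ^ ?d"
    have sz: "?s * z ^ ?d = 1" using circle_nonzero[OF z] by (simp add: power_divide)
    have s2: "(1 / z) ^ (2 * ?d) = ?s * ?s" by (simp only: mult_2[of "2 * n"] power_add)
    have \<xi>z: "\<xi> z = psi_inv n z * Y z * psi n z"
    proof -
      have "psi_inv n z * Y z * psi n z = psi_inv n z * (psi n z * (\<xi> z * psi_inv n z)) * psi n z"
        unfolding Y_def psi_conj_at_def assoc_mult_mat[OF psi_carrier \<xi>c[OF z] psi_inv_carrier] ..
      also have "\<dots> = \<xi> z * psi_inv n z * psi n z"
        by (simp only: psi_cancel(1)[OF mult_carrier_mat[OF \<xi>c[OF z] psi_inv_carrier]])
      also have "\<dots> = \<xi> z"
        unfolding assoc_mult_mat[OF \<xi>c[OF z] psi_inv_carrier psi_carrier] psi_inverse by (rule right_mult_one_mat[OF \<xi>c[OF z]])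
      finally show ?thesis ..
    qed
    have EP: "E - z ^ ?d \<cdot>\<^sub>m P \<in> carrier_mat ?d ?d" using E P by auto
    show ?thesis
    proof (rule eq_matI)
      let ?R = "?s \<cdot>\<^sub>m (psi_inv n z * (E - z ^ ?d \<cdot>\<^sub>m P) * psi n z) + (?s \<cdot>\<^sub>m psi_inv n z) * V z * (?s \<cdot>\<^sub>m psi n z)"
      note Q = psi_inv_carrier[of n z] and R = psi_carrier[of n z]
      have c3: "A * X * B \<in> carrier_mat ?d ?d" if "A \<in> carrier_mat ?d ?d" "X \<in> carrier_mat ?d ?d" "B \<in> carrier_mat ?d ?d" for A X B :: "complex mat"
        by (intro mult_carrier_mat[of _ ?d ?d] that)
      have Rc: "?R \<in> carrier_mat ?d ?d"
        by (intro add_carrier_mat smult_carrier_mat c3 Q R V EP)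
      fix a b assume "a < dim_row ?R" "b < dim_col ?R"
      then have ab: "a < ?d" "b < ?d" using Rc by auto
      have "\<zeta> z $$ (a, b) = \<xi> z $$ (a, b) - \<eta> z $$ (a, b)"
        using z ab \<xi>c[OF z] \<eta>c[OF z] by (simp add: \<zeta>_def)
      also have "\<dots> = (\<Sum>j<?d. (\<Sum>i<?d. psi_inv n z $$ (a, i) * (Y z $$ (i, j) - Y' z $$ (i, j))) * psi n z $$ (j, b))"
        using z unfolding \<xi>z \<eta>_def restrict_def
        by (simp add: mat_mult3_entry[OF Q Yc[OF z] R ab] mat_mult3_entry[OF Q Y'c R ab] right_diff_distrib left_diff_distrib sum_subtractf del: index_mult_mat(1))
      also have "\<dots> = (\<Sum>j<?d. (\<Sum>i<?d. ?s * (psi_inv n z $$ (a, i) * (E - z ^ ?d \<cdot>\<^sub>m P) $$ (i, j)) +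
          (?s \<cdot>\<^sub>m psi_inv n z) $$ (a, i) * V z $$ (i, j) * ?s) * psi n z $$ (j, b))"
      proof (intro sum.cong refl arg_cong2[where f = "(*)"])
        fix i j assume "j \<in> {..<?d}" "i \<in> {..<?d}"
        then have ij: "i < ?d" "j < ?d" by auto
        have "Y z $$ (i, j) - Y' z $$ (i, j) = c i j * ?s + ?s * ?s * v i j z - P $$ (i, j)"
          using ij P eq[OF ij z] unfolding s2 Y'_def by simp
        also have "\<dots> = ?s * (c i j - z ^ ?d * P $$ (i, j)) + ?s * ?s * v i j z"
          using sz by (simp add: algebra_simps)
        finally have y: "Y z $$ (i, j) - Y' z $$ (i, j) = ?s * (c i j - z ^ ?d * P $$ (i, j)) + ?s * ?s * v i j z" .
        have m: "(E - z ^ ?d \<cdot>\<^sub>m P) $$ (i, j) = c i j - z ^ ?d * P $$ (i, j)" "V z $$ (i, j) = v i j z"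
          "(?s \<cdot>\<^sub>m psi_inv n z) $$ (a, i) = ?s * psi_inv n z $$ (a, i)"
          using ij ab P carrier_matD[OF Q] by (simp_all add: E_def V_def)
        show "psi_inv n z $$ (a, i) * (Y z $$ (i, j) - Y' z $$ (i, j)) =
          ?s * (psi_inv n z $$ (a, i) * (E - z ^ ?d \<cdot>\<^sub>m P) $$ (i, j)) + (?s \<cdot>\<^sub>m psi_inv n z) $$ (a, i) * V z $$ (i, j) * ?s"
          unfolding y m by (simp only: distrib_left mult_ac)
      qed
      also have "\<dots> = ?R $$ (a, b)"
      proof -
        have r: "(?s \<cdot>\<^sub>m psi n z) $$ (j, b) = ?s * psi n z $$ (j, b)" if "j < ?d" for j
          using that ab carrier_matD[OF R] by simp
        note X = c3[OF Q EP R] and W = c3[OF smult_carrier_mat[OF Q, of ?s] V[of z] smult_carrier_mat[OF R, of ?s]]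
        have "?R $$ (a, b) = ?s * (psi_inv n z * (E - z ^ ?d \<cdot>\<^sub>m P) * psi n z) $$ (a, b)
            + ((?s \<cdot>\<^sub>m psi_inv n z) * V z * (?s \<cdot>\<^sub>m psi n z)) $$ (a, b)"
          by (simp only: index_add_mat(1) index_smult_mat(1) carrier_matD[OF X] carrier_matD[OF W] ab)
        also have "((?s \<cdot>\<^sub>m psi_inv n z) * V z * (?s \<cdot>\<^sub>m psi n z)) $$ (a, b) =
            (\<Sum>j<?d. (\<Sum>i<?d. (?s \<cdot>\<^sub>m psi_inv n z) $$ (a, i) * V z $$ (i, j)) * (?s * psi n z $$ (j, b)))"
          unfolding mat_mult3_entry[OF smult_carrier_mat[OF Q] V smult_carrier_mat[OF R] ab]
          by (intro sum.cong refl) (simp only: r lessThan_iff)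
        finally show ?thesis
          unfolding mat_mult3_entry[OF Q EP R ab] sum_distrib_two by (rule sym)
      qed
      finally show "\<zeta> z $$ (a, b) = ?R $$ (a, b)" .
    next
      show "dim_row (\<zeta> z) = dim_row (?s \<cdot>\<^sub>m (psi_inv n z * (E - z ^ ?d \<cdot>\<^sub>m P) * psi n z) + (?s \<cdot>\<^sub>m psi_inv n z) * V z * (?s \<cdot>\<^sub>m psi n z))"
        "dim_col (\<zeta> z) = dim_col (?s \<cdot>\<^sub>m (psi_inv n z * (E - z ^ ?d \<cdot>\<^sub>m P) * psi n z) + (?s \<cdot>\<^sub>m psi_inv n z) * V z * (?s \<cdot>\<^sub>m psi n z))"
        using smooth_loopsD(2)[OF \<zeta>s z] carrier_matD[OF psi_carrier[of n z]] carrier_matD[OF psi_inv_carrier[of n z]] by auto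
    qed
  qed
  have out\<zeta>: "outside ?d (0\<^sub>m ?d ?d) \<zeta>"
  proof -
    let ?Z = "0\<^sub>m ?d ?d :: complex mat"
    define C' where "C' = mat ?d ?d (\<lambda>(i, j). c' i j)"
    have 1: "outside ?d ?Z (\<lambda>z. (1 / z) ^ ?d \<cdot>\<^sub>m (psi_inv n z * (E - z ^ ?d \<cdot>\<^sub>m P) * psi n z))"
      unfolding outside_entries
      using extends_outside_polydeg[OF Pdeg] carrier_matD[OF psi_carrier[of n]] carrier_matD[OF psi_inv_carrier[of n]]
      by (auto simp del: index_mult_mat(1) intro!: mult_carrier_mat[of _ ?d ?d] psi_carrier psi_inv_carrier minus_carrier_mat smult_carrier_mat P)
    have 2: "outside ?d ?Z (\<lambda>z. (1 / z) ^ ?d \<cdot>\<^sub>m psi_inv n z)" "outside ?d ?Z (\<lambda>z. (1 / z) ^ ?d \<cdot>\<^sub>m psi n z)"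
      unfolding outside_entries
      using extends_outside_polydeg[OF polydeg_psi_inv_entry] extends_outside_polydeg[OF polydeg_psi_entry] carrier_matD[OF psi_carrier[of n]]
      by (simp_all add: psi_index psi_inv_def)
    have 3: "outside ?d C' V"
      unfolding outside_entries using v V by (simp add: C'_def V_def)
    have "?Z + ?Z * C' * ?Z = ?Z"
      using left_mult_zero_mat[of C' ?d ?d ?d] by (simp add: C'_def)
    with matrix_ext_add[OF 1[unfolded outside_def] matrix_ext_mult[OF matrix_ext_mult[OF 2(1)[unfolded outside_def] 3[unfolded outside_def]] 2(2)[unfolded outside_def]]]
    show ?thesis
      unfolding outside_def by (intro matrix_ext_cong[where g = "\<lambda>z. \<zeta> (1 / z)"]) (simp_all add: \<zeta>_form[OF inverse_in_circle])
  qed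
  \<comment> \<open>Since the trace of \<open>\<xi>\<close> is zero, the trace of
    \<open>\<eta>\<close> is minus that of \<open>\<zeta>\<close>: it extends inside as the one and
    outside, with value 0 at infinity, as the other.\<close>
  have trace: "mat_trace (\<eta> z) = 0" if z: "z \<in> circle" for z
  proof (rule extends_inside_outside[of "\<lambda>z. mat_trace (\<eta> z)"])
    have tr: "mat_trace (f z) = (\<Sum>i<?d. f z $$ (i, i))" if "f \<in> smooth_loops ?d S" "z \<in> circle" for f S z
      using smooth_loopsD(3)[OF that] by (simp add: mat_trace_def)
    have "(\<lambda>t. \<Sum>i<?d. \<eta> (cis t) $$ (i, i)) \<in> Collect smooth"
      by (intro ring_closed_sum[OF ring_closed_smooth]) (use entry_smooth[OF \<eta>s] in auto)
    then show "smooth (\<lambda>t. mat_trace (\<eta> (cis t)))" by (simp add: tr[OF \<eta>s])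
    obtain F C where F: "entries_in disc_fun ?d F" "\<And>z. z \<in> circle \<Longrightarrow> F z = \<eta> z"
      using in\<eta> unfolding inside_def matrix_ext_def by blast
    show "extends_inside (\<lambda>z. mat_trace (\<eta> z))"
      unfolding extends_inside_def
    proof (intro bexI ballI)
      show "(\<lambda>z. \<Sum>i<?d. F z $$ (i, i)) \<in> disc_fun"
        by (intro ring_closed_sum[OF ring_closed_disc_fun] entries_inD(2)[OF F(1)]) auto
    qed (simp add: F(2) tr[OF \<eta>s])
    obtain G where G: "entries_in disc_fun ?d G" "G 0 = 0\<^sub>m ?d ?d" "\<And>z. z \<in> circle \<Longrightarrow> G z = \<zeta> (1 / z)"
      using out\<zeta> unfolding outside_def matrix_ext_def by blast
    show "extends_outside 0 (\<lambda>z. mat_trace (\<eta> z))"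
      unfolding extends_outside_def
    proof (intro bexI conjI ballI)
      show "(\<lambda>z. \<Sum>i<?d. (-1) * G z $$ (i, i)) \<in> disc_fun"
        by (intro ring_closed_sum[OF ring_closed_disc_fun] ring_closed_simps[OF ring_closed_disc_fun] entries_inD(2)[OF G(1)]) auto
      show "(\<Sum>i<?d. (-1) * G 0 $$ (i, i)) = 0" by (simp add: G(2))
      fix z :: complex assume z: "z \<in> circle"
      note iz = inverse_in_circle[OF z]
      have "\<zeta> (1 / z) $$ (i, i) = \<xi> (1 / z) $$ (i, i) - \<eta> (1 / z) $$ (i, i)" if "i < ?d" for i
        using that iz \<xi>c[OF iz] \<eta>c[OF iz] by (simp add: \<zeta>_def)
      moreover have "(\<Sum>i<?d. \<xi> (1 / z) $$ (i, i)) = 0"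
        using smooth_loopsD(2)[OF \<xi>s iz] tr[OF \<xi>s iz] by (simp add: sl_def)
      ultimately show "(\<Sum>i<?d. (-1) * G z $$ (i, i)) = mat_trace (\<eta> (1 / z))"
        using G(3)[OF z] by (simp add: tr[OF \<eta>s iz] sum_subtractf sum_negf)
    qed
  qed (rule z)
  have \<eta>sl: "\<eta> \<in> sl_loops ?d"
    using \<eta>s trace \<eta>c by (simp add: sl_loops_def smooth_loops_iff sl_def)
  have "\<zeta> z \<in> sl ?d" if z: "z \<in> circle" for z
    using z smooth_loopsD(2)[OF \<xi>s z] \<eta>c[OF z] trace[OF z] smooth_loopsD(2)[OF \<zeta>s z]
    by (simp add: \<zeta>_def sl_def mat_trace_add[of _ ?d] mat_trace_smult[of _ ?d])
  then have \<zeta>sl: "\<zeta> \<in> sl_loops ?d"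
    using \<zeta>s by (simp add: sl_loops_def smooth_loops_iff)
  show thesis
  proof (rule that)
    show "\<eta> \<in> lie_L_plus n" using \<eta>sl tw\<eta> in\<eta> unfolding lie_L_plus_def lie_L_eq[OF n] sl_loops_plus_eq by blast
    show "\<zeta> \<in> lie_L_minus n" using \<zeta>sl tw\<zeta> out\<zeta> unfolding lie_L_minus_def lie_L_eq[OF n] sl_loops_minus_eq by blast
    have "\<eta> z + \<zeta> z = \<xi> z" if z: "z \<in> circle" for z
      by (rule eq_matI) (use z \<xi>c[OF z] \<eta>c[OF z] in \<open>auto simp: \<zeta>_def\<close>)
    then have "(\<lambda>z\<in>circle. \<eta> z + \<zeta> z) = \<xi>"
      by (rule restrict_circle_eqI[OF smooth_loopsD(1)[OF \<xi>s]])
    then show "\<xi> = (\<lambda>z\<in>circle. \<eta> z + \<zeta> z)" ..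
  qed
qed

lemma inside_outside_unique:
  assumes f: "f \<in> smooth_loops N S" and "inside N f" "outside N C f"
  shows "f = (\<lambda>z\<in>circle. C)"
proof -
  have "f z = C" if z: "z \<in> circle" for z
  proof (rule eq_matI)
    have C: "C \<in> carrier_mat N N" using assms(3) unfolding outside_entries by blast
    show "dim_row (f z) = dim_row C" "dim_col (f z) = dim_col C"
      using C smooth_loopsD(3)[OF f z] by auto
    fix i j assume "i < dim_row C" "j < dim_col C"
    then have ij: "i < N" "j < N" using C by auto
    show "f z $$ (i, j) = C $$ (i, j)"
      using extends_inside_outside[OF entry_smooth[OF f ij] _ _ z] assms(2,3) ij
      unfolding inside_entries outside_entries by blast
  qed
  then show ?thesis by (intro restrict_circle_eqI[OF smooth_loopsD(1)[OF f], symmetric]) simp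
qed

theorem mainTheorem2:
  fixes n :: nat
  assumes "n \<ge> 1"
  shows "splitting (2 * n) (grp_L n) (grp_L_plus n) (grp_L_minus n)
           (lie_L n) (lie_L_plus n) (lie_L_minus n)"
proof -
  let ?N = "2 * n"
  have G: "grp_L n = {f \<in> smooth_loops ?N (SL ?N). twisted n f}"
    "grp_L_plus n = {f \<in> smooth_loops ?N (SL ?N). twisted n f \<and> inside ?N f}"
    "grp_L_minus n = {f \<in> smooth_loops ?N (SL ?N). twisted n f \<and> outside ?N (1\<^sub>m ?N) f}"
    unfolding grp_L_plus_eq grp_L_minus_eq grp_L_eq[OF assms] by blast+
  have L: "lie_L n = {f \<in> sl_loops ?N. twisted n f}"
    "lie_L_plus n = {f \<in> sl_loops ?N. twisted n f \<and> inside ?N f}"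
    "lie_L_minus n = {f \<in> sl_loops ?N. twisted n f \<and> outside ?N (0\<^sub>m ?N ?N) f}"
    unfolding lie_L_plus_def lie_L_minus_def sl_loops_plus_eq sl_loops_minus_eq lie_L_eq[OF assms] by blast+
  have sub: "subgroup (grp_L n) (loop_group ?N)" "subgroup (grp_L_plus n) (loop_group ?N)" "subgroup (grp_L_minus n) (loop_group ?N)"
    unfolding G by (intro subgroup_group_pred group_pred_conj twisted_group_pred inside_group_pred outside_group_pred)+
  have lie: "lie_subalgebra ?N (lie_L n)" "lie_subalgebra ?N (lie_L_plus n)" "lie_subalgebra ?N (lie_L_minus n)"
    unfolding L by (intro lie_subalgebra_alg_pred alg_pred_conj twisted_alg_pred inside_alg_pred outside_alg_pred)+
  have lie_of: "lie_algebra_of ?N (grp_L n) = lie_L n" "lie_algebra_of ?N (grp_L_plus n) = lie_L_plus n"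
    "lie_algebra_of ?N (grp_L_minus n) = lie_L_minus n"
    unfolding G L
    by (rule lie_algebra_of_eq, simp only: all_conj_distrib twisted_exp inside_exp outside_exp)+
  have le: "grp_L_plus n \<subseteq> grp_L n" "grp_L_minus n \<subseteq> grp_L n" unfolding G by blast+
  have sum: "lie_L n = lie_L_plus n <+>\<^bsub>gl_loops ?N\<^esub> lie_L_minus n"
  proof (intro equalityI subsetI)
    fix \<xi> assume "\<xi> \<in> lie_L n"
    then obtain \<eta> \<zeta> where "\<eta> \<in> lie_L_plus n" "\<zeta> \<in> lie_L_minus n" "\<xi> = (\<lambda>z\<in>circle. \<eta> z + \<zeta> z)"
      using splitting_decomposition[OF assms] by blast
    then show "\<xi> \<in> lie_L_plus n <+>\<^bsub>gl_loops ?N\<^esub> lie_L_minus n"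
      unfolding set_add_def' by auto
  next
    fix \<xi> assume "\<xi> \<in> lie_L_plus n <+>\<^bsub>gl_loops ?N\<^esub> lie_L_minus n"
    then obtain \<eta> \<zeta> where \<eta>\<zeta>: "\<eta> \<in> lie_L n" "\<zeta> \<in> lie_L n" "\<xi> = add (gl_loops ?N) \<eta> \<zeta>"
      unfolding set_add_def' lie_L_plus_def lie_L_minus_def by auto
    have "submodule class_ring (lie_L n) (gl_loops ?N)"
      using lie(1) unfolding lie_subalgebra_def VectorSpace.subspace_def by blast
    then show "\<xi> \<in> lie_L n" unfolding \<eta>\<zeta>(3) using \<eta>\<zeta>(1,2) by (rule submodule.m_closed)
  qed
  have int: "lie_L_plus n \<inter> lie_L_minus n = {zero (gl_loops ?N)}"
  proof (intro equalityI subsetI)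
    fix f assume "f \<in> lie_L_plus n \<inter> lie_L_minus n"
    then have "f = (\<lambda>z\<in>circle. 0\<^sub>m ?N ?N)"
      unfolding L sl_loops_def using inside_outside_unique[of f ?N "sl ?N"] by blast
    then show "f \<in> {zero (gl_loops ?N)}" by simp
  next
    have "submodule class_ring V (gl_loops ?N)" if "lie_subalgebra ?N V" for V
      using that unfolding lie_subalgebra_def VectorSpace.subspace_def by blast
    then show "f \<in> lie_L_plus n \<inter> lie_L_minus n" if "f \<in> {zero (gl_loops ?N)}" for f
      using that lie(2,3) submodule.zero_closed by blast
  qed
  \<comment> \<open>The normalisation at infinity leaves only the identity among the constant
    loops.\<close>
  have int': "grp_L_plus n \<inter> grp_L_minus n = {one (loop_group ?N)}"
  proof (intro equalityI subsetI)
    fix f assume "f \<in> grp_L_plus n \<inter> grp_L_minus n"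
    then have "f = (\<lambda>z\<in>circle. 1\<^sub>m ?N)"
      unfolding G using inside_outside_unique[of f ?N "SL ?N"] by blast
    then show "f \<in> {one (loop_group ?N)}" by simp
  qed (use sub(2,3) subgroup.one_closed in blast)
  have incl: "subgroup (grp_L_plus n) ((loop_group ?N)\<lparr>carrier := grp_L n\<rparr>)"
    "subgroup (grp_L_minus n) ((loop_group ?N)\<lparr>carrier := grp_L n\<rparr>)"
    by (rule group.subgroup_incl[OF group_loop_group sub(2) sub(1) le(1)])
       (rule group.subgroup_incl[OF group_loop_group sub(3) sub(1) le(2)])
  show ?thesis
    unfolding splitting_def by (intro conjI group_loop_group sub incl lie lie_of sum int int')
qed

end
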